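(* There exist constants $\varepsilon_{\mathcal L}>0$ and $C_{\mathrm{qb}}>0$ that depend exclusively on the elliptic operator $\mathcal L$ (in particular, they are independent of the interface $\Sigma$, of the datum $f$, and of the discrete spaces $\mathcal V_d$ and $B_h$) such that the following holds. Let $\mathcal V_d\subset \mathcal V$ and $B_h\subset B$ be finite-dimensional subspaces, let $f\in H^{1/2}(\Sigma)$, and let $b\in B=H^{-1/2}(\Sigma)$ be the unique solution of $\mathsf V b=f$. If $$\varepsilon_{\mathrm{con}}:=\sup_{0\neq g_h,h_h\in B_h}\frac{\left|\left\langle(\mathsf V-\mathsf V_d)g_h,\overline{h_h}\right\rangle_{X\times B}\right|}{\|g_h\|_{B}\|h_h\|_{B}}\le\varepsilon_{\mathcal L},$$ then the discrete problem of finding $b_h\in B_h$ with $$\langle \mathsf V_d b_h,\overline{g_h}\rangle_{X\times B}=\langle f,\overline{g_h}\rangle_{X\times B}\qquad\text{for all }g_h\in B_h$$ admits a unique solution $b_h\in B_h$, and $$C_{\mathrm{qb}}^{-1}\|b-b_h\|_{H^{-1/2}(\Sigma)}\le\min_{g_h\in B_h}\|b-g_h\|_{H^{-1/2}(\Sigma)}+\min_{v_d\in\mathcal V_d}\|\mathcal S b-v_d\|_{H^1(\Omega)}.$$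
   Context: All spaces are complex. For a Banach space $Y$, $Y'$ is its space of bounded linear functionals with bilinear duality pairings $\langle\cdot,\cdot\rangle_{Y'\times Y}$ and $\langle y,y'\rangle_{Y\times Y'}=\langle y',y\rangle_{Y'\times Y}$; the overline is complex conjugation of functions, extended to functionals by $\langle\overline{y'},y\rangle=\overline{\langle y',\overline y\rangle}$. Setting. Let $\Omega\subset\mathbb R^n$, $n\ge2$, be a Lipschitz domain, $\Gamma_{\mathrm D}\subset\partial\Omega$ relatively closed, $\Gamma_{\mathrm N}:=\partial\Omega\setminus\Gamma_{\mathrm D}$, and $\mathcal V:=H^1_{\Gamma_{\mathrm D}}(\Omega)$ the space of $H^1(\Omega)$ functions with vanishing trace on $\Gamma_{\mathrm D}$, normed by $\|\cdot\|_{H^1(\Omega)}$. The coefficients are $\mathbb A\in L^\infty(\Omega;\mathbb H^n)$ (values in the Hermitian $n\times n$ matrices), $\mathbf b\in L^\infty(\Omega;\mathbb C^n)$, $c\in L^\infty(\Omega)$, and $G:\mathcal V\to H^{-1/2}(\Gamma_{\mathrm N})$ is a bounded linear operator, where $H^{-1/2}(\Gamma_{\mathrm N})$ is understood as the dual of the space of traces of functions in $\mathcal V$. There is $a_{\min}>0$ with $a_{\min}|\xi|^2\le\Re\,\xi^H\mathbb A(x)\xi$ for all $\xi\in\mathbb C^n$ and a.e. $x\in\Omega$. The operator $\mathcal L:\mathcal V\to\mathcal V'$ and its sesquilinear form are $$\ell(v,w):=\langle\mathcal Lv,\overline w\rangle_{\mathcal V'\times\mathcal V}:=\int_\Omega\mathbb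 A\nabla v\cdot\nabla\overline w+(\mathbf b\cdot\nabla v+cv)\overline w\,dx-\langle Gv,\overline w|_{\partial\Omega}\rangle_{\partial\Omega},\qquad v,w\in\mathcal V$$ (here $\cdot$ is the bilinear dot product). It is assumed coercive: there is $c_{\mathcal L}>0$ with $|\ell(v,v)|\ge c_{\mathcal L}\|v\|_{\mathcal V}^2$ for all $v\in\mathcal V$. Set $\mathcal N:=\mathcal L^{-1}:\mathcal V'\to\mathcal V$. Interface. An isolated boundary component of a set $G_0$ is a subset $\Gamma\subset\partial G_0$ with $\operatorname{dist}(\partial G_0\setminus\Gamma,\Gamma)>0$; a Lipschitz interface in $\Omega$ is an isolated boundary component of some Lipschitz set contained in $\Omega$. $\Sigma\subset\Omega\cup\Gamma_{\mathrm N}$ is a Lipschitz interface such that either (a) $\Sigma\subset\Omega$ and $\Omega=\Omega_+\cup\Sigma\cup\Omega_-$ with disjoint Lipschitz sets $\Omega_\pm\subset\Omega$, or (b) $\Sigma\subset\Gamma_{\mathrm N}$ is an isolated boundary component of $\Omega_+:=\Omega$, and $\Omega_-:=\emptyset$. Let $\gamma_\Sigma:\mathcal V\to X:=H^{1/2}(\Sigma)$ be the (surjective) Dirichlet trace, $X$ with the norm $\|t\|_X:=\inf\{\|v\|_{H^1(\Omega)}:v\in\mathcal V,\gamma_\Sigma v=t\}$, and let $B:=X'=H^{-1/2}(\Sigma)$ with the dual norm. The adjoint $\gamma_\Sigma':B\to\mathcal V'$ is given by $\langle\gamma_\Sigma'g,\overline v\rangle_{\mathcal V'\times\mathcal V}=\langle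 g,\overline{\gamma_\Sigma v}\rangle_{B\times X}$. Operators. The single-layer potential is $\mathcal S:=\mathcal N\gamma_\Sigma':B\to\mathcal V$ and the single-layer operator is $\mathsf V:=\gamma_\Sigma\mathcal S:B\to X$ (an isomorphism). For a finite-dimensional subspace $\mathcal V_d\subset\mathcal V$, the Galerkin projector $P_d:\mathcal V\to\mathcal V_d$ is defined by $\ell(P_dv,v_d)=\ell(v,v_d)$ for all $v_d\in\mathcal V_d$, and the discrete single-layer operator is $\mathsf V_d:=\gamma_\Sigma P_d\mathcal S:B\to X$. *)

theory Defs
  imports "HOL-Analysis.Analysis"
begin

text \<open>Elements of function spaces are represented by functions on the whole of \<open>real ^ 'n\<close>, of which
  only the values on the relevant set (the domain, or a piece of a boundary) matter, up to null sets.
  Accordingly the norms below are seminorms on representatives. Bounded functionals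
  cannot distinguish representatives of the same element.\<close>

section \<open>Surface measure\<close>

text \<open>The \<open>s\<close>-dimensional Hausdorff measure in its usual normalisation, for integers \<open>s \<ge> 1\<close>.\<close>

definition hausdorff_pre :: "nat \<Rightarrow> real \<Rightarrow> 'a::metric_space set \<Rightarrow> ennreal" where
  "hausdorff_pre s \<delta> E =
     (INF C\<in>{C :: nat \<Rightarrow> 'a set. E \<subseteq> (\<Union>i. C i) \<and> (\<forall>i. bounded (C i) \<and> diameter (C i) \<le> \<delta>)}.
        \<Sum>i. ennreal (unit_ball_vol (real s) * (diameter (C i) / 2) ^ s))"

definition hausdorff_measure :: "nat \<Rightarrow> 'a::metric_space measure" where
  "hausdorff_measure s = measure_of UNIV (sets borel) (\<lambda>E. SUP \<delta>\<in>{0<..}. hausdorff_pre s \<delta> E)"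

definition surface_measure :: "(real ^ 'n) measure" where
  "surface_measure = hausdorff_measure (CARD('n) - 1)"

section \<open>Lipschitz sets and interfaces\<close>

text \<open>Near each boundary point, \<open>S\<close> is the set of points below the graph of a Lipschitz function over
  the hyperplane orthogonal to a unit vector \<open>e\<close>, where \<open>y - (y \<bullet> e) *\<^sub>R e\<close> is the projection of \<open>y\<close>
  onto that hyperplane. Neither \<open>S\<close> nor its boundary is assumed to be bounded.\<close>

definition lipschitz_set :: "'a::euclidean_space set \<Rightarrow> bool" where
  "lipschitz_set S \<longleftrightarrow> open S \<and>
     (\<forall>x\<in>frontier S. \<exists>U e h L. open U \<and> x \<in> U \<and> norm e = 1 \<and> L-lipschitz_on {z. z \<bullet> e = 0} h \<and>
        S \<inter> U = {y \<in> U. y \<bullet> e < h (y - (y \<bullet> e) *\<^sub>R e)})"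

definition lipschitz_domain :: "'a::euclidean_space set \<Rightarrow> bool" where
  "lipschitz_domain S \<longleftrightarrow> lipschitz_set S \<and> connected S \<and> S \<noteq> {}"

text \<open>The positive distance is spelled out because \<^const>\<open>setdist\<close> to the empty set is \<open>0\<close> rather than
  infinite, which would exclude the whole boundary.\<close>

definition isolated_boundary_component :: "'a::metric_space set \<Rightarrow> 'a set \<Rightarrow> bool" where
  "isolated_boundary_component S \<Gamma> \<longleftrightarrow> \<Gamma> \<subseteq> frontier S \<and>
     (\<exists>\<delta>>0. \<forall>x\<in>frontier S - \<Gamma>. \<forall>y\<in>\<Gamma>. \<delta> \<le> dist x y)"

definition lipschitz_interface :: "'a::euclidean_space set \<Rightarrow> 'a set \<Rightarrow> bool" where
  "lipschitz_interface \<Omega> \<Sigma> \<longleftrightarrow> (\<exists>S. lipschitz_set S \<and> S \<subseteq> \<Omega> \<and> isolated_boundary_component S \<Sigma>)"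

definition admissible_interface :: "'a::euclidean_space set \<Rightarrow> 'a set \<Rightarrow> 'a set \<Rightarrow> bool" where
  "admissible_interface \<Omega> \<Gamma>D \<Sigma> \<longleftrightarrow>
     \<Sigma> \<subseteq> \<Omega> \<union> (frontier \<Omega> - \<Gamma>D) \<and> lipschitz_interface \<Omega> \<Sigma> \<and>
     (\<Sigma> \<subseteq> \<Omega> \<and> (\<exists>\<Omega>p \<Omega>m. lipschitz_set \<Omega>p \<and> lipschitz_set \<Omega>m \<and> \<Omega>p \<subseteq> \<Omega> \<and> \<Omega>m \<subseteq> \<Omega> \<and>
                   \<Omega>p \<inter> \<Omega>m = {} \<and> \<Omega> = \<Omega>p \<union> \<Sigma> \<union> \<Omega>m) \<or>
      \<Sigma> \<subseteq> frontier \<Omega> - \<Gamma>D \<and> isolated_boundary_component \<Omega> \<Sigma>)"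

section \<open>Sobolev functions\<close>

definition partial_deriv :: "'n \<Rightarrow> (real ^ 'n \<Rightarrow> complex) \<Rightarrow> real ^ 'n \<Rightarrow> complex" where
  "partial_deriv i \<phi> x = frechet_derivative \<phi> (at x) (axis i 1)"

primrec Ck :: "nat \<Rightarrow> (real ^ 'n \<Rightarrow> complex) \<Rightarrow> bool" where
  "Ck 0 \<phi> \<longleftrightarrow> continuous_on UNIV \<phi>"
| "Ck (Suc k) \<phi> \<longleftrightarrow> (\<forall>x. \<phi> differentiable (at x)) \<and> (\<forall>i. Ck k (partial_deriv i \<phi>))"

definition test_functions :: "(real ^ 'n) set \<Rightarrow> (real ^ 'n \<Rightarrow> complex) set" where
  "test_functions \<Omega> = {\<phi>. (\<forall>k. Ck k \<phi>) \<and> compact (closure {x. \<phi> x \<noteq> 0}) \<and> closure {x. \<phi> x \<noteq> 0} \<subseteq> \<Omega>}"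

definition L2 :: "(real ^ 'n) set \<Rightarrow> (real ^ 'n \<Rightarrow> 'b::euclidean_space) set" where
  "L2 \<Omega> = {f. f \<in> borel_measurable (lebesgue_on \<Omega>) \<and> integrable (lebesgue_on \<Omega>) (\<lambda>x. (norm (f x))\<^sup>2)}"

definition L_infinity :: "(real ^ 'n) set \<Rightarrow> (real ^ 'n \<Rightarrow> 'b::euclidean_space) set" where
  "L_infinity \<Omega> = {f. f \<in> borel_measurable (lebesgue_on \<Omega>) \<and> (\<exists>M. AE x in lebesgue_on \<Omega>. norm (f x) \<le> M)}"

definition has_weak_gradient ::
    "(real ^ 'n) set \<Rightarrow> (real ^ 'n \<Rightarrow> complex) \<Rightarrow> (real ^ 'n \<Rightarrow> complex ^ 'n) \<Rightarrow> bool" where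
  "has_weak_gradient \<Omega> v g \<longleftrightarrow>
     (\<forall>\<phi>\<in>test_functions \<Omega>. \<forall>i.
        (LINT x|lebesgue_on \<Omega>. v x * partial_deriv i \<phi> x) = - (LINT x|lebesgue_on \<Omega>. g x $ i * \<phi> x))"

definition H1 :: "(real ^ 'n) set \<Rightarrow> (real ^ 'n \<Rightarrow> complex) set" where
  "H1 \<Omega> = {v \<in> L2 \<Omega>. \<exists>g\<in>L2 \<Omega>. has_weak_gradient \<Omega> v g}"

definition weak_gradient :: "(real ^ 'n) set \<Rightarrow> (real ^ 'n \<Rightarrow> complex) \<Rightarrow> real ^ 'n \<Rightarrow> complex ^ 'n" where
  "weak_gradient \<Omega> v = (SOME g. g \<in> L2 \<Omega> \<and> has_weak_gradient \<Omega> v g)"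

definition H1_norm :: "(real ^ 'n) set \<Rightarrow> (real ^ 'n \<Rightarrow> complex) \<Rightarrow> real" where
  "H1_norm \<Omega> v =
     sqrt ((LINT x|lebesgue_on \<Omega>. (norm (v x))\<^sup>2) + (LINT x|lebesgue_on \<Omega>. (norm (weak_gradient \<Omega> v x))\<^sup>2))"

section \<open>Traces\<close>

text \<open>The trace operator onto \<open>S\<close>, a subset of the boundary of \<open>\<Omega>\<close> or an interface inside \<open>\<Omega>\<close>, is the extension
  by density of the restriction \<open>\<phi> \<mapsto> \<phi>|S\<close> of smooth functions: convergence is in \<open>H\<^sup>1(\<Omega>)\<close> for the
  functions and in \<open>L\<^sup>2\<close> for the restrictions, the latter locally because \<open>S\<close> may be unbounded.\<close>

definition has_trace ::
    "(real ^ 'n) set \<Rightarrow> (real ^ 'n) set \<Rightarrow> (real ^ 'n \<Rightarrow> complex) \<Rightarrow> (real ^ 'n \<Rightarrow> complex) \<Rightarrow> bool" where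
  "has_trace \<Omega> S v t \<longleftrightarrow> v \<in> H1 \<Omega> \<and> t \<in> borel_measurable borel \<and>
     (\<exists>\<phi> :: nat \<Rightarrow> real ^ 'n \<Rightarrow> complex.
        (\<forall>k. \<phi> k \<in> test_functions UNIV) \<and>
        (\<lambda>k. H1_norm \<Omega> (\<lambda>x. \<phi> k x - v x)) \<longlonglongrightarrow> 0 \<and>
        (\<forall>R. (\<lambda>k. \<integral>\<^sup>+x\<in>S \<inter> cball 0 R. ennreal ((norm (\<phi> k x - t x))\<^sup>2) \<partial>surface_measure) \<longlonglongrightarrow> 0))"

definition dirichlet_trace :: "(real ^ 'n) set \<Rightarrow> (real ^ 'n) set \<Rightarrow> (real ^ 'n \<Rightarrow> complex) \<Rightarrow> real ^ 'n \<Rightarrow> complex" where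
  "dirichlet_trace \<Omega> S v = (SOME t. has_trace \<Omega> S v t)"

definition H1D :: "(real ^ 'n) set \<Rightarrow> (real ^ 'n) set \<Rightarrow> (real ^ 'n \<Rightarrow> complex) set" where
  "H1D \<Omega> \<Gamma>D = {v \<in> H1 \<Omega>. has_trace \<Omega> \<Gamma>D v (\<lambda>x. 0)}"

text \<open>The space of traces on \<open>S\<close> of the functions in \<^term>\<open>H1D \<Omega> \<Gamma>D\<close>, with its quotient norm.\<close>

definition trace_space :: "(real ^ 'n) set \<Rightarrow> (real ^ 'n) set \<Rightarrow> (real ^ 'n) set \<Rightarrow> (real ^ 'n \<Rightarrow> complex) set" where
  "trace_space \<Omega> \<Gamma>D S = {t. \<exists>v\<in>H1D \<Omega> \<Gamma>D. has_trace \<Omega> S v t}"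

definition trace_norm :: "(real ^ 'n) set \<Rightarrow> (real ^ 'n) set \<Rightarrow> (real ^ 'n) set \<Rightarrow> (real ^ 'n \<Rightarrow> complex) \<Rightarrow> real" where
  "trace_norm \<Omega> \<Gamma>D S t = Inf {H1_norm \<Omega> v | v. v \<in> H1D \<Omega> \<Gamma>D \<and> has_trace \<Omega> S v t}"

section \<open>Dual spaces\<close>

text \<open>The bounded linear functionals on the function space \<open>W\<close> with (semi)norm \<open>N\<close>, set to \<open>0\<close>
  outside \<open>W\<close> so that equality of functionals is equality of HOL functions.\<close>

definition dual_space :: "('x \<Rightarrow> complex) set \<Rightarrow> (('x \<Rightarrow> complex) \<Rightarrow> real) \<Rightarrow> (('x \<Rightarrow> complex) \<Rightarrow> complex) set" where
  "dual_space W N = {g.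
     (\<forall>t. t \<notin> W \<longrightarrow> g t = 0) \<and>
     (\<forall>s\<in>W. \<forall>t\<in>W. \<forall>\<alpha> \<beta>. g (\<lambda>x. \<alpha> * s x + \<beta> * t x) = \<alpha> * g s + \<beta> * g t) \<and>
     (\<exists>C. \<forall>t\<in>W. norm (g t) \<le> C * N t)}"

definition dual_norm ::
    "('x \<Rightarrow> complex) set \<Rightarrow> (('x \<Rightarrow> complex) \<Rightarrow> real) \<Rightarrow> (('x \<Rightarrow> complex) \<Rightarrow> complex) \<Rightarrow> real" where
  "dual_norm W N g = (SUP t\<in>{t\<in>W. N t \<le> 1}. norm (g t))"

definition cnj_fun :: "('x \<Rightarrow> complex) \<Rightarrow> 'x \<Rightarrow> complex" where
  "cnj_fun w = (\<lambda>x. cnj (w x))"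

definition cnj_functional :: "(('x \<Rightarrow> complex) \<Rightarrow> complex) \<Rightarrow> ('x \<Rightarrow> complex) \<Rightarrow> complex" where
  "cnj_functional g = (\<lambda>t. cnj (g (cnj_fun t)))"

text \<open>The spaces \<open>H\<^sup>1\<^sup>/\<^sup>2(S)\<close> (normed by \<^const>\<open>trace_norm\<close>) and its dual \<open>H\<^sup>-\<^sup>1\<^sup>/\<^sup>2(S)\<close>.\<close>

abbreviation Hp12 :: "(real ^ 'n) set \<Rightarrow> (real ^ 'n) set \<Rightarrow> (real ^ 'n) set \<Rightarrow> (real ^ 'n \<Rightarrow> complex) set" where
  "Hp12 \<equiv> trace_space"

definition Hm12 ::
    "(real ^ 'n) set \<Rightarrow> (real ^ 'n) set \<Rightarrow> (real ^ 'n) set \<Rightarrow> ((real ^ 'n \<Rightarrow> complex) \<Rightarrow> complex) set" where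
  "Hm12 \<Omega> \<Gamma>D S = dual_space (Hp12 \<Omega> \<Gamma>D S) (trace_norm \<Omega> \<Gamma>D S)"

definition Hm12_norm ::
    "(real ^ 'n) set \<Rightarrow> (real ^ 'n) set \<Rightarrow> (real ^ 'n) set \<Rightarrow> ((real ^ 'n \<Rightarrow> complex) \<Rightarrow> complex) \<Rightarrow> real" where
  "Hm12_norm \<Omega> \<Gamma>D S = dual_norm (Hp12 \<Omega> \<Gamma>D S) (trace_norm \<Omega> \<Gamma>D S)"

text \<open>Spans of finitely many elements of \<open>W\<close>. When \<open>W\<close> consists of representatives, as \<^const>\<open>H1D\<close>
  does, every finite-dimensional subspace of the quotient has this form, by choosing
  representatives of a basis.\<close>

definition finite_dim_subspace :: "('y \<Rightarrow> complex) set \<Rightarrow> ('y \<Rightarrow> complex) set \<Rightarrow> bool" where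
  "finite_dim_subspace U W \<longleftrightarrow> (\<exists>F. finite F \<and> F \<subseteq> W \<and> U = {\<lambda>y. \<Sum>f\<in>F. a f * f y | a. True})"

section \<open>The elliptic operator and the layer operators\<close>

definition cdot :: "complex ^ 'n \<Rightarrow> complex ^ 'n \<Rightarrow> complex" where
  "cdot x y = (\<Sum>i\<in>UNIV. x $ i * y $ i)"

definition hermitian :: "complex ^ 'n ^ 'n \<Rightarrow> bool" where
  "hermitian M \<longleftrightarrow> (\<forall>i j. M $ i $ j = cnj (M $ j $ i))"

definition bounded_operator_Hm12 ::
    "(real ^ 'n) set \<Rightarrow> (real ^ 'n) set \<Rightarrow> (real ^ 'n) set \<Rightarrow>
     ((real ^ 'n \<Rightarrow> complex) \<Rightarrow> (real ^ 'n \<Rightarrow> complex) \<Rightarrow> complex) \<Rightarrow> bool" where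
  "bounded_operator_Hm12 \<Omega> \<Gamma>D S G \<longleftrightarrow>
     (\<forall>v\<in>H1D \<Omega> \<Gamma>D. G v \<in> Hm12 \<Omega> \<Gamma>D S) \<and>
     (\<forall>v\<in>H1D \<Omega> \<Gamma>D. \<forall>w\<in>H1D \<Omega> \<Gamma>D. \<forall>\<alpha> \<beta>.
        G (\<lambda>x. \<alpha> * v x + \<beta> * w x) = (\<lambda>t. \<alpha> * G v t + \<beta> * G w t)) \<and>
     (\<exists>C. \<forall>v\<in>H1D \<Omega> \<Gamma>D. Hm12_norm \<Omega> \<Gamma>D S (G v) \<le> C * H1_norm \<Omega> v)"

type_synonym 'n form = "(real ^ 'n \<Rightarrow> complex) \<Rightarrow> (real ^ 'n \<Rightarrow> complex) \<Rightarrow> complex"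

definition elliptic_form ::
    "(real ^ 'n) set \<Rightarrow> (real ^ 'n) set \<Rightarrow> (real ^ 'n \<Rightarrow> complex ^ 'n ^ 'n) \<Rightarrow> (real ^ 'n \<Rightarrow> complex ^ 'n) \<Rightarrow>
     (real ^ 'n \<Rightarrow> complex) \<Rightarrow> ((real ^ 'n \<Rightarrow> complex) \<Rightarrow> (real ^ 'n \<Rightarrow> complex) \<Rightarrow> complex) \<Rightarrow> 'n form" where
  "elliptic_form \<Omega> \<Gamma>D A bv c G v w =
     (LINT x|lebesgue_on \<Omega>.
        cdot (A x *v weak_gradient \<Omega> v x) (weak_gradient \<Omega> (cnj_fun w) x) +
        (cdot (bv x) (weak_gradient \<Omega> v x) + c x * v x) * cnj_fun w x) -
     G v (dirichlet_trace \<Omega> (frontier \<Omega> - \<Gamma>D) (cnj_fun w))"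

text \<open>In the following, \<open>\<l>\<close> is the sesquilinear form of the operator
  \<open>\<L> : \<V> \<rightarrow> \<V>'\<close>, i.e. \<open>\<l> v w\<close> is the duality pairing of \<open>\<L> v\<close> with the conjugate of \<open>w\<close>.\<close>

definition elliptic_operator ::
    "(real ^ 'n) set \<Rightarrow> (real ^ 'n) set \<Rightarrow> 'n form \<Rightarrow>
     (real ^ 'n \<Rightarrow> complex) \<Rightarrow> (real ^ 'n \<Rightarrow> complex) \<Rightarrow> complex" where
  "elliptic_operator \<Omega> \<Gamma>D \<l> v = (\<lambda>w. if w \<in> H1D \<Omega> \<Gamma>D then \<l> v (cnj_fun w) else 0)"

definition solution_operator ::
    "(real ^ 'n) set \<Rightarrow> (real ^ 'n) set \<Rightarrow> 'n form \<Rightarrow>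
     ((real ^ 'n \<Rightarrow> complex) \<Rightarrow> complex) \<Rightarrow> real ^ 'n \<Rightarrow> complex" where
  "solution_operator \<Omega> \<Gamma>D \<l> = inv_into (H1D \<Omega> \<Gamma>D) (elliptic_operator \<Omega> \<Gamma>D \<l>)"

text \<open>By definition the pairing of \<open>\<gamma>\<^sub>\<Sigma>' g\<close> with the conjugate of \<open>v\<close> is the pairing of \<open>g\<close> with the
  conjugate of \<open>\<gamma>\<^sub>\<Sigma> v\<close>; here \<open>v\<close> is the conjugate of \<open>w\<close>.\<close>

definition trace_adjoint ::
    "(real ^ 'n) set \<Rightarrow> (real ^ 'n) set \<Rightarrow> (real ^ 'n) set \<Rightarrow>
     ((real ^ 'n \<Rightarrow> complex) \<Rightarrow> complex) \<Rightarrow> (real ^ 'n \<Rightarrow> complex) \<Rightarrow> complex" where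
  "trace_adjoint \<Omega> \<Gamma>D \<Sigma> g =
     (\<lambda>w. if w \<in> H1D \<Omega> \<Gamma>D then g (cnj_fun (dirichlet_trace \<Omega> \<Sigma> (cnj_fun w))) else 0)"

definition single_layer_potential ::
    "(real ^ 'n) set \<Rightarrow> (real ^ 'n) set \<Rightarrow> 'n form \<Rightarrow> (real ^ 'n) set \<Rightarrow>
     ((real ^ 'n \<Rightarrow> complex) \<Rightarrow> complex) \<Rightarrow> real ^ 'n \<Rightarrow> complex" where
  "single_layer_potential \<Omega> \<Gamma>D \<l> \<Sigma> g = solution_operator \<Omega> \<Gamma>D \<l> (trace_adjoint \<Omega> \<Gamma>D \<Sigma> g)"

definition single_layer_operator ::
    "(real ^ 'n) set \<Rightarrow> (real ^ 'n) set \<Rightarrow> 'n form \<Rightarrow> (real ^ 'n) set \<Rightarrow>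
     ((real ^ 'n \<Rightarrow> complex) \<Rightarrow> complex) \<Rightarrow> real ^ 'n \<Rightarrow> complex" where
  "single_layer_operator \<Omega> \<Gamma>D \<l> \<Sigma> g = dirichlet_trace \<Omega> \<Sigma> (single_layer_potential \<Omega> \<Gamma>D \<l> \<Sigma> g)"

definition galerkin_projector ::
    "'n form \<Rightarrow> (real ^ 'n \<Rightarrow> complex) set \<Rightarrow> (real ^ 'n \<Rightarrow> complex) \<Rightarrow> real ^ 'n \<Rightarrow> complex" where
  "galerkin_projector \<l> Vd v = (SOME p. p \<in> Vd \<and> (\<forall>vd\<in>Vd. \<l> p vd = \<l> v vd))"

definition discrete_single_layer_operator ::
    "(real ^ 'n) set \<Rightarrow> (real ^ 'n) set \<Rightarrow> 'n form \<Rightarrow> (real ^ 'n) set \<Rightarrow> (real ^ 'n \<Rightarrow> complex) set \<Rightarrow>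
     ((real ^ 'n \<Rightarrow> complex) \<Rightarrow> complex) \<Rightarrow> real ^ 'n \<Rightarrow> complex" where
  "discrete_single_layer_operator \<Omega> \<Gamma>D \<l> \<Sigma> Vd g =
     dirichlet_trace \<Omega> \<Sigma> (galerkin_projector \<l> Vd (single_layer_potential \<Omega> \<Gamma>D \<l> \<Sigma> g))"

text \<open>The duality pairing of \<open>t\<close> in \<open>H\<^sup>1\<^sup>/\<^sup>2(\<Sigma>)\<close> with \<open>g\<close> in \<open>H\<^sup>-\<^sup>1\<^sup>/\<^sup>2(\<Sigma>)\<close>, in this order.\<close>

definition pairing_XB :: "('x \<Rightarrow> complex) \<Rightarrow> (('x \<Rightarrow> complex) \<Rightarrow> complex) \<Rightarrow> complex" where
  "pairing_XB t g = g t"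

text \<open>The supremum is taken in \<^typ>\<open>ennreal\<close>, where it is \<open>0\<close> if \<open>Bh\<close> is the zero space.\<close>

definition consistency_error ::
    "(real ^ 'n) set \<Rightarrow> (real ^ 'n) set \<Rightarrow> 'n form \<Rightarrow> (real ^ 'n) set \<Rightarrow> (real ^ 'n \<Rightarrow> complex) set \<Rightarrow>
     ((real ^ 'n \<Rightarrow> complex) \<Rightarrow> complex) set \<Rightarrow> ennreal" where
  "consistency_error \<Omega> \<Gamma>D \<l> \<Sigma> Vd Bh =
     (SUP (g, h)\<in>{(g, h). g \<in> Bh \<and> h \<in> Bh \<and> g \<noteq> (\<lambda>_. 0) \<and> h \<noteq> (\<lambda>_. 0)}.
        ennreal (norm (pairing_XB
            (\<lambda>x. single_layer_operator \<Omega> \<Gamma>D \<l> \<Sigma> g x - discrete_single_layer_operator \<Omega> \<Gamma>D \<l> \<Sigma> Vd g x)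
            (cnj_functional h)) /
          (Hm12_norm \<Omega> \<Gamma>D \<Sigma> g * Hm12_norm \<Omega> \<Gamma>D \<Sigma> h)))"

definition discrete_solution ::
    "(real ^ 'n) set \<Rightarrow> (real ^ 'n) set \<Rightarrow> 'n form \<Rightarrow> (real ^ 'n) set \<Rightarrow> (real ^ 'n \<Rightarrow> complex) set \<Rightarrow>
     ((real ^ 'n \<Rightarrow> complex) \<Rightarrow> complex) set \<Rightarrow> (real ^ 'n \<Rightarrow> complex) \<Rightarrow> ((real ^ 'n \<Rightarrow> complex) \<Rightarrow> complex) \<Rightarrow> bool" where
  "discrete_solution \<Omega> \<Gamma>D \<l> \<Sigma> Vd Bh f bh \<longleftrightarrow> bh \<in> Bh \<and>
     (\<forall>g\<in>Bh. pairing_XB (discrete_single_layer_operator \<Omega> \<Gamma>D \<l> \<Sigma> Vd bh) (cnj_functional g) =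
             pairing_XB f (cnj_functional g))"

end

theory Submission
  imports Defs "HOL-Computational_Algebra.Polynomial"
begin

text \<open>Testing the equation of the single-layer potential \<open>S g\<close> shows that the pairing of its trace with the
  conjugate of \<open>h\<close> is the conjugate of \<open>\<l> (S h) (S g)\<close>. If \<open>K\<close> bounds \<open>\<l>\<close>, then the norm of \<open>g\<close> is at most \<open>K\<close>
  times that of \<open>S g\<close>, so coercivity of \<open>\<l>\<close> with constant \<open>cL\<close> makes the single-layer operator coercive with
  constant \<open>cL / K\<^sup>2\<close>, which does not involve the interface. A consistency error of at most half of this leaves
  the discrete operator coercive on \<open>Bh\<close>, and the error estimate is Strang's lemma combined with Cea's lemma
  for the Galerkin projector.

  All of this needs that \<open>\<L>\<close> is invertible and that every function in \<open>H1D \<Omega> \<Gamma>D\<close> has a trace. The former is the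
  Lax-Milgram lemma in the complete space \<open>H1D \<Omega> \<Gamma>D\<close>. The latter follows from a local trace inequality, as such a
  function is by definition a limit of smooth functions. For the inequality, the Hausdorff measure of a piece of a
  Lipschitz graph is bounded, by a Vitali covering, by the volume of the slab below it.\<close>

section \<open>Hausdorff measure on Lipschitz graphs\<close>

text \<open>If the set function defining \<^const>\<open>hausdorff_measure\<close> were not a measure,
  \<^const>\<open>measure_of\<close> would be zero; so an upper bound needs no additivity.\<close>

lemma emeasure_hausdorff_le:
  fixes X :: "'a::metric_space set"
  shows "emeasure (hausdorff_measure s) X \<le> (SUP \<delta>\<in>{0<..}. hausdorff_pre s \<delta> X)"
  unfolding hausdorff_measure_def emeasure_measure_of_conv by auto

lemma sets_hausdorff_measure [simp, measurable_cong]: "sets (hausdorff_measure s) = sets borel"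
  unfolding hausdorff_measure_def by (metis sets.sets_measure_of_eq space_borel)

locale graph_chart =
  fixes g :: "'a::euclidean_space \<Rightarrow> real" and e :: 'a and K :: real
  assumes lip: "\<bar>g x - g y\<bar> \<le> K * dist x y"
    and shift: "g (y + t *\<^sub>R e) = g y - t"
    and e: "norm e = 1"
    and K1: "1 \<le> K"
begin

definition foot :: "'a \<Rightarrow> 'a" where
  "foot y = y + g y *\<^sub>R e"

lemma continuous_g: "continuous_on UNIV g"
proof -
  have "K-lipschitz_on UNIV g"
    using lip K1 by (intro lipschitz_onI) (auto simp: dist_real_def)
  then show ?thesis by (rule lipschitz_on_continuous_on)
qed

lemma borel_g [measurable]: "g \<in> borel_measurable borel"
  using continuous_g by (rule borel_measurable_continuous_onI)

lemma borel_foot [measurable]: "foot \<in> borel_measurable borel"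
  unfolding foot_def[abs_def] by measurable

lemma foot_shift: "foot (y + t *\<^sub>R e) = foot y"
  by (simp add: foot_def shift algebra_simps)

lemma dist_foot: "dist (foot x) (foot y) \<le> (K + 1) * dist x y"
proof -
  have "foot x - foot y = (x - y) + (g x - g y) *\<^sub>R e"
    by (simp add: foot_def algebra_simps)
  then have "norm (foot x - foot y) \<le> norm (x - y) + \<bar>g x - g y\<bar> * norm e"
    by (metis norm_scaleR norm_triangle_ineq)
  then show ?thesis using lip[of x y] e by (simp add: dist_norm algebra_simps)
qed

lemma dist_foot_self: "dist (foot y) y = \<bar>g y\<bar>"
  by (simp add: foot_def dist_norm e)

definition slab :: "real \<Rightarrow> 'a set \<Rightarrow> 'a set" where
  "slab \<delta> A = {y. 0 < g y \<and> g y < \<delta> \<and> foot y \<in> A}"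

lemma slab_borel [measurable]:
  assumes [measurable]: "A \<in> sets borel"
  shows "slab \<delta> A \<in> sets borel"
proof -
  have "slab \<delta> A = {y. 0 < g y \<and> g y < \<delta>} \<inter> foot -` A" by (auto simp: slab_def)
  then show ?thesis using measurable_sets_borel[OF borel_foot assms] by simp
qed

definition slab_const :: "real \<Rightarrow> real" where
  "slab_const \<delta> = \<delta> * unit_ball_vol (real DIM('a)) / (4 * (K + 1) ^ (DIM('a) - 1))"

lemma slab_const_pos: "0 < \<delta> \<Longrightarrow> 0 < slab_const \<delta>"
  using K1 by (auto simp: slab_const_def)

text \<open>The slab over a ball contains a stack of disjoint balls along \<open>e\<close>.\<close>

lemma emeasure_slab_ball_ge:
  assumes p: "g p = 0" and \<rho>: "0 < \<rho>" "\<rho> \<le> \<delta> / 4"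
  shows "ennreal (slab_const \<delta> * \<rho> ^ (DIM('a) - 1)) \<le> emeasure lborel (slab \<delta> (ball p \<rho>))"
proof -
  define r where "r = \<rho> / (K + 1)"
  define N where "N = nat \<lceil>\<delta> / (4 * r)\<rceil>"
  define s where "s j = K * r + 2 * r * real j" for j :: nat
  define B where "B j = ball (p - s j *\<^sub>R e) r" for j
  have r: "0 < r" using \<rho> K1 by (simp add: r_def)
  have Kr: "K * r \<le> \<rho>" "(K + 1) * r = \<rho>"
    using \<rho> K1 by (simp_all add: r_def field_simps)
  have \<delta>: "0 < \<delta>" using \<rho> by linarith
  have N: "\<delta> / (4 * r) \<le> real N"
    unfolding N_def by linarith
  have disj: "disjoint_family_on B {..<N}"
  proof (unfold disjoint_family_on_def, intro ballI impI)
    fix i j :: nat assume "i \<noteq> j"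
    then have "1 \<le> \<bar>real i - real j\<bar>" by linarith
    have "dist (p - s i *\<^sub>R e) (p - s j *\<^sub>R e) = norm ((s j - s i) *\<^sub>R e)"
      by (simp add: dist_norm algebra_simps)
    also have "\<dots> = 2 * r * \<bar>real i - real j\<bar>"
    proof -
      have "s j - s i = 2 * r * (real j - real i)" by (simp add: s_def algebra_simps)
      then show ?thesis using e r by (simp add: abs_mult abs_minus_commute)
    qed
    also have "\<dots> \<ge> 2 * r" using r \<open>1 \<le> _\<close> by simp
    finally show "B i \<inter> B j = {}"
      unfolding B_def by (intro disjoint_ballI) simp
  qed
  have sub: "B j \<subseteq> slab \<delta> (ball p \<rho>)" if "j < N" for j
  proof
    fix y assume y: "y \<in> B j"
    have "real j < \<delta> / (4 * r)" using that unfolding N_def by linarith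
    then have j: "2 * r * real j < \<delta> / 2" using r by (simp add: field_simps)
    have gp: "g (p - s j *\<^sub>R e) = s j" using shift[of p "- s j"] p by simp
    have fp: "foot (p - s j *\<^sub>R e) = p" unfolding foot_def gp by simp
    have d: "dist (p - s j *\<^sub>R e) y < r" using y by (simp add: B_def)
    have "\<bar>s j - g y\<bar> \<le> K * dist (p - s j *\<^sub>R e) y" using lip[of "p - s j *\<^sub>R e" y] gp by simp
    also have "\<dots> < K * r" using d K1 by simp
    finally have gy: "\<bar>s j - g y\<bar> < K * r" .
    have "0 < g y" using gy r by (simp add: s_def abs_less_iff) (smt (verit) mult_nonneg_nonneg of_nat_0_le_iff)
    moreover have "g y < \<delta>"
    proof -
      have "g y < 2 * (K * r) + 2 * r * real j" using gy by (simp add: s_def abs_less_iff)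
      also have "\<dots> \<le> 2 * \<rho> + \<delta> / 2" using j Kr by linarith
      also have "\<dots> \<le> \<delta>" using \<rho> by linarith
      finally show ?thesis .
    qed
    moreover have "dist p (foot y) < \<rho>"
    proof -
      have "dist p (foot y) \<le> (K + 1) * dist (p - s j *\<^sub>R e) y"
        using dist_foot[of "p - s j *\<^sub>R e" y] fp by simp
      also have "\<dots> < (K + 1) * r" using d K1 by simp
      finally show ?thesis using Kr by simp
    qed
    ultimately show "y \<in> slab \<delta> (ball p \<rho>)" by (simp add: slab_def)
  qed
  have "slab_const \<delta> * \<rho> ^ (DIM('a) - 1) = \<delta> / (4 * r) * (unit_ball_vol (real DIM('a)) * r ^ DIM('a))"
  proof -
    obtain m where m: "DIM('a) = Suc m" using DIM_positive gr0_implies_Suc by blast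
    have "\<rho> ^ m = (K + 1) ^ m * r ^ m" by (simp only: Kr(2)[symmetric] power_mult_distrib)
    then have "slab_const \<delta> * \<rho> ^ m = \<delta> * unit_ball_vol (real DIM('a)) / 4 * r ^ m"
      using K1 m by (simp add: slab_const_def)
    also have "\<dots> = \<delta> / (4 * r) * (unit_ball_vol (real DIM('a)) * (r * r ^ m))"
      using r by simp
    finally show ?thesis using m by simp
  qed
  also have "\<dots> \<le> real N * (unit_ball_vol (real DIM('a)) * r ^ DIM('a))"
    using N r by (intro mult_right_mono) auto
  finally have "ennreal (slab_const \<delta> * \<rho> ^ (DIM('a) - 1))
      \<le> ennreal (real N * (unit_ball_vol (real DIM('a)) * r ^ DIM('a)))"
    by (rule ennreal_leI)
  also have "\<dots> = (\<Sum>j<N. emeasure lborel (B j))"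
    using r by (simp add: B_def emeasure_ball ennreal_mult' ennreal_of_nat_eq_real_of_nat)
  also have "\<dots> = emeasure lborel (\<Union>j<N. B j)"
    by (rule sum_emeasure[OF _ disj]) (auto simp: B_def)
  also have "\<dots> \<le> emeasure lborel (slab \<delta> (ball p \<rho>))"
    using sub by (intro emeasure_mono) auto
  finally show ?thesis .
qed

lemma hausdorff_le_slab:
  assumes dim: "2 \<le> DIM('a)" and \<delta>: "0 < \<delta>"
  shows "\<exists>C\<ge>0. \<forall>A\<in>sets borel. \<forall>R. A \<subseteq> cball 0 R \<longrightarrow> (\<forall>x\<in>A. g x = 0) \<longrightarrow>
    emeasure (hausdorff_measure (DIM('a) - 1)) A \<le> ennreal C * emeasure lborel (slab \<delta> A)"
proof (intro exI conjI ballI allI impI)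
  let ?s = "DIM('a) - 1"
  define C where "C = unit_ball_vol (real ?s) * 5 ^ ?s / slab_const \<delta>"
  show C0: "0 \<le> C" using slab_const_pos[OF \<delta>] by (simp add: C_def)
  fix A :: "'a set" and R
  assume A [measurable]: "A \<in> sets borel" and AR: "A \<subseteq> cball 0 R" and Ag: "\<forall>x\<in>A. g x = 0"
  define N where "N = distr (density lborel (indicator (slab \<delta> (ball 0 (R + 1))))) borel foot"
  have N: "emeasure N X = emeasure lborel (slab \<delta> (X \<inter> ball 0 (R + 1)))" if [measurable]: "X \<in> sets borel" for X
  proof -
    have "foot -` X \<in> sets borel" using measurable_sets_borel[OF borel_foot that] by simp
    then have "emeasure N X = emeasure lborel (slab \<delta> (ball 0 (R + 1)) \<inter> foot -` X)"
      unfolding N_def by (simp add: emeasure_distr emeasure_density nn_integral_indicator flip: indicator_inter_arith)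
    also have "slab \<delta> (ball 0 (R + 1)) \<inter> foot -` X = slab \<delta> (X \<inter> ball 0 (R + 1))"
      by (auto simp: slab_def)
    finally show ?thesis .
  qed
  have setsN: "sets N = sets borel" by (simp add: N_def)
  have spN: "space N = UNIV" using sets_eq_imp_space_eq[OF setsN] by simp
  have fin: "emeasure N (space N) \<noteq> \<infinity>"
  proof -
    have "slab \<delta> (ball 0 (R + 1)) \<subseteq> ball 0 (R + 1 + \<delta>)"
    proof
      fix y assume y: "y \<in> slab \<delta> (ball 0 (R + 1))"
      have "norm y \<le> norm (foot y) + dist (foot y) y" by (metis add.commute dist_commute dist_norm norm_triangle_sub)
      then show "y \<in> ball 0 (R + 1 + \<delta>)" using y by (simp add: slab_def dist_foot_self)
    qed
    then have "emeasure lborel (slab \<delta> (ball 0 (R + 1))) \<le> emeasure lborel (ball (0::'a) (R + 1 + \<delta>))"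
      by (rule emeasure_mono) simp
    also have "\<dots> < \<infinity>" using emeasure_lborel_ball_finite[of "0::'a"] by simp
    finally show ?thesis by (simp add: spN N)
  qed
  have key: "hausdorff_pre ?s \<eta> A \<le> ennreal C * (emeasure lborel (slab \<delta> A) + ennreal \<epsilon>)"
    if \<eta>: "0 < \<eta>" and \<epsilon>: "0 < \<epsilon>" for \<eta> \<epsilon> :: real
  proof -
    have "emeasure N A = (INF U \<in> {U. A \<subseteq> U \<and> open U}. emeasure N U)"
      by (rule outer_regular[OF setsN fin A])
    moreover have "emeasure N A < emeasure N A + ennreal \<epsilon>"
    proof -
      have "emeasure N A < top"
        using emeasure_space[of N A] fin by (simp add: less_top order.strict_trans1)
      then obtain a where "emeasure N A = ennreal a" "0 \<le> a" by (cases "emeasure N A") auto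
      then show ?thesis using \<epsilon> by (simp add: ennreal_less_iff flip: ennreal_plus)
    qed
    ultimately obtain U where U: "A \<subseteq> U" "open U" "emeasure N U < emeasure N A + ennreal \<epsilon>"
      by (auto simp: INF_less_iff)
    define V where "V = U \<inter> ball 0 (R + 1)"
    have AV: "A \<subseteq> V" "open V" using U AR by (auto simp: V_def)
    have V: "emeasure lborel (slab \<delta> V) \<le> emeasure lborel (slab \<delta> A) + ennreal \<epsilon>"
    proof -
      have "A \<inter> ball 0 (R + 1) = A" using AR by auto
      then show ?thesis using U N[of U] N[of A] by (simp add: V_def less_imp_le borel_open)
    qed
    have "\<exists>\<rho>. 0 < \<rho> \<and> \<rho> \<le> min (\<delta> / 4) (\<eta> / 10) \<and> ball p \<rho> \<subseteq> V" if "p \<in> A" for p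
    proof -
      obtain \<rho> where "0 < \<rho>" "ball p \<rho> \<subseteq> V" using AV \<open>p \<in> A\<close> openE[of V p] by blast
      then show ?thesis using \<delta> \<eta>
        by (intro exI[of _ "min \<rho> (min (\<delta> / 4) (\<eta> / 10))"]) auto
    qed
    then obtain \<rho> where \<rho>: "\<And>p. p \<in> A \<Longrightarrow> 0 < \<rho> p \<and> \<rho> p \<le> min (\<delta> / 4) (\<eta> / 10) \<and> ball p (\<rho> p) \<subseteq> V"
      by metis
    have cover: "A \<subseteq> (\<Union>p\<in>A. ball p (\<rho> p))" using \<rho> by fastforce
    obtain P where P: "countable P" "P \<subseteq> A" "pairwise (\<lambda>i j. disjnt (ball i (\<rho> i)) (ball j (\<rho> j))) P"
        "A \<subseteq> (\<Union>i\<in>P. ball i (5 * \<rho> i))"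
      by (rule Vitali_covering_lemma_balls[OF cover, of "\<delta> / 4"]) (use \<rho> in auto)
    define idx where "idx = to_nat_on P"
    define pt where "pt = from_nat_into P"
    define D where "D i = (if i \<in> idx ` P then ball (pt i) (\<rho> (pt i)) else {})" for i
    define E where "E i = (if i \<in> idx ` P then ball (pt i) (5 * \<rho> (pt i)) else {})" for i
    have pt: "pt (idx p) = p" if "p \<in> P" for p using P that by (simp add: pt_def idx_def)
    have AE': "A \<subseteq> (\<Union>i. E i)"
    proof
      fix x assume "x \<in> A"
      then obtain p where "p \<in> P" "x \<in> ball p (5 * \<rho> p)" using P by auto
      then have "x \<in> E (idx p)" by (simp add: E_def pt)
      then show "x \<in> (\<Union>i. E i)" by blast
    qed
    have Dd: "disjoint_family D"
    proof (unfold disjoint_family_on_def, intro ballI impI)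
      fix i j :: nat assume "i \<noteq> j"
      show "D i \<inter> D j = {}"
      proof (cases "i \<in> idx ` P \<and> j \<in> idx ` P")
        case True
        then obtain p q where pq: "p \<in> P" "i = idx p" "q \<in> P" "j = idx q" by auto
        with \<open>i \<noteq> j\<close> have "p \<noteq> q" by auto
        then show ?thesis using P(3) pq by (simp add: D_def pt pairwise_def disjnt_def)
      qed (auto simp: D_def)
    qed
    have Db: "D i \<in> sets borel" for i by (auto simp: D_def)
    have DV: "D i \<subseteq> V" for i 
    proof (cases "i \<in> idx ` P")
      case True
      then obtain p where p: "p \<in> P" "i = idx p" by auto
      then have "p \<in> A" using P(2) by auto
      then show ?thesis using \<rho>[of p] p by (simp add: D_def pt)
    qed (simp add: D_def)
    have bnd: "ennreal (unit_ball_vol (real ?s) * (diameter (E i) / 2) ^ ?s) \<le> ennreal C * emeasure lborel (slab \<delta> (D i))"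
      for i
    proof (cases "i \<in> idx ` P")
      case True
      then obtain p where p: "p \<in> P" "i = idx p" by auto
      have pr: "0 < \<rho> p" "\<rho> p \<le> \<delta> / 4" "g p = 0" using \<rho>[of p] p P(2) Ag by auto
      have "unit_ball_vol (real ?s) * (diameter (E i) / 2) ^ ?s = C * (slab_const \<delta> * \<rho> p ^ ?s)"
        using p True pr slab_const_pos[OF \<delta>] by (simp add: E_def pt C_def power_mult_distrib)
      also have "ennreal \<dots> = ennreal C * ennreal (slab_const \<delta> * \<rho> p ^ ?s)"
        using C0 by (rule ennreal_mult')
      also have "\<dots> \<le> ennreal C * emeasure lborel (slab \<delta> (D i))"
        using emeasure_slab_ball_ge[OF pr(3,1,2)] p True by (simp add: D_def pt mult_left_mono)
      finally show ?thesis .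
    qed (use dim in \<open>simp add: E_def power_0_left\<close>)
    have Ec: "bounded (E i) \<and> diameter (E i) \<le> \<eta>" for i
    proof (cases "i \<in> idx ` P")
      case True
      then obtain p where p: "p \<in> P" "i = idx p" by auto
      have pr: "0 < \<rho> p" "\<rho> p \<le> \<eta> / 10" using \<rho>[of p] p P(2) by auto
      then show ?thesis using p True by (simp add: E_def pt)
    qed (use \<eta> in \<open>auto simp: E_def\<close>)
    have "hausdorff_pre ?s \<eta> A \<le> (\<Sum>i. ennreal (unit_ball_vol (real ?s) * (diameter (E i) / 2) ^ ?s))"
      unfolding hausdorff_pre_def using AE' Ec by (intro INF_lower) auto
    also have "\<dots> \<le> (\<Sum>i. ennreal C * emeasure lborel (slab \<delta> (D i)))"
      by (intro suminf_le bnd) auto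
    also have "\<dots> = ennreal C * (\<Sum>i. emeasure lborel (slab \<delta> (D i)))" by simp
    also have "(\<Sum>i. emeasure lborel (slab \<delta> (D i))) = emeasure lborel (\<Union>i. slab \<delta> (D i))"
      using Dd Db by (intro suminf_emeasure) (auto simp: disjoint_family_on_def slab_def)
    also have "\<dots> \<le> emeasure lborel (slab \<delta> V)"
    proof (rule emeasure_mono)
      show "slab \<delta> V \<in> sets lborel" using AV(2) by (auto intro: slab_borel)
    qed (use DV in \<open>auto simp: slab_def\<close>)
    also have "\<dots> \<le> emeasure lborel (slab \<delta> A) + ennreal \<epsilon>" by (rule V)
    finally show ?thesis by (simp add: mult_left_mono)
  qed
  have "hausdorff_pre ?s \<eta> A \<le> ennreal C * emeasure lborel (slab \<delta> A)" if \<eta>: "0 < \<eta>" for \<eta>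
  proof (rule ennreal_le_epsilon)
    fix \<epsilon> :: real assume "0 < \<epsilon>"
    then have "0 < \<epsilon> / (C + 1)" using C0 by simp
    from key[OF \<eta> this] have "hausdorff_pre ?s \<eta> A \<le> ennreal C * emeasure lborel (slab \<delta> A) + ennreal (C * (\<epsilon> / (C + 1)))"
      by (simp only: distrib_left ennreal_mult'[OF C0])
    also have "\<dots> \<le> ennreal C * emeasure lborel (slab \<delta> A) + ennreal \<epsilon>"
      using C0 \<open>0 < \<epsilon>\<close> by (intro add_left_mono ennreal_leI) (simp add: field_simps)
    finally show "hausdorff_pre ?s \<eta> A \<le> ennreal C * emeasure lborel (slab \<delta> A) + ennreal \<epsilon>" .
  qed
  then show "emeasure (hausdorff_measure ?s) A \<le> ennreal C * emeasure lborel (slab \<delta> A)"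
    by (intro order_trans[OF emeasure_hausdorff_le] SUP_least) auto
qed

end

lemma nn_integral_lborel_shift:
  fixes u :: "'a::euclidean_space \<Rightarrow> ennreal"
  assumes [measurable]: "u \<in> borel_measurable borel"
  shows "(\<integral>\<^sup>+y. u (y + a) \<partial>lborel) = (\<integral>\<^sup>+y. u y \<partial>lborel)"
proof -
  have "(\<integral>\<^sup>+y. u y \<partial>lborel) = (\<integral>\<^sup>+y. u y \<partial>distr lborel borel ((+) a))"
    by (simp add: lborel_distr_plus)
  also have "\<dots> = (\<integral>\<^sup>+y. u (a + y) \<partial>lborel)" by (subst nn_integral_distr) auto
  finally show ?thesis by (simp add: add.commute)
qed

context graph_chart begin

lemma nn_integral_hausdorff_le:
  assumes dim: "2 \<le> DIM('a)" and \<delta>: "0 < \<delta>"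
  shows "\<exists>C\<ge>0. \<forall>A\<in>sets borel. \<forall>R. \<forall>u\<in>borel_measurable borel. A \<subseteq> cball 0 R \<longrightarrow> (\<forall>x\<in>A. g x = 0) \<longrightarrow>
    (\<integral>\<^sup>+x\<in>A. u x \<partial>hausdorff_measure (DIM('a) - 1)) \<le> ennreal C * (\<integral>\<^sup>+y\<in>slab \<delta> A. u (foot y) \<partial>lborel)"
proof -
  let ?H = "hausdorff_measure (DIM('a) - 1) :: 'a measure"
  from hausdorff_le_slab[OF dim \<delta>] obtain C where C: "0 \<le> C" and
    C_le: "\<forall>A\<in>sets borel. \<forall>R. A \<subseteq> cball 0 R \<longrightarrow> (\<forall>x\<in>A. g x = 0) \<longrightarrow>
      emeasure ?H A \<le> ennreal C * emeasure lborel (slab \<delta> A)"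
    by (elim exE conjE)
  show ?thesis
  proof (intro exI[of _ C] conjI C ballI allI impI)
    fix A R and u :: "'a \<Rightarrow> ennreal"
    assume A [measurable]: "A \<in> sets borel" and u [measurable]: "u \<in> borel_measurable borel"
      and AR: "A \<subseteq> cball 0 R" and Ag: "\<forall>x\<in>A. g x = 0"
    define M where "M = density ?H (indicator A)"
    define N where "N = scale_measure (ennreal C) (distr (density lborel (indicator (slab \<delta> A))) borel foot)"
    have sM: "sets M = sets borel" and sN: "sets N = sets borel" by (simp_all add: M_def N_def)
    have le: "emeasure M X \<le> emeasure N X" for X
    proof (cases "X \<in> sets borel")
      case True
      note X [measurable] = this
      have fX: "foot -` X \<in> sets borel" using measurable_sets_borel[OF borel_foot X] by simp
      have "emeasure M X = emeasure ?H (A \<inter> X)"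
        unfolding M_def by (simp add: emeasure_density nn_integral_indicator flip: indicator_inter_arith)
      also have "\<dots> \<le> ennreal C * emeasure lborel (slab \<delta> (A \<inter> X))"
        using AR Ag by (intro C_le[rule_format, of _ R]) auto
      also have "slab \<delta> (A \<inter> X) = slab \<delta> A \<inter> foot -` X" by (auto simp: slab_def)
      also have "ennreal C * emeasure lborel \<dots> = emeasure N X"
        unfolding N_def using fX
        by (simp add: emeasure_distr emeasure_density nn_integral_indicator flip: indicator_inter_arith)
      finally show ?thesis .
    qed (simp add: emeasure_notin_sets sM)
    have "M \<le> N"
      using sM sN le sets_eq_imp_space_eq[of M N] by (auto simp: le_measure_iff le_fun_def)
    then have "nn_integral M u \<le> nn_integral N u"
      by (intro nn_integral_mono_measure) (simp_all add: sM sN)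
    moreover have "nn_integral M u = (\<integral>\<^sup>+x\<in>A. u x \<partial>?H)"
      unfolding M_def by (subst nn_integral_density) (auto simp: mult.commute)
    moreover have "nn_integral N u = ennreal C * (\<integral>\<^sup>+y\<in>slab \<delta> A. u (foot y) \<partial>lborel)"
      unfolding N_def by (subst nn_integral_scale_measure) (auto simp: nn_integral_distr nn_integral_density mult.commute)
    ultimately show "(\<integral>\<^sup>+x\<in>A. u x \<partial>?H) \<le> ennreal C * (\<integral>\<^sup>+y\<in>slab \<delta> A. u (foot y) \<partial>lborel)" by simp
  qed
qed

lemma norm_foot_sq_le:
  fixes \<phi> d :: "'a \<Rightarrow> complex"
  assumes d: "continuous_on UNIV d"
    and der: "\<And>y t. ((\<lambda>t. \<phi> (y + t *\<^sub>R e)) has_vector_derivative d (y + t *\<^sub>R e)) (at t)"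
    and y: "y \<in> slab \<delta> A"
  shows "ennreal ((norm (\<phi> (foot y)))\<^sup>2) \<le> ennreal (2 * (norm (\<phi> y))\<^sup>2) +
    ennreal (2 * \<delta>) * (\<integral>\<^sup>+t\<in>{0..\<delta>}. ennreal ((norm (d (y + t *\<^sub>R e)))\<^sup>2) * indicator (slab \<delta> A) (y + t *\<^sub>R e) \<partial>lborel)"
    (is "_ \<le> _ + _ * ?J")
proof -
  define \<sigma> where "\<sigma> = g y"
  have \<sigma>: "0 < \<sigma>" "\<sigma> < \<delta>" using y by (auto simp: slab_def \<sigma>_def)
  have [measurable]: "d \<in> borel_measurable borel" using d by (rule borel_measurable_continuous_onI)
  have ct: "continuous_on {0..\<sigma>} (\<lambda>t. d (y + t *\<^sub>R e))"
    by (rule continuous_on_compose2[OF d]) (auto intro!: continuous_intros)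
  have hb: "has_bochner_integral lborel (\<lambda>t. indicator {0..\<sigma>} t *\<^sub>R d (y + t *\<^sub>R e)) (\<phi> (y + \<sigma> *\<^sub>R e) - \<phi> (y + 0 *\<^sub>R e))"
    using \<sigma> der ct by (intro has_bochner_integral_FTC_Icc) (auto intro: has_vector_derivative_at_within)
  then have "\<phi> (foot y) - \<phi> y = (LINT t|lborel. indicator {0..\<sigma>} t *\<^sub>R d (y + t *\<^sub>R e))"
    by (simp add: has_bochner_integral_integral_eq foot_def \<sigma>_def)
  then have "ennreal (norm (\<phi> (foot y) - \<phi> y)) \<le> (\<integral>\<^sup>+t. ennreal (norm (indicator {0..\<sigma>} t *\<^sub>R d (y + t *\<^sub>R e))) \<partial>lborel)"
    using integral_norm_bound_ennreal[OF integrable.intros[OF hb]] by simp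
  also have "\<dots> = (\<integral>\<^sup>+t. (ennreal (norm (d (y + t *\<^sub>R e))) * indicator {0..\<sigma>} t) * indicator {0..\<sigma>} t \<partial>lborel)"
    by (intro nn_integral_cong) (auto simp: indicator_def)
  finally have "(ennreal (norm (\<phi> (foot y) - \<phi> y)))\<^sup>2
      \<le> (\<integral>\<^sup>+t. (ennreal (norm (d (y + t *\<^sub>R e))) * indicator {0..\<sigma>} t) * indicator {0..\<sigma>} t \<partial>lborel)\<^sup>2"
    by (rule power_mono_ennreal)
  also have "\<dots> \<le> (\<integral>\<^sup>+t. (ennreal (norm (d (y + t *\<^sub>R e))) * indicator {0..\<sigma>} t)\<^sup>2 \<partial>lborel) * (\<integral>\<^sup>+t. (indicator {0..\<sigma>} t)\<^sup>2 \<partial>lborel)"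
    by (rule Cauchy_Schwarz_nn_integral) measurable
  also have "(\<integral>\<^sup>+t. (indicator {0..\<sigma>} t :: ennreal)\<^sup>2 \<partial>lborel) = (\<integral>\<^sup>+t. indicator {0..\<sigma>} t \<partial>lborel)"
    by (intro nn_integral_cong) (auto simp: indicator_def)
  also have "\<dots> = ennreal \<sigma>" using \<sigma> by simp
  also have "(\<integral>\<^sup>+t. (ennreal (norm (d (y + t *\<^sub>R e))) * indicator {0..\<sigma>} t)\<^sup>2 \<partial>lborel)
     = (\<integral>\<^sup>+t. (ennreal (norm (d (y + t *\<^sub>R e))) * indicator {0..<\<sigma>} t)\<^sup>2 \<partial>lborel)"
    using AE_lborel_singleton[of \<sigma>]
    by (intro nn_integral_cong_AE) (auto simp: indicator_def elim!: eventually_mono)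
  also have "\<dots> \<le> ?J"
  proof (rule nn_integral_mono)
    fix t :: real
    have "y + t *\<^sub>R e \<in> slab \<delta> A" "t \<in> {0..\<delta>}" if "t \<in> {0..<\<sigma>}"
      using that y \<sigma> by (auto simp: slab_def shift foot_shift \<sigma>_def)
    then show "(ennreal (norm (d (y + t *\<^sub>R e))) * indicator {0..<\<sigma>} t)\<^sup>2
        \<le> ennreal ((norm (d (y + t *\<^sub>R e)))\<^sup>2) * indicator (slab \<delta> A) (y + t *\<^sub>R e) * indicator {0..\<delta>} t"
      by (cases "t \<in> {0..<\<sigma>}") (simp_all add: ennreal_power)
  qed
  finally have "(ennreal (norm (\<phi> (foot y) - \<phi> y)))\<^sup>2 \<le> ?J * ennreal \<sigma>" by (simp add: mult_right_mono)
  also have "\<dots> \<le> ?J * ennreal \<delta>" using \<sigma> by (intro mult_left_mono ennreal_leI) auto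
  finally have *: "ennreal ((norm (\<phi> (foot y) - \<phi> y))\<^sup>2) \<le> ?J * ennreal \<delta>" by (simp add: ennreal_power)
  have "(norm (\<phi> (foot y)))\<^sup>2 \<le> 2 * (norm (\<phi> y))\<^sup>2 + 2 * (norm (\<phi> (foot y) - \<phi> y))\<^sup>2"
  proof -
    have "norm (\<phi> (foot y)) \<le> norm (\<phi> y) + norm (\<phi> (foot y) - \<phi> y)" by (metis add.commute norm_triangle_sub)
    then have "(norm (\<phi> (foot y)))\<^sup>2 \<le> (norm (\<phi> y) + norm (\<phi> (foot y) - \<phi> y))\<^sup>2" by (intro power_mono) auto
    also have "\<dots> \<le> 2 * (norm (\<phi> y))\<^sup>2 + 2 * (norm (\<phi> (foot y) - \<phi> y))\<^sup>2"
      using sum_squares_bound[of "norm (\<phi> y)" "norm (\<phi> (foot y) - \<phi> y)"] by (simp add: power2_sum)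
    finally show ?thesis .
  qed
  then have "ennreal ((norm (\<phi> (foot y)))\<^sup>2) \<le> ennreal (2 * (norm (\<phi> y))\<^sup>2 + 2 * (norm (\<phi> (foot y) - \<phi> y))\<^sup>2)"
    by (rule ennreal_leI)
  also have "\<dots> = ennreal (2 * (norm (\<phi> y))\<^sup>2) + 2 * ennreal ((norm (\<phi> (foot y) - \<phi> y))\<^sup>2)"
    by (simp add: ennreal_mult')
  also have "\<dots> \<le> ennreal (2 * (norm (\<phi> y))\<^sup>2) + 2 * (?J * ennreal \<delta>)"
    by (intro add_left_mono mult_left_mono *) auto
  also have "\<dots> = ennreal (2 * (norm (\<phi> y))\<^sup>2) + ennreal (2 * \<delta>) * ?J"
    using \<sigma> by (simp add: ennreal_mult' mult_ac)
  finally show ?thesis .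
qed

lemma trace_le_slab:
  assumes dim: "2 \<le> DIM('a)" and \<delta>: "0 < \<delta>"
  shows "\<exists>C\<ge>0. \<forall>A\<in>sets borel. \<forall>R \<phi> d. A \<subseteq> cball 0 R \<longrightarrow> (\<forall>x\<in>A. g x = 0) \<longrightarrow>
     continuous_on UNIV \<phi> \<longrightarrow> continuous_on UNIV d \<longrightarrow>
     (\<forall>y t. ((\<lambda>t. \<phi> (y + t *\<^sub>R e)) has_vector_derivative (d (y + t *\<^sub>R e) :: complex)) (at t)) \<longrightarrow>
     (\<integral>\<^sup>+x\<in>A. ennreal ((norm (\<phi> x))\<^sup>2) \<partial>hausdorff_measure (DIM('a) - 1))
       \<le> ennreal C * (\<integral>\<^sup>+y\<in>slab \<delta> A. ennreal ((norm (\<phi> y))\<^sup>2 + (norm (d y))\<^sup>2) \<partial>lborel)"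
proof -
  let ?H = "hausdorff_measure (DIM('a) - 1) :: 'a measure"
  from nn_integral_hausdorff_le[OF dim \<delta>] obtain C where C: "0 \<le> C" and
    le: "\<forall>A\<in>sets borel. \<forall>R. \<forall>u\<in>borel_measurable borel. A \<subseteq> cball 0 R \<longrightarrow> (\<forall>x\<in>A. g x = 0) \<longrightarrow>
      (\<integral>\<^sup>+x\<in>A. u x \<partial>?H) \<le> ennreal C * (\<integral>\<^sup>+y\<in>slab \<delta> A. u (foot y) \<partial>lborel)"
    by (elim exE conjE)
  show ?thesis
  proof (intro exI[of _ "C * (2 + 2 * \<delta> * \<delta>)"] conjI ballI allI impI)
    show "0 \<le> C * (2 + 2 * \<delta> * \<delta>)" using C \<delta> by simp
    fix A R and \<phi> d :: "'a \<Rightarrow> complex"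
    assume A [measurable]: "A \<in> sets borel" and AR: "A \<subseteq> cball 0 R" and Ag: "\<forall>x\<in>A. g x = 0"
      and \<phi>: "continuous_on UNIV \<phi>" and d: "continuous_on UNIV d"
      and der: "\<forall>y t. ((\<lambda>t. \<phi> (y + t *\<^sub>R e)) has_vector_derivative d (y + t *\<^sub>R e)) (at t)"
    have [measurable]: "\<phi> \<in> borel_measurable borel" "d \<in> borel_measurable borel"
      using \<phi> d by (auto intro: borel_measurable_continuous_onI)
    define W where "W z = ennreal ((norm (d z))\<^sup>2) * indicator (slab \<delta> A) z" for z
    have [measurable]: "W \<in> borel_measurable borel" unfolding W_def[abs_def] by measurable
    define P where "P = (\<integral>\<^sup>+y\<in>slab \<delta> A. ennreal ((norm (\<phi> y))\<^sup>2) \<partial>lborel)"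
    define Q where "Q = (\<integral>\<^sup>+y. W y \<partial>lborel)"
    have "(\<integral>\<^sup>+x\<in>A. ennreal ((norm (\<phi> x))\<^sup>2) \<partial>?H) \<le> ennreal C * (\<integral>\<^sup>+y\<in>slab \<delta> A. ennreal ((norm (\<phi> (foot y)))\<^sup>2) \<partial>lborel)"
      using Ag by (intro le[rule_format, OF A _ AR]) auto
    also have "(\<integral>\<^sup>+y\<in>slab \<delta> A. ennreal ((norm (\<phi> (foot y)))\<^sup>2) \<partial>lborel)
        \<le> (\<integral>\<^sup>+y. 2 * (ennreal ((norm (\<phi> y))\<^sup>2) * indicator (slab \<delta> A) y) + ennreal (2 * \<delta>) * (\<integral>\<^sup>+t. W (y + t *\<^sub>R e) * indicator {0..\<delta>} t \<partial>lborel) \<partial>lborel)"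
    proof (rule nn_integral_mono)
      fix y
      show "ennreal ((norm (\<phi> (foot y)))\<^sup>2) * indicator (slab \<delta> A) y \<le>
        2 * (ennreal ((norm (\<phi> y))\<^sup>2) * indicator (slab \<delta> A) y) + ennreal (2 * \<delta>) * (\<integral>\<^sup>+t. W (y + t *\<^sub>R e) * indicator {0..\<delta>} t \<partial>lborel)"
        using norm_foot_sq_le[of d \<phi> y \<delta> A] d der
        by (cases "y \<in> slab \<delta> A") (auto simp: W_def ennreal_mult')
    qed
    also have "\<dots> = 2 * P + ennreal (2 * \<delta>) * (\<integral>\<^sup>+y. (\<integral>\<^sup>+t. W (y + t *\<^sub>R e) * indicator {0..\<delta>} t \<partial>lborel) \<partial>lborel)"
      unfolding P_def by (subst nn_integral_add) (auto simp: nn_integral_cmult)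
    also have "(\<integral>\<^sup>+y. (\<integral>\<^sup>+t. W (y + t *\<^sub>R e) * indicator {0..\<delta>} t \<partial>lborel) \<partial>lborel)
       = (\<integral>\<^sup>+t. (\<integral>\<^sup>+y. W (y + t *\<^sub>R e) * indicator {0..\<delta>} t \<partial>lborel) \<partial>lborel)"
      by (rule lborel_pair.Fubini') measurable
    also have "\<dots> = (\<integral>\<^sup>+t. Q * indicator {0..\<delta>} t \<partial>lborel)"
      by (intro nn_integral_cong) (auto simp: nn_integral_multc nn_integral_lborel_shift Q_def)
    also have "\<dots> = Q * ennreal \<delta>" using \<delta> by (simp add: nn_integral_cmult)
    also have "2 * P + ennreal (2 * \<delta>) * (Q * ennreal \<delta>) \<le> ennreal (2 + 2 * \<delta> * \<delta>) * (P + Q)"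
    proof -
      have "2 * P \<le> ennreal (2 + 2 * \<delta> * \<delta>) * P"
        using \<delta> by (intro mult_right_mono) (auto simp: ennreal_plus)
      moreover have "ennreal (2 * \<delta>) * (Q * ennreal \<delta>) = ennreal (2 * \<delta> * \<delta>) * Q"
        using \<delta> by (simp add: ennreal_mult mult_ac)
      moreover have "ennreal (2 * \<delta> * \<delta>) * Q \<le> ennreal (2 + 2 * \<delta> * \<delta>) * Q"
        by (intro mult_right_mono ennreal_leI) auto
      ultimately show ?thesis by (simp add: distrib_left add_mono)
    qed
    also have "P + Q = (\<integral>\<^sup>+y\<in>slab \<delta> A. ennreal ((norm (\<phi> y))\<^sup>2 + (norm (d y))\<^sup>2) \<partial>lborel)"
      unfolding P_def Q_def W_def by (simp add: distrib_right nn_integral_add[symmetric])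
    finally show "(\<integral>\<^sup>+x\<in>A. ennreal ((norm (\<phi> x))\<^sup>2) \<partial>?H)
      \<le> ennreal (C * (2 + 2 * \<delta> * \<delta>)) * (\<integral>\<^sup>+y\<in>slab \<delta> A. ennreal ((norm (\<phi> y))\<^sup>2 + (norm (d y))\<^sup>2) \<partial>lborel)"
      using C \<delta> by (simp add: mult_left_mono ennreal_mult mult.assoc)
  qed
qed

end

section \<open>The trace inequality\<close>

definition classical_gradient :: "(real ^ 'n \<Rightarrow> complex) \<Rightarrow> real ^ 'n \<Rightarrow> complex ^ 'n" where
  "classical_gradient \<phi> x = (\<chi> i. partial_deriv i \<phi> x)"

lemma Ck_SucD:
  assumes "Ck (Suc k) \<phi>"
  shows "\<phi> differentiable (at x)" "Ck k (partial_deriv i \<phi>)"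
  using assms by auto

lemma Ck_continuous: "Ck k \<phi> \<Longrightarrow> continuous_on UNIV \<phi>"
  by (cases k) (auto intro!: continuous_at_imp_continuous_on differentiable_imp_continuous_within)

lemma frechet_derivative_partial_deriv:
  fixes \<phi> :: "real ^ 'n \<Rightarrow> complex"
  assumes "\<phi> differentiable (at x)"
  shows "frechet_derivative \<phi> (at x) v = (\<Sum>i\<in>UNIV. of_real (v $ i) * partial_deriv i \<phi> x)"
proof -
  have lin: "linear (frechet_derivative \<phi> (at x))"
    using assms by (rule linear_frechet_derivative)
  have "v = (\<Sum>i\<in>UNIV. v $ i *\<^sub>R axis i 1)"
    by (metis (no_types) basis_expansion scalar_mult_eq_scaleR)
  then have "frechet_derivative \<phi> (at x) v = frechet_derivative \<phi> (at x) (\<Sum>i\<in>UNIV. v $ i *\<^sub>R axis i 1)"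
    by (rule arg_cong)
  also have "\<dots> = (\<Sum>i\<in>UNIV. v $ i *\<^sub>R frechet_derivative \<phi> (at x) (axis i 1))"
    by (simp add: linear_sum[OF lin] linear_cmul[OF lin])
  finally show ?thesis by (simp add: partial_deriv_def scaleR_conv_of_real)
qed

lemma has_vector_derivative_along:
  fixes \<phi> :: "real ^ 'n \<Rightarrow> complex"
  assumes "\<phi> differentiable (at (y + t *\<^sub>R e))"
  shows "((\<lambda>t. \<phi> (y + t *\<^sub>R e)) has_vector_derivative
    (\<Sum>i\<in>UNIV. of_real (e $ i) * partial_deriv i \<phi> (y + t *\<^sub>R e))) (at t)"
proof -
  let ?D = "frechet_derivative \<phi> (at (y + t *\<^sub>R e))"
  have D: "(\<phi> has_derivative ?D) (at (y + t *\<^sub>R e))"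
    using assms by (simp add: frechet_derivative_works)
  have "((\<lambda>t. y + t *\<^sub>R e) has_derivative (\<lambda>h. h *\<^sub>R e)) (at t)"
    by (auto intro!: derivative_eq_intros)
  from has_derivative_compose[OF this] D
  have "((\<lambda>t. \<phi> (y + t *\<^sub>R e)) has_derivative (\<lambda>h. ?D (h *\<^sub>R e))) (at t)" by auto
  moreover have "?D (h *\<^sub>R e) = h *\<^sub>R ?D e" for h
    using linear_frechet_derivative[OF assms] by (rule linear_cmul)
  ultimately show ?thesis
    by (simp add: has_vector_derivative_def frechet_derivative_partial_deriv[OF assms])
qed

lemma norm_directional_le:
  fixes w :: "complex ^ 'n"
  shows "norm (\<Sum>i\<in>UNIV. of_real (e $ i) * w $ i) \<le> norm e * norm w"
proof -
  have "norm (\<Sum>i\<in>UNIV. of_real (e $ i) * w $ i) \<le> (\<Sum>i\<in>UNIV. \<bar>e $ i\<bar> * \<bar>norm (w $ i)\<bar>)"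
    by (rule order_trans[OF norm_sum]) (simp add: norm_mult)
  also have "\<dots> \<le> L2_set (\<lambda>i. e $ i) UNIV * L2_set (\<lambda>i. norm (w $ i)) UNIV"
    by (rule L2_set_mult_ineq)
  finally show ?thesis by (simp add: norm_vec_def L2_set_def)
qed

lemma graph_chart_of_lipschitz:
  fixes e :: "'a::euclidean_space"
  assumes e: "norm e = 1" and h: "L-lipschitz_on {z. z \<bullet> e = 0} h"
  shows "graph_chart (\<lambda>y. h (y - (y \<bullet> e) *\<^sub>R e) - y \<bullet> e) e (L + 1)"
proof
  have L: "0 \<le> L" using h by (rule lipschitz_on_nonneg)
  have ee: "e \<bullet> e = 1" using e by (simp add: norm_eq_1)
  show "1 \<le> L + 1" using L by simp
  show "norm e = 1" by (rule e)
  fix x y :: 'a and t :: real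
  let ?P = "\<lambda>y. y - (y \<bullet> e) *\<^sub>R e"
  have mem: "?P y \<in> {z. z \<bullet> e = 0}" for y by (simp add: inner_diff_left ee)
  have "dist (?P x) (?P y) \<le> dist x y"
  proof -
    have eq: "?P x - ?P y = ?P (x - y)" by (simp add: inner_diff_left scaleR_diff_left)
    have "?P v \<bullet> ?P v = v \<bullet> v - (v \<bullet> e)\<^sup>2" for v
      by (simp add: inner_diff_left inner_diff_right ee inner_commute[of e v] power2_eq_square)
    then have "(norm (?P (x - y)))\<^sup>2 \<le> (norm (x - y))\<^sup>2"
      unfolding power2_norm_eq_inner by simp
    then have "norm (?P (x - y)) \<le> norm (x - y)" by (rule power2_le_imp_le) simp
    then show ?thesis by (simp only: dist_norm eq)
  qed
  then have "L * dist (?P x) (?P y) \<le> L * dist x y" using L by (rule mult_left_mono)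
  with lipschitz_onD[OF h mem[of x] mem[of y]] have "\<bar>h (?P x) - h (?P y)\<bar> \<le> L * dist x y"
    unfolding dist_real_def by (rule order_trans)
  moreover have "\<bar>x \<bullet> e - y \<bullet> e\<bar> \<le> dist x y"
    using Cauchy_Schwarz_ineq2[of "x - y" e] e by (simp add: inner_diff_left dist_norm)
  ultimately show "\<bar>h (?P x) - x \<bullet> e - (h (?P y) - y \<bullet> e)\<bar> \<le> (L + 1) * dist x y"
    by (simp add: algebra_simps)
  have P_shift: "?P (y + t *\<^sub>R e) = ?P y" by (simp add: inner_add_left ee algebra_simps)
  show "h (?P (y + t *\<^sub>R e)) - (y + t *\<^sub>R e) \<bullet> e = h (?P y) - y \<bullet> e - t"
    unfolding P_shift by (simp add: inner_add_left ee)
qed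

lemma local_trace_inequality:
  fixes S :: "(real ^ 'n) set"
  assumes dim: "2 \<le> CARD('n)" and S: "lipschitz_set S" and x: "x \<in> frontier S"
  shows "\<exists>r>0. \<exists>C\<ge>0. \<forall>\<phi>. Ck 1 \<phi> \<longrightarrow>
    (\<integral>\<^sup>+z\<in>frontier S \<inter> cball x r. ennreal ((norm (\<phi> z))\<^sup>2) \<partial>surface_measure)
      \<le> ennreal C * (\<integral>\<^sup>+y\<in>S. ennreal ((norm (\<phi> y))\<^sup>2 + (norm (classical_gradient \<phi> y))\<^sup>2) \<partial>lborel)"
proof -
  obtain U e h L where U: "open U" "x \<in> U" and e: "norm e = 1" and h: "L-lipschitz_on {z. z \<bullet> e = 0} h"
      and SU: "S \<inter> U = {y \<in> U. y \<bullet> e < h (y - (y \<bullet> e) *\<^sub>R e)}"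
    using S x unfolding lipschitz_set_def by meson
  have oS: "open S" using S by (simp add: lipschitz_set_def)
  define g where "g = (\<lambda>y. h (y - (y \<bullet> e) *\<^sub>R e) - y \<bullet> e)"
  interpret graph_chart g e "L + 1"
    unfolding g_def using e h by (rule graph_chart_of_lipschitz)
  have SU': "y \<in> S \<longleftrightarrow> 0 < g y" if "y \<in> U" for y
    using SU that by (auto simp: g_def set_eq_iff)
  obtain r where r: "0 < r" "ball x (3 * r) \<subseteq> U"
  proof -
    obtain r where "0 < r" "ball x r \<subseteq> U" using U openE by blast
    then show thesis using that[of "r / 3"] by simp
  qed
  define A where "A = frontier S \<inter> cball x r"
  have A: "A \<in> sets borel" by (simp add: A_def borel_closed closed_Int)
  have AR: "A \<subseteq> cball 0 (norm x + r)"
  proof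
    fix z assume "z \<in> A"
    then have "dist x z \<le> r" by (simp add: A_def)
    then show "z \<in> cball 0 (norm x + r)" using norm_triangle_sub[of z x] by (simp add: dist_norm norm_minus_commute)
  qed
  have AU: "A \<subseteq> U"
    using r by (auto simp: A_def)
  have A0: "g z = 0" if "z \<in> A" for z
  proof -
    have z: "z \<in> U" "z \<in> frontier S" using that AU by (auto simp: A_def)
    then have zS: "z \<notin> S" using oS by (simp add: frontier_def interior_open)
    then have "\<not> 0 < g z" using SU' z by simp
    moreover have "\<not> g z < 0"
    proof
      assume "g z < 0"
      then have "z \<in> U \<inter> {y. g y < 0}" using z by simp
      moreover have "open (U \<inter> {y. g y < 0})"
        using U(1) continuous_g by (intro open_Int open_Collect_less) auto
      moreover have "S \<inter> (U \<inter> {y. g y < 0}) = {}" using SU' by auto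
      ultimately have "z \<notin> closure S"
        by (metis (no_types, lifting) Int_commute disjoint_iff open_Int_closure_eq_empty)
      then show False using z by (simp add: frontier_def)
    qed
    ultimately show ?thesis by linarith
  qed
  have slabS: "slab r A \<subseteq> S"
  proof
    fix y assume y: "y \<in> slab r A"
    then have "dist x (foot y) \<le> r" "dist (foot y) y < r" "0 < g y"
      by (auto simp: slab_def A_def dist_foot_self)
    then have "dist x y < 3 * r" using dist_triangle[of x y "foot y"] r by linarith
    then show "y \<in> S" using r SU'[of y] \<open>0 < g y\<close> by auto
  qed
  have dim': "2 \<le> DIM(real ^ 'n)" using dim by simp
  from trace_le_slab[OF dim' r(1)] obtain C where C: "0 \<le> C" and
    C_le: "\<forall>A\<in>sets borel. \<forall>R \<phi> d. A \<subseteq> cball 0 R \<longrightarrow> (\<forall>x\<in>A. g x = 0) \<longrightarrow>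
     continuous_on UNIV \<phi> \<longrightarrow> continuous_on UNIV d \<longrightarrow>
     (\<forall>y t. ((\<lambda>t. \<phi> (y + t *\<^sub>R e)) has_vector_derivative (d (y + t *\<^sub>R e) :: complex)) (at t)) \<longrightarrow>
     (\<integral>\<^sup>+x\<in>A. ennreal ((norm (\<phi> x))\<^sup>2) \<partial>hausdorff_measure (DIM(real ^ 'n) - 1))
       \<le> ennreal C * (\<integral>\<^sup>+y\<in>slab r A. ennreal ((norm (\<phi> y))\<^sup>2 + (norm (d y))\<^sup>2) \<partial>lborel)"
    by (elim exE conjE)
  show ?thesis
  proof (rule exI[of _ r], rule conjI[OF r(1)], rule exI[of _ C], rule conjI[OF C], intro allI impI)
    fix \<phi> :: "real ^ 'n \<Rightarrow> complex" assume \<phi>: "Ck 1 \<phi>"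
    define d where "d = (\<lambda>y. \<Sum>i\<in>UNIV. of_real (e $ i) * partial_deriv i \<phi> y)"
    have c\<phi>: "continuous_on UNIV \<phi>" using \<phi> by (rule Ck_continuous)
    have cp: "continuous_on UNIV (partial_deriv i \<phi>)" for i using \<phi> by simp
    have cd: "continuous_on UNIV d" unfolding d_def by (intro continuous_intros cp)
    have der: "((\<lambda>t. \<phi> (y + t *\<^sub>R e)) has_vector_derivative d (y + t *\<^sub>R e)) (at t)" for y t
      unfolding d_def using \<phi> by (intro has_vector_derivative_along) simp
    have dle: "norm (d y) \<le> norm (classical_gradient \<phi> y)" for y
      using norm_directional_le[of e "classical_gradient \<phi> y"] e by (simp add: d_def classical_gradient_def)
    have "(\<integral>\<^sup>+z\<in>A. ennreal ((norm (\<phi> z))\<^sup>2) \<partial>hausdorff_measure (DIM(real ^ 'n) - 1))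
        \<le> ennreal C * (\<integral>\<^sup>+y\<in>slab r A. ennreal ((norm (\<phi> y))\<^sup>2 + (norm (d y))\<^sup>2) \<partial>lborel)"
      using A0 c\<phi> cd der by (intro C_le[rule_format, OF A AR]) auto
    also have "\<dots> \<le> ennreal C * (\<integral>\<^sup>+y\<in>S. ennreal ((norm (\<phi> y))\<^sup>2 + (norm (classical_gradient \<phi> y))\<^sup>2) \<partial>lborel)"
      using slabS dle
      by (intro mult_left_mono nn_integral_mono) (auto simp: indicator_def intro!: ennreal_leI power_mono)
    finally show "(\<integral>\<^sup>+z\<in>frontier S \<inter> cball x r. ennreal ((norm (\<phi> z))\<^sup>2) \<partial>surface_measure)
      \<le> ennreal C * (\<integral>\<^sup>+y\<in>S. ennreal ((norm (\<phi> y))\<^sup>2 + (norm (classical_gradient \<phi> y))\<^sup>2) \<partial>lborel)"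
      by (simp add: A_def surface_measure_def)
  qed
qed

lemma sets_surface_measure [simp, measurable_cong]: "sets surface_measure = sets borel"
  by (simp add: surface_measure_def)

theorem trace_inequality:
  fixes S :: "(real ^ 'n) set"
  assumes dim: "2 \<le> CARD('n)" and S: "lipschitz_set S"
  shows "\<exists>C\<ge>0. \<forall>\<phi>. Ck 1 \<phi> \<longrightarrow>
    (\<integral>\<^sup>+z\<in>frontier S \<inter> cball 0 R. ennreal ((norm (\<phi> z))\<^sup>2) \<partial>surface_measure)
      \<le> ennreal C * (\<integral>\<^sup>+y\<in>S. ennreal ((norm (\<phi> y))\<^sup>2 + (norm (classical_gradient \<phi> y))\<^sup>2) \<partial>lborel)"
proof -
  let ?I = "\<lambda>\<phi>. \<integral>\<^sup>+y\<in>S. ennreal ((norm (\<phi> y))\<^sup>2 + (norm (classical_gradient \<phi> y))\<^sup>2) \<partial>lborel"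
  define P where "P x r C \<longleftrightarrow> 0 < r \<and> 0 \<le> C \<and> (\<forall>\<phi>. Ck 1 \<phi> \<longrightarrow>
    (\<integral>\<^sup>+z\<in>frontier S \<inter> cball x r. ennreal ((norm (\<phi> z))\<^sup>2) \<partial>surface_measure) \<le> ennreal C * ?I \<phi>)" for x r C
  have "\<exists>r C. P x r C" if "x \<in> frontier S" for x
    using local_trace_inequality[OF dim S that] unfolding P_def by blast
  then obtain r C where rC: "\<And>x. x \<in> frontier S \<Longrightarrow> P x (r x) (C x)" by metis
  have rC_pos: "0 < r x" "0 \<le> C x" if "x \<in> frontier S" for x using rC[OF that] by (simp_all add: P_def)
  have "compact (frontier S \<inter> cball 0 R)" by (simp add: closed_Int_compact)
  moreover have "frontier S \<inter> cball 0 R \<subseteq> (\<Union>x\<in>frontier S. ball x (r x))" using rC_pos by fastforce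
  ultimately obtain D where D: "D \<subseteq> frontier S" "finite D" "frontier S \<inter> cball 0 R \<subseteq> (\<Union>x\<in>D. ball x (r x))"
    by (rule compactE_image[OF _ open_ball])
  show ?thesis
  proof (intro exI[of _ "\<Sum>x\<in>D. C x"] conjI allI impI)
    show "0 \<le> sum C D" using D rC_pos by (intro sum_nonneg) auto
    fix \<phi> :: "real ^ 'n \<Rightarrow> complex" assume \<phi>: "Ck 1 \<phi>"
    have [measurable]: "\<phi> \<in> borel_measurable borel"
      using Ck_continuous[OF \<phi>] by (rule borel_measurable_continuous_onI)
    have [measurable]: "frontier S \<inter> cball x (r x) \<in> sets borel" for x
      by (simp add: borel_closed closed_Int)
    have "(\<integral>\<^sup>+z\<in>frontier S \<inter> cball 0 R. ennreal ((norm (\<phi> z))\<^sup>2) \<partial>surface_measure)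
       \<le> (\<integral>\<^sup>+z. (\<Sum>x\<in>D. ennreal ((norm (\<phi> z))\<^sup>2) * indicator (frontier S \<inter> cball x (r x)) z) \<partial>surface_measure)"
    proof (rule nn_integral_mono)
      fix z
      show "ennreal ((norm (\<phi> z))\<^sup>2) * indicator (frontier S \<inter> cball 0 R) z
         \<le> (\<Sum>x\<in>D. ennreal ((norm (\<phi> z))\<^sup>2) * indicator (frontier S \<inter> cball x (r x)) z)"
      proof (cases "z \<in> frontier S \<inter> cball 0 R")
        case True
        then obtain x where x: "x \<in> D" "z \<in> ball x (r x)" using D by auto
        then have "ennreal ((norm (\<phi> z))\<^sup>2) = ennreal ((norm (\<phi> z))\<^sup>2) * indicator (frontier S \<inter> cball x (r x)) z"
          using True by simp
        also have "\<dots> \<le> (\<Sum>x\<in>D. ennreal ((norm (\<phi> z))\<^sup>2) * indicator (frontier S \<inter> cball x (r x)) z)"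
          using x D by (intro member_le_sum) auto
        finally show ?thesis using True by simp
      qed simp
    qed
    also have "\<dots> = (\<Sum>x\<in>D. \<integral>\<^sup>+z\<in>frontier S \<inter> cball x (r x). ennreal ((norm (\<phi> z))\<^sup>2) \<partial>surface_measure)"
      by (rule nn_integral_sum) measurable
    also have "\<dots> \<le> (\<Sum>x\<in>D. ennreal (C x) * ?I \<phi>)"
      using rC \<phi> D unfolding P_def by (intro sum_mono) blast
    also have "\<dots> = (\<Sum>x\<in>D. ennreal (C x)) * ?I \<phi>" by (simp add: sum_distrib_right)
    also have "(\<Sum>x\<in>D. ennreal (C x)) = ennreal (\<Sum>x\<in>D. C x)"
      using rC_pos D by (intro sum_ennreal) auto
    finally show "(\<integral>\<^sup>+z\<in>frontier S \<inter> cball 0 R. ennreal ((norm (\<phi> z))\<^sup>2) \<partial>surface_measure) \<le> ennreal (sum C D) * ?I \<phi>" .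
  qed
qed

section \<open>Test functions\<close>

lemma partial_deriv_eqI:
  assumes "(\<phi> has_derivative D) (at x)"
  shows "partial_deriv i \<phi> x = D (axis i 1)"
  using frechet_derivative_at[OF assms] by (simp add: partial_deriv_def)

lemma partial_deriv_lin:
  assumes "\<phi> differentiable (at x)" "\<psi> differentiable (at x)"
  shows "partial_deriv i (\<lambda>x. a * \<phi> x + b * \<psi> x) x = a * partial_deriv i \<phi> x + b * partial_deriv i \<psi> x"
proof -
  have "((\<lambda>x. a * \<phi> x + b * \<psi> x) has_derivative
      (\<lambda>v. a * frechet_derivative \<phi> (at x) v + b * frechet_derivative \<psi> (at x) v)) (at x)"
    using assms by (intro derivative_intros) (auto simp: frechet_derivative_works)
  then show ?thesis by (subst partial_deriv_eqI) (simp_all add: partial_deriv_def)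
qed

lemma partial_deriv_mult:
  assumes "\<phi> differentiable (at x)" "\<psi> differentiable (at x)"
  shows "partial_deriv i (\<lambda>x. \<phi> x * \<psi> x) x = \<phi> x * partial_deriv i \<psi> x + partial_deriv i \<phi> x * \<psi> x"
proof -
  have "((\<lambda>x. \<phi> x * \<psi> x) has_derivative
      (\<lambda>v. \<phi> x * frechet_derivative \<psi> (at x) v + frechet_derivative \<phi> (at x) v * \<psi> x)) (at x)"
    using assms by (intro has_derivative_mult) (auto simp: frechet_derivative_works)
  then show ?thesis by (subst partial_deriv_eqI) (simp_all add: partial_deriv_def)
qed

lemma partial_deriv_cnj:
  assumes "\<phi> differentiable (at x)"
  shows "cnj_fun \<phi> differentiable (at x)"
    and "partial_deriv i (cnj_fun \<phi>) x = cnj (partial_deriv i \<phi> x)"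
proof -
  have "(cnj_fun \<phi> has_derivative (\<lambda>v. cnj (frechet_derivative \<phi> (at x) v))) (at x)"
    unfolding cnj_fun_def using assms
    by (intro has_derivative_cnj) (auto simp: frechet_derivative_works)
  then show "cnj_fun \<phi> differentiable (at x)" "partial_deriv i (cnj_fun \<phi>) x = cnj (partial_deriv i \<phi> x)"
    using partial_deriv_eqI by (auto simp: differentiable_def partial_deriv_def[of i \<phi>])
qed

lemma Ck_lin: "Ck k \<phi> \<Longrightarrow> Ck k \<psi> \<Longrightarrow> Ck k (\<lambda>x. a * \<phi> x + b * \<psi> x)"
proof (induction k arbitrary: \<phi> \<psi>)
  case 0
  then show ?case by (auto intro!: continuous_intros)
next
  case (Suc k)
  have "partial_deriv i (\<lambda>x. a * \<phi> x + b * \<psi> x) = (\<lambda>x. a * partial_deriv i \<phi> x + b * partial_deriv i \<psi> x)" for i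
    using Suc.prems by (intro ext partial_deriv_lin) auto
  then show ?case using Suc by (auto intro!: derivative_intros)
qed

lemma Ck_cnj: "Ck k \<phi> \<Longrightarrow> Ck k (cnj_fun \<phi>)"
proof (induction k arbitrary: \<phi>)
  case 0
  then show ?case by (auto simp: cnj_fun_def intro!: continuous_intros)
next
  case (Suc k)
  have "partial_deriv i (cnj_fun \<phi>) = cnj_fun (partial_deriv i \<phi>)" for i
    using Suc.prems by (intro ext) (simp add: partial_deriv_cnj cnj_fun_def[of "partial_deriv i \<phi>"])
  then show ?case using Suc by (auto intro: partial_deriv_cnj)
qed

lemma Ck_mono: "Ck (Suc k) \<phi> \<Longrightarrow> Ck k \<phi>"
proof (induction k arbitrary: \<phi>)
  case 0
  from Ck_continuous[OF this] show ?case by simp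
next
  case (Suc k)
  then show ?case using Ck_SucD[of "Suc k" \<phi>] by auto
qed

lemma Ck_mult: "Ck k \<phi> \<Longrightarrow> Ck k \<psi> \<Longrightarrow> Ck k (\<lambda>x. \<phi> x * \<psi> x)"
proof (induction k arbitrary: \<phi> \<psi>)
  case 0
  then show ?case by (auto intro!: continuous_intros)
next
  case (Suc k)
  have "partial_deriv i (\<lambda>x. \<phi> x * \<psi> x) = (\<lambda>x. 1 * (\<phi> x * partial_deriv i \<psi> x) + 1 * (partial_deriv i \<phi> x * \<psi> x))" for i
    using partial_deriv_mult[OF Ck_SucD(1)[OF Suc.prems(1)] Ck_SucD(1)[OF Suc.prems(2)]] by (intro ext) simp
  moreover have "Ck k (\<lambda>x. 1 * (\<phi> x * partial_deriv i \<psi> x) + 1 * (partial_deriv i \<phi> x * \<psi> x))" for i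
    using Suc.IH Ck_mono[OF Suc.prems(1)] Ck_mono[OF Suc.prems(2)] Suc.prems by (intro Ck_lin) auto
  ultimately show ?case using Suc.prems by (auto intro!: derivative_intros)
qed

lemma Ck_const: "Ck k (\<lambda>x. c)"
proof (induction k arbitrary: c)
  case (Suc k)
  have "partial_deriv i (\<lambda>x :: real ^ 'a. c) = (\<lambda>x. 0)" for i
    by (intro ext partial_deriv_eqI[of _ "\<lambda>v. 0", simplified]) simp
  then show ?case using Suc[of 0] by simp
qed simp

lemma Ck_prod: "finite I \<Longrightarrow> (\<And>i. i \<in> I \<Longrightarrow> Ck k (f i)) \<Longrightarrow> Ck k (\<lambda>x. \<Prod>i\<in>I. f i x)"
  by (induction I rule: finite_induct) (auto intro: Ck_const Ck_mult)

lemma test_functionsD: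
  assumes "\<phi> \<in> test_functions \<Omega>"
  shows "Ck k \<phi>" "continuous_on UNIV \<phi>" "\<phi> differentiable (at x)"
    "\<And>x. x \<notin> closure {x. \<phi> x \<noteq> 0} \<Longrightarrow> \<phi> x = 0"
    "compact (closure {x. \<phi> x \<noteq> 0})" "closure {x. \<phi> x \<noteq> 0} \<subseteq> \<Omega>"
proof -
  have *: "\<forall>k. Ck k \<phi>" using assms by (simp add: test_functions_def)
  then show "Ck k \<phi>" "continuous_on UNIV \<phi>" using Ck_continuous by auto
  show "\<phi> differentiable (at x)" using Ck_SucD(1)[of 0 \<phi>] * by blast
  show "x \<notin> closure {x. \<phi> x \<noteq> 0} \<Longrightarrow> \<phi> x = 0" for x
    using closure_subset[of "{x. \<phi> x \<noteq> 0}"] by auto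
  show "compact (closure {x. \<phi> x \<noteq> 0})" "closure {x. \<phi> x \<noteq> 0} \<subseteq> \<Omega>"
    using assms by (simp_all add: test_functions_def)
qed

lemma test_functionsI:
  assumes "\<And>k. Ck k \<phi>" "compact K" "K \<subseteq> \<Omega>" "\<And>x. x \<notin> K \<Longrightarrow> \<phi> x = 0"
  shows "\<phi> \<in> test_functions \<Omega>"
proof -
  have "closure {x. \<phi> x \<noteq> 0} \<subseteq> K"
    using assms(2,4) by (intro closure_minimal) (auto simp: compact_imp_closed)
  moreover have "compact (closure {x. \<phi> x \<noteq> 0})"
    using assms(2) calculation by (meson bounded_subset closed_closure compact_eq_bounded_closed)
  ultimately show ?thesis using assms by (auto simp: test_functions_def)
qed

lemma test_functions_lin:
  assumes \<phi>: "\<phi> \<in> test_functions \<Omega>" and \<psi>: "\<psi> \<in> test_functions \<Omega>"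
  shows "(\<lambda>x. a * \<phi> x + b * \<psi> x) \<in> test_functions \<Omega>"
proof (rule test_functionsI)
  show "compact (closure {x. \<phi> x \<noteq> 0} \<union> closure {x. \<psi> x \<noteq> 0})"
    using \<phi> \<psi> by (intro compact_Un test_functionsD)
  show "closure {x. \<phi> x \<noteq> 0} \<union> closure {x. \<psi> x \<noteq> 0} \<subseteq> \<Omega>"
    using test_functionsD(6)[OF \<phi>] test_functionsD(6)[OF \<psi>] by simp
  show "Ck k (\<lambda>x. a * \<phi> x + b * \<psi> x)" for k
    using test_functionsD(1)[OF \<phi>] test_functionsD(1)[OF \<psi>] by (rule Ck_lin)
  show "a * \<phi> x + b * \<psi> x = 0" if "x \<notin> closure {x. \<phi> x \<noteq> 0} \<union> closure {x. \<psi> x \<noteq> 0}" for x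
    using that test_functionsD(4)[OF \<phi>, of x] test_functionsD(4)[OF \<psi>, of x] by simp
qed

lemma test_functions_cnj:
  assumes \<phi>: "\<phi> \<in> test_functions \<Omega>"
  shows "cnj_fun \<phi> \<in> test_functions \<Omega>"
  using Ck_cnj[OF test_functionsD(1)[OF \<phi>]] test_functionsD(5,6)[OF \<phi>]
proof (rule test_functionsI)
  show "cnj_fun \<phi> x = 0" if "x \<notin> closure {x. \<phi> x \<noteq> 0}" for x
    using test_functionsD(4)[OF \<phi> that] by (simp add: cnj_fun_def)
qed

lemma test_functions_zero: "(\<lambda>x. 0) \<in> test_functions \<Omega>"
  by (intro test_functionsI[of _ "{}"] Ck_const) auto

lemma partial_deriv_zero_outside:
  assumes "x \<notin> closure {x. \<phi> x \<noteq> 0}"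
  shows "partial_deriv i \<phi> x = 0"
proof -
  have "(\<phi> has_derivative (\<lambda>v. 0)) (at x)"
  proof (rule has_derivative_transform_within_open[of "\<lambda>x. 0" _ _ _ "- closure {x. \<phi> x \<noteq> 0}"])
    show "y \<in> - closure {x. \<phi> x \<noteq> 0} \<Longrightarrow> 0 = \<phi> y" for y
      using closure_subset[of "{x. \<phi> x \<noteq> 0}"] by auto
  qed (use assms in auto)
  from partial_deriv_eqI[OF this] show ?thesis .
qed

lemma test_functions_partial_deriv:
  assumes \<phi>: "\<phi> \<in> test_functions \<Omega>"
  shows "partial_deriv i \<phi> \<in> test_functions \<Omega>"
  using Ck_SucD(2)[OF test_functionsD(1)[OF \<phi>]] test_functionsD(5,6)[OF \<phi>] partial_deriv_zero_outside
  by (rule test_functionsI)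

lemma continuous_compact_support_bounded:
  fixes f :: "'a::topological_space \<Rightarrow> 'b::real_normed_vector"
  assumes "continuous_on UNIV f" "compact K" "\<And>x. x \<notin> K \<Longrightarrow> f x = 0"
  shows "\<exists>B>0. \<forall>x. norm (f x) \<le> B"
proof -
  have "compact (f ` K)"
    using assms by (intro compact_continuous_image) (auto intro: continuous_on_subset)
  then obtain B where "0 < B" "\<forall>x\<in>K. norm (f x) \<le> B"
    using compact_imp_bounded bounded_pos by (metis imageI)
  then have "norm (f x) \<le> B" for x using assms(3)[of x] by (cases "x \<in> K") auto
  then show ?thesis using \<open>0 < B\<close> by blast
qed

lemma continuous_compact_support_integrable:
  fixes f :: "'a::euclidean_space \<Rightarrow> 'b::{banach, second_countable_topology}"
  assumes "continuous_on UNIV f" "compact K" "\<And>x. x \<notin> K \<Longrightarrow> f x = 0"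
  shows "integrable lborel f"
proof -
  have "integrable lborel (\<lambda>x. indicator K x *\<^sub>R f x)"
    using assms by (intro borel_integrable_compact) (auto intro: continuous_on_subset)
  moreover have "(\<lambda>x. indicator K x *\<^sub>R f x) = f" using assms(3) by (auto simp: indicator_def)
  ultimately show ?thesis by simp
qed

lemma integral_lborel_shift:
  fixes f :: "'a::euclidean_space \<Rightarrow> 'b::{banach, second_countable_topology}"
  assumes [measurable]: "f \<in> borel_measurable borel"
  shows "(LINT x|lborel. f (x + a)) = (LINT x|lborel. f x)"
proof -
  have "(LINT x|lborel. f x) = (LINT x|distr lborel borel ((+) a). f x)"
    by (simp add: lborel_distr_plus)
  also have "\<dots> = (LINT x|lborel. f (a + x))" by (subst integral_distr) auto
  finally show ?thesis by (simp add: add.commute)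
qed

lemma has_vector_derivative_quotient:
  fixes f :: "real \<Rightarrow> 'a::real_normed_vector"
  assumes "(f has_vector_derivative D) (at x)"
  shows "((\<lambda>h. (f (x + h) - f x) /\<^sub>R h) \<longlongrightarrow> D) (at 0)"
proof (rule LIM_zero_cancel, rule tendsto_norm_zero_cancel)
  have "((\<lambda>h. norm (f (x + h) - f x - h *\<^sub>R D) / norm h) \<longlongrightarrow> 0) (at 0)"
    using assms by (simp add: has_vector_derivative_def has_derivative_at)
  then show "((\<lambda>h. norm ((f (x + h) - f x) /\<^sub>R h - D)) \<longlongrightarrow> 0) (at 0)"
  proof (rule Lim_transform_eventually)
    have "norm (f (x + h) - f x - h *\<^sub>R D) / norm h = norm ((f (x + h) - f x) /\<^sub>R h - D)" if "h \<noteq> 0" for h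
    proof -
      have "(f (x + h) - f x) /\<^sub>R h - D = (f (x + h) - f x - h *\<^sub>R D) /\<^sub>R h"
        using that by (simp add: scaleR_diff_right)
      then show ?thesis by (simp add: divide_inverse mult.commute)
    qed
    then show "\<forall>\<^sub>F h in at 0. norm (f (x + h) - f x - h *\<^sub>R D) / norm h = norm ((f (x + h) - f x) /\<^sub>R h - D)"
      by (auto simp: eventually_at_filter)
  qed
qed

text \<open>The difference quotients of \<open>\<phi>\<close> have integral zero by translation invariance, and they
  converge boundedly to the derivative.\<close>

lemma integral_partial_deriv_eq_0:
  fixes \<phi> :: "real ^ 'n \<Rightarrow> complex"
  assumes \<phi>: "Ck 1 \<phi>" and K: "compact K" "\<And>x. x \<notin> K \<Longrightarrow> \<phi> x = 0"
  shows "(LINT x|lborel. partial_deriv i \<phi> x) = 0"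
proof -
  define e where "e = (axis i 1 :: real ^ 'n)"
  have e: "norm e = 1" by (simp add: e_def)
  define h where "h k = 1 / real (Suc k)" for k
  have h: "0 < h k" "h k \<le> 1" for k by (auto simp: h_def)
  have c\<phi>: "continuous_on UNIV \<phi>" using \<phi> by (rule Ck_continuous)
  have cp: "continuous_on UNIV (partial_deriv i \<phi>)" using \<phi> by simp
  have [measurable]: "\<phi> \<in> borel_measurable borel" "partial_deriv i \<phi> \<in> borel_measurable borel"
    using c\<phi> cp by (auto intro: borel_measurable_continuous_onI)
  have "closure {x. \<phi> x \<noteq> 0} \<subseteq> K"
    using K by (intro closure_minimal) (auto simp: compact_imp_closed)
  then have p0: "partial_deriv i \<phi> x = 0" if "x \<notin> K" for x
    using partial_deriv_zero_outside that by blast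
  obtain B where B: "0 < B" "\<And>x. norm (partial_deriv i \<phi> x) \<le> B"
    using continuous_compact_support_bounded[OF cp K(1) p0] by blast
  obtain R where R: "\<And>x. x \<in> K \<Longrightarrow> norm x \<le> R"
    using compact_imp_bounded[OF K(1)] by (auto simp: bounded_iff)
  have der: "((\<lambda>t. \<phi> (y + t *\<^sub>R e)) has_vector_derivative partial_deriv i \<phi> (y + t *\<^sub>R e)) (at t)" for y t
  proof -
    have "(\<Sum>j\<in>UNIV. of_real (e $ j) * partial_deriv j \<phi> (y + t *\<^sub>R e)) = partial_deriv i \<phi> (y + t *\<^sub>R e)"
      by (simp add: e_def axis_def if_distrib[of of_real] if_distrib[of "\<lambda>c. c * _"] cong: if_cong)
    then show ?thesis using has_vector_derivative_along[of \<phi> y t e] \<phi> by simp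
  qed
  define q where "q k x = (1 / h k) *\<^sub>R (\<phi> (x + h k *\<^sub>R e) - \<phi> x)" for k x
  have int\<phi>: "integrable lborel \<phi>" using c\<phi> K by (rule continuous_compact_support_integrable)
  have q0: "(LINT x|lborel. q k x) = 0" for k
  proof -
    have "integrable lborel (\<lambda>x. \<phi> (x + h k *\<^sub>R e))"
    proof (rule continuous_compact_support_integrable)
      show "continuous_on UNIV (\<lambda>x. \<phi> (x + h k *\<^sub>R e))"
        by (rule continuous_on_compose2[OF c\<phi>]) (auto intro!: continuous_intros)
      show "compact ((\<lambda>y. y - h k *\<^sub>R e) ` K)"
        using K(1) by (intro compact_continuous_image continuous_intros)
      show "x \<notin> (\<lambda>y. y - h k *\<^sub>R e) ` K \<Longrightarrow> \<phi> (x + h k *\<^sub>R e) = 0" for x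
        using K(2) by (metis add_diff_cancel_right' image_eqI)
    qed
    then show ?thesis using int\<phi> by (simp add: q_def integral_lborel_shift)
  qed
  have lim: "(\<lambda>k. q k x) \<longlonglongrightarrow> partial_deriv i \<phi> x" for x
  proof -
    have "((\<lambda>t. \<phi> (x + t *\<^sub>R e)) has_vector_derivative partial_deriv i \<phi> x) (at 0)"
      using der[of x 0] by simp
    then have "((\<lambda>t. (\<phi> (x + t *\<^sub>R e) - \<phi> x) /\<^sub>R t) \<longlongrightarrow> partial_deriv i \<phi> x) (at 0)"
      using has_vector_derivative_quotient by fastforce
    moreover have "filterlim h (at 0) sequentially"
    proof -
      have "h = (\<lambda>k. inverse (real (Suc k)))" by (auto simp: h_def inverse_eq_divide)
      then have "h \<longlonglongrightarrow> 0" using LIMSEQ_inverse_real_of_nat by metis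
      then show ?thesis unfolding filterlim_at using h(1) by (auto intro!: always_eventually simp: less_imp_neq[symmetric])
    qed
    ultimately have "(\<lambda>k. (\<phi> (x + h k *\<^sub>R e) - \<phi> x) /\<^sub>R h k) \<longlonglongrightarrow> partial_deriv i \<phi> x"
      by (rule filterlim_compose)
    then show ?thesis by (simp add: q_def inverse_eq_divide)
  qed
  have bound: "norm (q k x) \<le> B * indicator (cball 0 (R + 1)) x" for k x
  proof -
    have "norm (\<phi> (x + h k *\<^sub>R e) - \<phi> (x + 0 *\<^sub>R e)) \<le> B * norm (h k - 0)"
    proof (rule differentiable_bound[of UNIV "\<lambda>t. \<phi> (x + t *\<^sub>R e)" "\<lambda>t v. v *\<^sub>R partial_deriv i \<phi> (x + t *\<^sub>R e)"])
      fix t :: real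
      show "((\<lambda>t. \<phi> (x + t *\<^sub>R e)) has_derivative (\<lambda>v. v *\<^sub>R partial_deriv i \<phi> (x + t *\<^sub>R e))) (at t within UNIV)"
        using der[of x t] by (simp add: has_vector_derivative_def)
      show "onorm (\<lambda>v. v *\<^sub>R partial_deriv i \<phi> (x + t *\<^sub>R e)) \<le> B"
        using B by (intro onorm_le) (simp add: mult.commute[of B] mult_left_mono)
    qed auto
    then have "norm (q k x) \<le> B" using h[of k] unfolding q_def norm_scaleR by (simp add: divide_le_eq)
    moreover have "q k x = 0" if "x \<notin> cball 0 (R + 1)"
    proof -
      have n: "R + 1 < norm x" using that by simp
      have "norm (h k *\<^sub>R e) \<le> 1" using e h[of k] by simp
      then have "R < norm (x + h k *\<^sub>R e)"
        using n norm_triangle_ineq4[of "x + h k *\<^sub>R e" "h k *\<^sub>R e"] by simp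
      then have "x \<notin> K" "x + h k *\<^sub>R e \<notin> K" using R n by force+
      then show ?thesis by (simp add: q_def K(2))
    qed
    ultimately show ?thesis by (auto simp: indicator_def)
  qed
  have "(\<lambda>k. LINT x|lborel. q k x) \<longlonglongrightarrow> (LINT x|lborel. partial_deriv i \<phi> x)"
  proof (rule integral_dominated_convergence)
    show "integrable lborel (\<lambda>x :: real ^ 'n. B * indicator (cball 0 (R + 1)) x)"
      by (intro integrable_mult_right integrable_real_indicator) (use emeasure_lborel_cball_finite in \<open>auto simp: less_top\<close>)
    show "AE x in lborel. (\<lambda>k. q k x) \<longlonglongrightarrow> partial_deriv i \<phi> x" using lim by simp
    show "AE x in lborel. norm (q k x) \<le> B * indicator (cball 0 (R + 1)) x" for k using bound by simp
    show "q k \<in> borel_measurable lborel" for k unfolding q_def[abs_def] by measurable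
  qed measurable
  then show ?thesis using q0 by (simp add: LIMSEQ_const_iff)
qed

lemma integral_lebesgue_on_eq_lborel:
  fixes f :: "'a::euclidean_space \<Rightarrow> 'b::{banach, second_countable_topology}"
  assumes "\<Omega> \<in> sets lebesgue" "f \<in> borel_measurable borel" "\<And>x. x \<notin> \<Omega> \<Longrightarrow> f x = 0"
  shows "(LINT x|lebesgue_on \<Omega>. f x) = (LINT x|lborel. f x)"
proof -
  have "(LINT x|lebesgue_on \<Omega>. f x) = (LINT x|lebesgue. indicator \<Omega> x *\<^sub>R f x)"
    using assms(1) by (intro integral_restrict_space) simp
  also have "(\<lambda>x. indicator \<Omega> x *\<^sub>R f x) = f" using assms(3) by (auto simp: indicator_def)
  finally show ?thesis using assms(2) by (simp add: integral_completion)
qed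

lemma test_function_weak_gradient:
  fixes \<phi> :: "real ^ 'n \<Rightarrow> complex"
  assumes \<Omega>: "open \<Omega>" and \<phi>: "\<phi> \<in> test_functions UNIV"
  shows "has_weak_gradient \<Omega> \<phi> (classical_gradient \<phi>)"
  unfolding has_weak_gradient_def
proof (intro ballI allI)
  fix \<psi> i assume \<psi>: "\<psi> \<in> test_functions \<Omega>"
  note D\<phi> = test_functionsD[OF \<phi>] and D\<psi> = test_functionsD[OF \<psi>]
  note P\<phi> = test_functionsD[OF test_functions_partial_deriv[OF \<phi>, of i]]
  note P\<psi> = test_functionsD[OF test_functions_partial_deriv[OF \<psi>, of i]]
  have [measurable]: "\<phi> \<in> borel_measurable borel" "\<psi> \<in> borel_measurable borel"
     "partial_deriv i \<phi> \<in> borel_measurable borel" "partial_deriv i \<psi> \<in> borel_measurable borel"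
    using D\<phi>(2) D\<psi>(2) P\<phi>(2) P\<psi>(2) by (auto intro: borel_measurable_continuous_onI)
  have sup: "x \<notin> \<Omega> \<Longrightarrow> \<psi> x = 0" "x \<notin> \<Omega> \<Longrightarrow> partial_deriv i \<psi> x = 0" for x
    using D\<psi> P\<psi> by blast+
  have i1: "integrable lborel (\<lambda>x. \<phi> x * partial_deriv i \<psi> x)"
    by (rule continuous_compact_support_integrable[OF continuous_on_mult[OF D\<phi>(2) P\<psi>(2)] P\<psi>(5)])
      (frule P\<psi>(4), simp)
  have i2: "integrable lborel (\<lambda>x. partial_deriv i \<phi> x * \<psi> x)"
    by (rule continuous_compact_support_integrable[OF continuous_on_mult[OF P\<phi>(2) D\<psi>(2)] D\<psi>(5)])
      (frule D\<psi>(4), simp)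
  have "0 = (LINT x|lborel. partial_deriv i (\<lambda>x. \<phi> x * \<psi> x) x)"
    by (rule integral_partial_deriv_eq_0[OF Ck_mult[OF D\<phi>(1) D\<psi>(1)] D\<psi>(5), symmetric]) (frule D\<psi>(4), simp)
  also have "\<dots> = (LINT x|lborel. \<phi> x * partial_deriv i \<psi> x + partial_deriv i \<phi> x * \<psi> x)"
    by (rule arg_cong[of _ _ "integral\<^sup>L lborel"], rule ext, rule partial_deriv_mult[OF D\<phi>(3) D\<psi>(3)])
  also have "\<dots> = (LINT x|lborel. \<phi> x * partial_deriv i \<psi> x) + (LINT x|lborel. partial_deriv i \<phi> x * \<psi> x)"
    using i1 i2 by (rule Bochner_Integration.integral_add)
  finally have "(LINT x|lborel. \<phi> x * partial_deriv i \<psi> x) = - (LINT x|lborel. partial_deriv i \<phi> x * \<psi> x)"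
    by (simp add: add_eq_0_iff2)
  then show "(LINT x|lebesgue_on \<Omega>. \<phi> x * partial_deriv i \<psi> x) = - (LINT x|lebesgue_on \<Omega>. classical_gradient \<phi> x $ i * \<psi> x)"
    using \<Omega> sup by (simp add: classical_gradient_def integral_lebesgue_on_eq_lborel)
qed

section \<open>The fundamental lemma of the calculus of variations\<close>

text \<open>This family is closed under differentiation, so its members are smooth.\<close>

definition flat_fun :: "real poly \<Rightarrow> real \<Rightarrow> real" where
  "flat_fun q t = (if 0 < t then poly q (1 / t) * exp (- (1 / t)) else 0)"

lemma poly_exp_tendsto_0: "((\<lambda>x. poly q x * exp (- x)) \<longlongrightarrow> (0 :: real)) at_top"
proof -
  have "((\<lambda>x. x ^ k * (poly q x * exp (- x))) \<longlongrightarrow> (0 :: real)) at_top" for k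
  proof (induction q arbitrary: k)
    case 0
    then show ?case by simp
  next
    case (pCons a q)
    have "((\<lambda>x. a * (x ^ k / exp x) + x ^ Suc k * (poly q x * exp (- x))) \<longlongrightarrow> a * 0 + 0) at_top"
      by (intro tendsto_intros pCons.IH tendsto_power_div_exp_0)
    then show ?case by (simp add: algebra_simps exp_minus divide_inverse)
  qed
  from this[of 0] show ?thesis by simp
qed

lemma flat_fun_deriv:
  "(flat_fun q has_real_derivative flat_fun (monom 1 2 * (q - pderiv q)) t) (at t)"
proof -
  consider "0 < t" | "t < 0" | "t = 0" by linarith
  then show ?thesis
  proof cases
    case 1
    have "((\<lambda>t. poly q (1 / t) * exp (- (1 / t))) has_real_derivative flat_fun (monom 1 2 * (q - pderiv q)) t) (at t)"
      using 1 by (auto intro!: derivative_eq_intros poly_DERIV[THEN DERIV_chain2]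
          simp: flat_fun_def poly_monom field_simps power2_eq_square)
    then show ?thesis
      by (rule has_field_derivative_transform_within_open[of _ _ _ "{0<..}"]) (use 1 in \<open>auto simp: flat_fun_def\<close>)
  next
    case 2
    have "((\<lambda>t. 0) has_real_derivative 0) (at t)" by simp
    then have "(flat_fun q has_real_derivative 0) (at t)"
      by (rule has_field_derivative_transform_within_open[of _ _ _ "{..<0}"]) (use 2 in \<open>auto simp: flat_fun_def\<close>)
    then show ?thesis using 2 by (simp add: flat_fun_def)
  next
    case 3
    have "((\<lambda>h. flat_fun q h / h) \<longlongrightarrow> 0) (at 0)"
    proof (rule filterlim_split_at)
      show "((\<lambda>h. flat_fun q h / h) \<longlongrightarrow> 0) (at_left 0)"
        by (rule Lim_transform_eventually[OF tendsto_const])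
          (auto simp: eventually_at_filter flat_fun_def)
      have "((\<lambda>h. poly (pCons 0 q) (inverse h) * exp (- inverse h)) \<longlongrightarrow> 0) (at_right 0)"
        by (rule filterlim_compose[OF poly_exp_tendsto_0 filterlim_inverse_at_top_right])
      then show "((\<lambda>h. flat_fun q h / h) \<longlongrightarrow> 0) (at_right 0)"
        by (rule Lim_transform_eventually) (auto simp: eventually_at_filter flat_fun_def inverse_eq_divide)
    qed
    moreover have "flat_fun p 0 = 0" for p by (simp add: flat_fun_def)
    ultimately show ?thesis unfolding DERIV_def by (simp add: 3)
  qed
qed

lemma Ck_flat_fun: "Ck k (\<lambda>x :: real ^ 'n. of_real (flat_fun q (s * x $ i + r)))"
proof (induction k arbitrary: q)
  case 0
  have "continuous_on UNIV (flat_fun q)"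
    by (rule DERIV_continuous_on[OF flat_fun_deriv])
  then have "continuous_on UNIV (\<lambda>x :: real ^ 'n. flat_fun q (s * x $ i + r))"
    by (rule continuous_on_compose2) (auto intro!: continuous_intros)
  then show ?case by (auto intro!: continuous_intros)
next
  case (Suc k)
  let ?q = "monom 1 2 * (q - pderiv q)"
  have der: "((\<lambda>x :: real ^ 'n. complex_of_real (flat_fun q (s * x $ i + r))) has_derivative
      (\<lambda>v. of_real (s * v $ i * flat_fun ?q (s * x $ i + r)))) (at x)" for x
  proof -
    have "((\<lambda>x :: real ^ 'n. s * x $ i + r) has_derivative (\<lambda>v. s * v $ i)) (at x)"
      by (auto intro!: derivative_eq_intros bounded_linear.has_derivative[OF bounded_linear_vec_nth])
    from has_derivative_compose[OF this flat_fun_deriv[unfolded has_field_derivative_def]]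
    show ?thesis by (intro has_derivative_of_real) (simp add: mult.commute)
  qed
  have p: "partial_deriv j (\<lambda>x :: real ^ 'n. complex_of_real (flat_fun q (s * x $ i + r)))
      = (\<lambda>x. (if i = j then of_real s else 0) * of_real (flat_fun ?q (s * x $ i + r)) + 0 * 0)" for j
    by (intro ext) (auto simp: partial_deriv_eqI[OF der] axis_def)
  have "Ck k (partial_deriv j (\<lambda>x :: real ^ 'n. complex_of_real (flat_fun q (s * x $ i + r))))" for j
    unfolding p by (intro Ck_lin Suc.IH Ck_const)
  moreover have "(\<lambda>x :: real ^ 'n. complex_of_real (flat_fun q (s * x $ i + r))) differentiable (at x)" for x
    using der differentiable_def by blast
  ultimately show ?case by simp
qed

definition box_bump :: "real ^ 'n \<Rightarrow> real ^ 'n \<Rightarrow> nat \<Rightarrow> real ^ 'n \<Rightarrow> complex" where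
  "box_bump a b k x = (\<Prod>i\<in>UNIV. of_real (flat_fun 1 (real k * x $ i + - real k * a $ i)) *
     of_real (flat_fun 1 (- real k * x $ i + real k * b $ i)))"

lemma flat_fun_1_bounds: "0 \<le> flat_fun 1 t" "flat_fun 1 t \<le> 1" "t \<le> 0 \<Longrightarrow> flat_fun 1 t = 0"
  by (auto simp: flat_fun_def)

lemma flat_fun_1_tendsto:
  assumes "0 < t"
  shows "(\<lambda>k. flat_fun 1 (real k * t)) \<longlonglongrightarrow> 1"
proof -
  have "(\<lambda>k. exp (- (1 / t * (1 / real k)))) \<longlonglongrightarrow> exp (- (1 / t * 0))"
    by (intro tendsto_intros lim_1_over_n)
  then have "(\<lambda>k. exp (- (1 / t * (1 / real k)))) \<longlonglongrightarrow> 1" by simp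
  then show ?thesis
  proof (rule Lim_transform_eventually)
    show "\<forall>\<^sub>F k in sequentially. exp (- (1 / t * (1 / real k))) = flat_fun 1 (real k * t)"
      using eventually_gt_at_top[of 0]
      by eventually_elim (use assms in \<open>auto simp: flat_fun_def mult.commute\<close>)
  qed
qed

lemma box_bump_outside: "x \<notin> box a b \<Longrightarrow> box_bump a b k x = 0"
proof -
  assume "x \<notin> box a b"
  then obtain i where "x $ i \<le> a $ i \<or> b $ i \<le> x $ i" by (auto simp: mem_box_cart not_less)
  then have "real k * x $ i + - real k * a $ i \<le> 0 \<or> - real k * x $ i + real k * b $ i \<le> 0"
    by (auto simp: mult_left_mono)
  then have "flat_fun 1 (real k * x $ i + - real k * a $ i) * flat_fun 1 (- real k * x $ i + real k * b $ i) = 0"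
    using flat_fun_1_bounds(3) by auto
  then show ?thesis unfolding box_bump_def by (intro prod_zero bexI[of _ i]) auto
qed

lemma norm_box_bump_le: "norm (box_bump a b k x) \<le> 1"
  unfolding box_bump_def prod_norm[symmetric]
  using flat_fun_1_bounds by (intro prod_le_1) (auto simp: norm_mult intro!: mult_le_one)

lemma box_bump_test_function:
  assumes "cbox a b \<subseteq> \<Omega>"
  shows "box_bump a b k \<in> test_functions \<Omega>"
proof (rule test_functionsI)
  show "Ck m (box_bump a b k)" for m
    unfolding box_bump_def[abs_def] by (intro Ck_prod Ck_mult Ck_flat_fun) auto
  show "box_bump a b k x = 0" if "x \<notin> cbox a b" for x
    using that box_subset_cbox by (intro box_bump_outside) blast
qed (use assms in auto)

lemma box_bump_tendsto: "(\<lambda>k. box_bump a b k x) \<longlonglongrightarrow> indicator (box a b) x"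
proof (cases "x \<in> box a b")
  case True
  have "(\<lambda>k. box_bump a b k x) \<longlonglongrightarrow> (\<Prod>i\<in>(UNIV :: 'a set). complex_of_real 1 * complex_of_real 1)"
    unfolding box_bump_def
  proof (intro tendsto_prod tendsto_mult tendsto_of_real)
    fix i
    have "0 < x $ i - a $ i" "0 < b $ i - x $ i" using True by (auto simp: mem_box_cart)
    from this[THEN flat_fun_1_tendsto]
    show "(\<lambda>k. flat_fun 1 (real k * x $ i + - real k * a $ i)) \<longlonglongrightarrow> 1"
      "(\<lambda>k. flat_fun 1 (- real k * x $ i + real k * b $ i)) \<longlonglongrightarrow> 1"
      by (simp_all add: algebra_simps)
  qed
  then show ?thesis using True by simp
qed (simp add: box_bump_outside)

lemma ae_zero_if_box_integrals_zero:
  fixes F :: "'a::euclidean_space \<Rightarrow> complex"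
  assumes F: "integrable lebesgue F"
    and zero: "\<And>x h. 0 < h \<Longrightarrow> cbox x (x + h *\<^sub>R One) \<subseteq> U \<Longrightarrow> (LINT y:box x (x + h *\<^sub>R One)|lebesgue. F y) = 0"
    and U: "open U"
  shows "AE x in lebesgue. x \<in> U \<longrightarrow> F x = 0"
proof -
  have si: "set_integrable lebesgue S F" if "S \<in> sets lebesgue" for S
    using F that unfolding set_integrable_def by (simp add: integrable_mult_indicator)
  have "F integrable_on cbox a b" for a b
    using si[of "cbox a b"] by (intro set_lebesgue_integral_eq_integral) auto
  then obtain N where N: "negligible N"
    "\<And>x e. x \<notin> N \<Longrightarrow> 0 < e \<Longrightarrow> \<exists>d>0. \<forall>h. 0 < h \<and> h < d \<longrightarrow>
       norm (integral (cbox x (x + h *\<^sub>R One)) F /\<^sub>R h ^ DIM('a) - F x) < e"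
    by (rule integrable_ccontinuous_explicit) blast
  have "F x = 0" if x: "x \<in> U" "x \<notin> N" for x
  proof (rule ccontr)
    assume "F x \<noteq> 0"
    then obtain d where d: "0 < d" "\<And>h. 0 < h \<Longrightarrow> h < d \<Longrightarrow>
       norm (integral (cbox x (x + h *\<^sub>R One)) F /\<^sub>R h ^ DIM('a) - F x) < norm (F x)"
      using N(2)[OF x(2), of "norm (F x)"] by auto
    obtain r where r: "0 < r" "ball x r \<subseteq> U" using U x(1) openE by blast
    define h where "h = min (d / 2) (r / (2 * real DIM('a)))"
    have h: "0 < h" "h < d" using d r by (auto simp: h_def)
    have "cbox x (x + h *\<^sub>R One) \<subseteq> ball x r"
    proof
      fix y assume y: "y \<in> cbox x (x + h *\<^sub>R One)"
      have "norm (y - x) \<le> (\<Sum>b\<in>Basis. \<bar>(y - x) \<bullet> b\<bar>)" by (rule norm_le_l1)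
      also have "\<dots> \<le> (\<Sum>b\<in>(Basis :: 'a set). h)"
        using y by (intro sum_mono) (auto simp: mem_box inner_simps abs_le_iff)
      also have "\<dots> = real DIM('a) * h" by simp
      also have "\<dots> \<le> real DIM('a) * (r / (2 * real DIM('a)))" by (intro mult_left_mono) (auto simp: h_def)
      also have "\<dots> < r" using r by simp
      finally show "y \<in> ball x r" by (simp add: dist_norm norm_minus_commute)
    qed
    then have "(LINT y:box x (x + h *\<^sub>R One)|lebesgue. F y) = 0" using r h by (intro zero) auto
    then have "integral (box x (x + h *\<^sub>R One)) F = 0"
      using set_lebesgue_integral_eq_integral(2)[OF si[of "box x (x + h *\<^sub>R One)"]] by simp
    then have "integral (cbox x (x + h *\<^sub>R One)) F = 0"
      by (simp add: integral_open_interval)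
    then show False using d(2)[OF h] by simp
  qed
  then have "{x. \<not> (x \<in> U \<longrightarrow> F x = 0)} \<subseteq> N" by auto
  moreover have "N \<in> null_sets lebesgue" using N(1) by (simp add: negligible_iff_null_sets)
  ultimately show ?thesis by (intro AE_I'[of N]) auto
qed

theorem fundamental_lemma:
  fixes f :: "real ^ 'n \<Rightarrow> complex"
  assumes \<Omega>: "open \<Omega>" and f: "f \<in> borel_measurable (lebesgue_on \<Omega>)"
    and int: "\<And>a b. cbox a b \<subseteq> \<Omega> \<Longrightarrow> integrable (lebesgue_on \<Omega>) (\<lambda>x. indicator (cbox a b) x *\<^sub>R f x)"
    and zero: "\<And>\<phi>. \<phi> \<in> test_functions \<Omega> \<Longrightarrow> (LINT x|lebesgue_on \<Omega>. f x * \<phi> x) = 0"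
  shows "AE x in lebesgue_on \<Omega>. f x = 0"
proof -
  have \<Omega>s: "\<Omega> \<in> sets lebesgue" using \<Omega> by (simp add: borel_open lebesgue_openin)
  have box0: "(LINT x|lebesgue_on \<Omega>. f x * indicator (box a b) x) = 0" if ab: "cbox a b \<subseteq> \<Omega>" for a b
  proof -
    have tf: "box_bump a b k \<in> test_functions \<Omega>" for k using ab by (rule box_bump_test_function)
    have meas: "box_bump a b k \<in> borel_measurable (lebesgue_on \<Omega>)" for k
      using test_functionsD(2)[OF tf] by (intro measurable_restrict_space1 measurable_completion) (simp add: borel_measurable_continuous_onI)
    have "(\<lambda>k. LINT x|lebesgue_on \<Omega>. f x * box_bump a b k x) \<longlonglongrightarrow> (LINT x|lebesgue_on \<Omega>. f x * indicator (box a b) x)"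
    proof (rule integral_dominated_convergence)
      show "integrable (lebesgue_on \<Omega>) (\<lambda>x. norm (indicator (cbox a b) x *\<^sub>R f x))"
        using int[OF ab] by (rule integrable_norm)
      show "AE x in lebesgue_on \<Omega>. (\<lambda>k. f x * box_bump a b k x) \<longlonglongrightarrow> f x * indicator (box a b) x"
        by (intro AE_I2 tendsto_intros box_bump_tendsto)
      show "AE x in lebesgue_on \<Omega>. norm (f x * box_bump a b k x) \<le> norm (indicator (cbox a b) x *\<^sub>R f x)" for k
      proof (intro AE_I2)
        fix x
        show "norm (f x * box_bump a b k x) \<le> norm (indicator (cbox a b) x *\<^sub>R f x)"
        proof (cases "x \<in> box a b")
          case True
          then have "x \<in> cbox a b" using box_subset_cbox by blast
          then show ?thesis using norm_box_bump_le[of a b k x] by (simp add: norm_mult mult_left_le)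
        qed (simp add: box_bump_outside)
      qed
      have "indicator (box a b) \<in> borel_measurable (lebesgue_on \<Omega>)"
        by (intro measurable_restrict_space1 borel_measurable_indicator) auto
      then show "(\<lambda>x. f x * indicator (box a b) x) \<in> borel_measurable (lebesgue_on \<Omega>)"
        using f by (rule borel_measurable_times[rotated])
    qed (use f meas in \<open>auto intro: borel_measurable_times\<close>)
    then show ?thesis using zero[OF tf] by (simp add: LIMSEQ_const_iff)
  qed
  have on_box: "AE x in lebesgue. x \<in> box a b \<longrightarrow> f x = 0" if ab: "cbox a b \<subseteq> \<Omega>" for a b
  proof -
    define F where "F x = indicator (cbox a b) x *\<^sub>R f x" for x
    have F: "integrable lebesgue F"
    proof -
      have "integrable lebesgue (\<lambda>x. indicator \<Omega> x *\<^sub>R F x)"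
        using int[OF ab] \<Omega>s by (simp add: integrable_restrict_space F_def)
      moreover have "(\<lambda>x. indicator \<Omega> x *\<^sub>R F x) = F" using ab by (intro ext) (auto simp: F_def indicator_def)
      ultimately show ?thesis by simp
    qed
    have "AE x in lebesgue. x \<in> box a b \<longrightarrow> F x = 0"
    proof (rule ae_zero_if_box_integrals_zero[OF F])
      fix x and h :: real assume "0 < h" and sub: "cbox x (x + h *\<^sub>R One) \<subseteq> box a b"
      let ?Q = "box x (x + h *\<^sub>R One)"
      have Q: "?Q \<subseteq> cbox a b" "cbox x (x + h *\<^sub>R One) \<subseteq> \<Omega>"
        using sub ab box_subset_cbox by blast+
      have "(LINT y:?Q|lebesgue. F y) = (LINT y|lebesgue. indicator \<Omega> y *\<^sub>R (f y * indicator ?Q y))"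
        unfolding set_lebesgue_integral_def
        using Q ab by (intro Bochner_Integration.integral_cong) (auto simp: F_def indicator_def)
      also have "\<dots> = (LINT y|lebesgue_on \<Omega>. f y * indicator ?Q y)"
        using \<Omega>s by (intro integral_restrict_space[symmetric]) simp
      also have "\<dots> = 0" using Q(2) by (rule box0)
      finally show "(LINT y:?Q|lebesgue. F y) = 0" .
    qed (rule open_box)
    then show ?thesis
      by (rule eventually_mono) (use box_subset_cbox[of a b] in \<open>auto simp: F_def indicator_def split: if_splits\<close>)
  qed
  obtain \<D> where \<D>: "countable \<D>" "\<D> \<subseteq> Pow \<Omega>" "\<And>X. X \<in> \<D> \<Longrightarrow> \<exists>a b. X = cbox a b" "\<Union>\<D> = \<Omega>"
    using open_countable_Union_open_cbox[OF \<Omega>] by blast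
  have "AE x in lebesgue. \<forall>X\<in>\<D>. x \<in> X \<longrightarrow> f x = 0"
  proof (subst AE_ball_countable[OF \<D>(1)], intro ballI)
    fix X assume X: "X \<in> \<D>"
    then obtain a b where ab: "X = cbox a b" using \<D>(3) by blast
    have "cbox a b - box a b \<in> null_sets lebesgue"
      using negligible_frontier_interval[of a b] by (simp add: negligible_iff_null_sets)
    then have "AE x in lebesgue. x \<notin> cbox a b - box a b" by (rule AE_not_in)
    moreover have "AE x in lebesgue. x \<in> box a b \<longrightarrow> f x = 0" using X ab \<D>(2) by (intro on_box) auto
    ultimately show "AE x in lebesgue. x \<in> X \<longrightarrow> f x = 0" by eventually_elim (use ab in auto)
  qed
  then have "AE x in lebesgue. x \<in> \<Omega> \<longrightarrow> f x = 0" by (rule eventually_mono) (use \<D>(4) in auto)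
  then show ?thesis using \<Omega>s by (simp add: AE_restrict_space_iff)
qed

section \<open>Sesquilinear forms on semi-Hilbert spaces of functions\<close>

locale function_space =
  fixes V :: "('x \<Rightarrow> complex) set"
  assumes zero_mem: "(\<lambda>x. 0) \<in> V"
    and lin_mem: "u \<in> V \<Longrightarrow> v \<in> V \<Longrightarrow> (\<lambda>x. \<alpha> * u x + \<beta> * v x) \<in> V"
begin

lemma diff_mem: "u \<in> V \<Longrightarrow> v \<in> V \<Longrightarrow> (\<lambda>x. u x - v x) \<in> V"
  using lin_mem[of u v 1 "-1"] by simp

lemma add_mem: "u \<in> V \<Longrightarrow> v \<in> V \<Longrightarrow> (\<lambda>x. u x + v x) \<in> V"
  using lin_mem[of u v 1 1] by simp

lemma scale_mem: "u \<in> V \<Longrightarrow> (\<lambda>x. \<alpha> * u x) \<in> V"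
  using lin_mem[of u u \<alpha> 0] by simp

end

definition sesquilinear_on ::
    "('x \<Rightarrow> complex) set \<Rightarrow> (('x \<Rightarrow> complex) \<Rightarrow> ('x \<Rightarrow> complex) \<Rightarrow> complex) \<Rightarrow> bool" where
  "sesquilinear_on V a \<longleftrightarrow> (\<forall>u\<in>V. \<forall>v\<in>V. \<forall>w\<in>V. \<forall>\<alpha> \<beta>.
     a (\<lambda>x. \<alpha> * u x + \<beta> * v x) w = \<alpha> * a u w + \<beta> * a v w \<and>
     a w (\<lambda>x. \<alpha> * u x + \<beta> * v x) = cnj \<alpha> * a w u + cnj \<beta> * a w v)"

definition antilinear_on :: "('x \<Rightarrow> complex) set \<Rightarrow> (('x \<Rightarrow> complex) \<Rightarrow> complex) \<Rightarrow> bool" where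
  "antilinear_on V F \<longleftrightarrow> (\<forall>u\<in>V. \<forall>v\<in>V. \<forall>\<alpha> \<beta>. F (\<lambda>x. \<alpha> * u x + \<beta> * v x) = cnj \<alpha> * F u + cnj \<beta> * F v)"

lemma sesquilinear_onD:
  assumes "sesquilinear_on V a" "u \<in> V" "v \<in> V" "w \<in> V"
  shows "a (\<lambda>x. \<alpha> * u x + \<beta> * v x) w = \<alpha> * a u w + \<beta> * a v w"
    and "a w (\<lambda>x. \<alpha> * u x + \<beta> * v x) = cnj \<alpha> * a w u + cnj \<beta> * a w v"
  using assms unfolding sesquilinear_on_def by blast+

lemma sesquilinear_on_diff:
  assumes "sesquilinear_on V a" "u \<in> V" "v \<in> V" "w \<in> V"
  shows "a (\<lambda>x. u x - v x) w = a u w - a v w"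
    and "a w (\<lambda>x. u x - v x) = a w u - a w v"
  using sesquilinear_onD[OF assms, of 1 "-1"] by simp_all

lemma antilinear_onD:
  assumes "antilinear_on V F" "u \<in> V" "v \<in> V"
  shows "F (\<lambda>x. \<alpha> * u x + \<beta> * v x) = cnj \<alpha> * F u + cnj \<beta> * F v"
  using assms unfolding antilinear_on_def by blast

lemma sesquilinear_on_antilinear: "sesquilinear_on V a \<Longrightarrow> u \<in> V \<Longrightarrow> antilinear_on V (a u)"
  unfolding sesquilinear_on_def antilinear_on_def by blast

lemma sesquilinear_on_subset: "sesquilinear_on V a \<Longrightarrow> U \<subseteq> V \<Longrightarrow> sesquilinear_on U a"
  unfolding sesquilinear_on_def by blast

lemma le_zero_if_le_small_multiples:
  fixes a b :: real
  assumes "\<And>t. 0 < t \<Longrightarrow> a \<le> t * b"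
  shows "a \<le> 0"
proof (rule field_le_epsilon)
  fix \<epsilon> :: real assume "0 < \<epsilon>"
  then have "0 < \<epsilon> / (\<bar>b\<bar> + 1)" by simp
  from assms[OF this] have "a \<le> \<epsilon> * (b / (\<bar>b\<bar> + 1))" by simp
  also have "\<dots> \<le> \<epsilon> * 1" using \<open>0 < \<epsilon>\<close> by (intro mult_left_mono) (auto simp: divide_simps)
  finally show "a \<le> 0 + \<epsilon>" by simp
qed

locale semi_inner_space = function_space V for V :: "('x \<Rightarrow> complex) set" +
  fixes ip :: "('x \<Rightarrow> complex) \<Rightarrow> ('x \<Rightarrow> complex) \<Rightarrow> complex"
  assumes ip_lin: "u \<in> V \<Longrightarrow> v \<in> V \<Longrightarrow> w \<in> V \<Longrightarrow> ip (\<lambda>x. \<alpha> * u x + \<beta> * v x) w = \<alpha> * ip u w + \<beta> * ip v w"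
    and ip_cnj: "u \<in> V \<Longrightarrow> v \<in> V \<Longrightarrow> ip v u = cnj (ip u v)"
    and ip_ge: "v \<in> V \<Longrightarrow> 0 \<le> Re (ip v v)"
begin

definition nrm :: "('x \<Rightarrow> complex) \<Rightarrow> real" where
  "nrm v = sqrt (Re (ip v v))"

lemma ip_sesquilinear: "sesquilinear_on V ip"
  unfolding sesquilinear_on_def
proof (intro ballI allI conjI)
  fix u v w \<alpha> \<beta> assume *: "u \<in> V" "v \<in> V" "w \<in> V"
  then show "ip (\<lambda>x. \<alpha> * u x + \<beta> * v x) w = \<alpha> * ip u w + \<beta> * ip v w" by (rule ip_lin)
  with * show "ip w (\<lambda>x. \<alpha> * u x + \<beta> * v x) = cnj \<alpha> * ip w u + cnj \<beta> * ip w v"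
    using ip_cnj[of "\<lambda>x. \<alpha> * u x + \<beta> * v x" w] ip_cnj[of u w] ip_cnj[of v w] by (simp add: lin_mem)
qed

lemma nrm_ge: "v \<in> V \<Longrightarrow> 0 \<le> nrm v"
  by (simp add: nrm_def ip_ge)

lemma nrm_sq: "v \<in> V \<Longrightarrow> (nrm v)\<^sup>2 = Re (ip v v)"
  by (simp add: nrm_def ip_ge)

lemma ip_self: "v \<in> V \<Longrightarrow> ip v v = of_real ((nrm v)\<^sup>2)"
  using ip_cnj[of v v] by (simp add: nrm_sq complex_eq_iff)

lemma nrm_sq_lin:
  assumes "u \<in> V" "v \<in> V"
  shows "(nrm (\<lambda>x. u x + c * v x))\<^sup>2 = (nrm u)\<^sup>2 + 2 * Re (cnj c * ip u v) + (norm c)\<^sup>2 * (nrm v)\<^sup>2"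
proof -
  have m: "(\<lambda>x. u x + c * v x) \<in> V" using lin_mem[of u v 1 c] assms by simp
  have "ip (\<lambda>x. u x + c * v x) (\<lambda>x. u x + c * v x)
      = ip u u + cnj c * ip u v + c * ip v u + c * cnj c * ip v v"
    using sesquilinear_onD[OF ip_sesquilinear assms m, of 1 c]
      sesquilinear_onD(2)[OF ip_sesquilinear assms assms(1), of 1 c]
      sesquilinear_onD(2)[OF ip_sesquilinear assms assms(2), of 1 c]
    by (simp add: algebra_simps)
  also have "ip v u = cnj (ip u v)" using assms by (intro ip_cnj)
  also have "c * cnj c = of_real ((norm c)\<^sup>2)" using complex_norm_square[of c] by simp
  finally show ?thesis
    by (subst nrm_sq[OF m]) (simp add: ip_self assms mult.commute)
qed

lemma ip_bound:
  assumes "u \<in> V" "v \<in> V"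
  shows "norm (ip u v) \<le> nrm u * nrm v"
proof -
  define z where "z = ip u v"
  have *: "2 * s * (norm z)\<^sup>2 \<le> (nrm u)\<^sup>2 + s\<^sup>2 * (norm z)\<^sup>2 * (nrm v)\<^sup>2" for s :: real
  proof -
    have "0 \<le> (nrm (\<lambda>x. u x + (- of_real s * z) * v x))\<^sup>2" by simp
    also have "\<dots> = (nrm u)\<^sup>2 + 2 * Re (cnj (- of_real s * z) * z) + (norm (- of_real s * z))\<^sup>2 * (nrm v)\<^sup>2"
      unfolding z_def by (rule nrm_sq_lin[OF assms])
    also have "Re (cnj (- of_real s * z) * z) = - s * (norm z)\<^sup>2"
      unfolding cmod_power2 by (simp add: power2_eq_square algebra_simps)
    finally show ?thesis by (simp add: norm_mult power_mult_distrib)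
  qed
  show ?thesis
  proof (cases "nrm v = 0")
    case True
    have "(norm z)\<^sup>2 \<le> t * ((nrm u)\<^sup>2 / 2)" if "0 < t" for t
      using *[of "1 / t"] that True by (simp add: field_simps)
    then have "(norm z)\<^sup>2 \<le> 0" by (rule le_zero_if_le_small_multiples)
    then show ?thesis using True by (simp add: z_def)
  next
    case False
    with nrm_ge[OF assms(2)] have v: "0 < nrm v" by simp
    have "2 * (1 / (nrm v)\<^sup>2) * (norm z)\<^sup>2 \<le> (nrm u)\<^sup>2 + (1 / (nrm v)\<^sup>2)\<^sup>2 * (norm z)\<^sup>2 * (nrm v)\<^sup>2" by (rule *)
    moreover have "(1 / (nrm v)\<^sup>2)\<^sup>2 * (norm z)\<^sup>2 * (nrm v)\<^sup>2 = (norm z)\<^sup>2 / (nrm v)\<^sup>2"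
      using v by (simp add: power2_eq_square)
    ultimately have "(norm z)\<^sup>2 / (nrm v)\<^sup>2 \<le> (nrm u)\<^sup>2" by simp
    then have "(norm z)\<^sup>2 \<le> (nrm u * nrm v)\<^sup>2" using v by (simp add: divide_le_eq power_mult_distrib)
    then show ?thesis unfolding z_def
      by (rule power2_le_imp_le) (use nrm_ge assms in auto)
  qed
qed

lemma nrm_scale:
  assumes "v \<in> V"
  shows "nrm (\<lambda>x. c * v x) = norm c * nrm v"
proof -
  have "(nrm (\<lambda>x. c * v x))\<^sup>2 = (norm c * nrm v)\<^sup>2"
    using nrm_sq_lin[OF zero_mem assms, of c] sesquilinear_onD(1)[OF ip_sesquilinear zero_mem zero_mem zero_mem, of 0 0]
      sesquilinear_onD(1)[OF ip_sesquilinear zero_mem zero_mem assms, of 0 0]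
    by (simp add: power_mult_distrib nrm_def)
  then show ?thesis using nrm_ge[OF assms] nrm_ge[OF scale_mem[OF assms]] by (simp add: power2_eq_iff_nonneg)
qed

lemma nrm_triangle:
  assumes "u \<in> V" "v \<in> V"
  shows "nrm (\<lambda>x. u x + v x) \<le> nrm u + nrm v"
proof (rule power2_le_imp_le)
  have "(nrm (\<lambda>x. u x + v x))\<^sup>2 = (nrm u)\<^sup>2 + 2 * Re (ip u v) + (nrm v)\<^sup>2"
    using nrm_sq_lin[OF assms, of 1] by simp
  also have "\<dots> \<le> (nrm u + nrm v)\<^sup>2"
    using ip_bound[OF assms] complex_Re_le_cmod[of "ip u v"] by (simp add: power2_sum)
  finally show "(nrm (\<lambda>x. u x + v x))\<^sup>2 \<le> (nrm u + nrm v)\<^sup>2" .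
qed (use nrm_ge assms in auto)

lemma nrm_minus_commute: "u \<in> V \<Longrightarrow> v \<in> V \<Longrightarrow> nrm (\<lambda>x. u x - v x) = nrm (\<lambda>x. v x - u x)"
  using nrm_scale[OF diff_mem, of u v "-1"] by simp

lemma nrm_triangle_diff:
  assumes "u \<in> V" "v \<in> V" "w \<in> V"
  shows "nrm (\<lambda>x. u x - w x) \<le> nrm (\<lambda>x. u x - v x) + nrm (\<lambda>x. v x - w x)"
  using nrm_triangle[OF diff_mem[OF assms(1,2)] diff_mem[OF assms(2,3)]] by simp

lemma nrm_triangle_sub:
  assumes "u \<in> V" "v \<in> V"
  shows "nrm u \<le> nrm v + nrm (\<lambda>x. u x - v x)"
  using nrm_triangle[OF assms(2) diff_mem[OF assms]] by simp

lemma ip_null: "u \<in> V \<Longrightarrow> v \<in> V \<Longrightarrow> nrm v = 0 \<Longrightarrow> ip u v = 0"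
  using ip_bound[of u v] by simp

lemma sesquilinear_bound:
  assumes a: "sesquilinear_on V a" and K: "0 \<le> K"
    and bound: "\<And>u v. u \<in> V \<Longrightarrow> v \<in> V \<Longrightarrow> norm (a u v) \<le> K * ((nrm u)\<^sup>2 + (nrm v)\<^sup>2)"
    and u: "u \<in> V" and v: "v \<in> V"
  shows "norm (a u v) \<le> 2 * K * nrm u * nrm v"
proof -
  have *: "norm (a u v) \<le> K * (s\<^sup>2 * (nrm u)\<^sup>2 + (nrm v)\<^sup>2 / s\<^sup>2)" if s: "0 < s" for s :: real
  proof -
    have "a (\<lambda>x. of_real s * u x) (\<lambda>x. of_real (1 / s) * v x) = a u v"
      using sesquilinear_onD(1)[OF a u u scale_mem[OF v, of "of_real (1/s)"], of "of_real s" 0]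
        sesquilinear_onD(2)[OF a v v u, of "of_real (1/s)" 0] s by simp
    then show ?thesis
      using bound[OF scale_mem[OF u, of "of_real s"] scale_mem[OF v, of "of_real (1 / s)"]] s
        nrm_scale[OF v, of "of_real (1 / s)"]
      by (simp add: nrm_scale u v power_mult_distrib power_divide norm_divide)
  qed
  consider "nrm u = 0" | "nrm v = 0" | "0 < nrm u" "0 < nrm v"
    using nrm_ge[OF u] nrm_ge[OF v] by linarith
  then show ?thesis
  proof cases
    case 1
    have "norm (a u v) \<le> t * (K * (nrm v)\<^sup>2)" if "0 < t" for t
      using *[of "sqrt (1 / t)"] that 1 by (simp add: field_simps)
    then have "norm (a u v) \<le> 0" by (rule le_zero_if_le_small_multiples)
    then show ?thesis using 1 by simp
  next
    case 2
    have "norm (a u v) \<le> t * (K * (nrm u)\<^sup>2)" if "0 < t" for t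
      using *[of "sqrt t"] that 2 by (simp add: field_simps)
    then have "norm (a u v) \<le> 0" by (rule le_zero_if_le_small_multiples)
    then show ?thesis using 2 by simp
  next
    case 3
    have "norm (a u v) \<le> K * ((nrm v / nrm u) * (nrm u)\<^sup>2 + (nrm v)\<^sup>2 / (nrm v / nrm u))"
      using *[of "sqrt (nrm v / nrm u)"] 3 by simp
    also have "\<dots> = 2 * K * nrm u * nrm v" using 3 by (simp add: field_simps power2_eq_square)
    finally show ?thesis .
  qed
qed

end

locale semi_hilbert_space = semi_inner_space +
  assumes complete: "(\<And>k. s k \<in> V) \<Longrightarrow>
    (\<forall>\<epsilon>>0. \<exists>N. \<forall>m\<ge>N. \<forall>n\<ge>N. nrm (\<lambda>x. s m x - s n x) < \<epsilon>) \<Longrightarrow>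
    \<exists>v\<in>V. (\<lambda>k. nrm (\<lambda>x. s k x - v x)) \<longlonglongrightarrow> 0"
begin

theorem riesz_representation:
  assumes F: "antilinear_on V F" and bound: "\<And>v. v \<in> V \<Longrightarrow> norm (F v) \<le> C * nrm v"
  shows "\<exists>u\<in>V. \<forall>v\<in>V. ip u v = F v"
proof -
  define J where "J v = (nrm v)\<^sup>2 - 2 * Re (F v)" for v
  have lower: "- C\<^sup>2 \<le> J v" if "v \<in> V" for v
  proof -
    have "2 * Re (F v) \<le> 2 * C * nrm v"
      using bound[OF that] complex_Re_le_cmod[of "F v"] by simp
    moreover have "0 \<le> (nrm v - C)\<^sup>2" by simp
    ultimately show ?thesis by (simp add: J_def power2_diff algebra_simps)
  qed
  define m where "m = (INF v\<in>V. J v)"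
  have bdd: "bdd_below (J ` V)" using lower by (intro bdd_belowI2)
  have m_le: "m \<le> J v" if "v \<in> V" for v unfolding m_def using bdd that by (rule cINF_lower)
  have "\<exists>v\<in>V. J v < m + \<epsilon>" if "0 < \<epsilon>" for \<epsilon>
    using cINF_less_iff[OF _ bdd, of "m + \<epsilon>"] zero_mem that by (auto simp: m_def)
  then have "\<forall>k. \<exists>v\<in>V. J v < m + 1 / real (Suc k)" by simp
  then obtain s where s: "\<And>k. s k \<in> V" "\<And>k. J (s k) < m + 1 / real (Suc k)" by metis
  have parallelogram: "(nrm (\<lambda>x. u x - v x))\<^sup>2 \<le> 2 * (J u - m) + 2 * (J v - m)" if "u \<in> V" "v \<in> V" for u v
  proof -
    let ?w = "\<lambda>x. 1 / 2 * u x + 1 / 2 * v x"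
    have w: "?w \<in> V" using that by (rule lin_mem)
    have eq: "?w = (\<lambda>x. 1 / 2 * (u x + v x))" by (simp add: add_divide_distrib)
    have "(nrm ?w)\<^sup>2 = 1 / 4 * ((nrm u)\<^sup>2 + 2 * Re (ip u v) + (nrm v)\<^sup>2)"
      unfolding eq nrm_scale[OF add_mem[OF that], of "1 / 2"]
      using nrm_sq_lin[OF that, of 1] by (simp add: power_mult_distrib power_divide)
    moreover have "F ?w = 1 / 2 * F u + 1 / 2 * F v"
      using antilinear_onD[OF F that, of "1/2" "1/2"] by simp
    moreover have "(nrm (\<lambda>x. u x - v x))\<^sup>2 = (nrm u)\<^sup>2 - 2 * Re (ip u v) + (nrm v)\<^sup>2"
      using nrm_sq_lin[OF that, of "-1"] by simp
    moreover have "m \<le> J ?w" using w by (rule m_le)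
    ultimately show ?thesis by (simp add: J_def algebra_simps)
  qed
  have "\<exists>N. \<forall>j\<ge>N. \<forall>k\<ge>N. nrm (\<lambda>x. s j x - s k x) < \<epsilon>" if \<epsilon>: "0 < \<epsilon>" for \<epsilon>
  proof -
    obtain N where N: "4 / \<epsilon>\<^sup>2 < real N" using reals_Archimedean2 by blast
    have "nrm (\<lambda>x. s j x - s k x) < \<epsilon>" if "N \<le> j" "N \<le> k" for j k
    proof (rule power2_less_imp_less)
      have N0: "0 < real N" using N \<epsilon> by (smt (verit) divide_pos_pos zero_less_power)
      have "1 / real (Suc j) \<le> 1 / real N" "1 / real (Suc k) \<le> 1 / real N"
        using that N0 by (auto intro!: divide_left_mono)
      then have "J (s j) < m + 1 / real N" "J (s k) < m + 1 / real N"
        using s(2)[of j] s(2)[of k] by (meson add_left_mono less_le_trans)+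
      then have "(nrm (\<lambda>x. s j x - s k x))\<^sup>2 \<le> 4 * (1 / real N)"
        using parallelogram[OF s(1) s(1), of j k] by argo
      also have "\<dots> < \<epsilon>\<^sup>2" using N N0 \<epsilon> by (simp add: field_simps)
      finally show "(nrm (\<lambda>x. s j x - s k x))\<^sup>2 < \<epsilon>\<^sup>2" .
    qed (use \<epsilon> in auto)
    then show ?thesis by blast
  qed
  then obtain u where u: "u \<in> V" and lim: "(\<lambda>k. nrm (\<lambda>x. s k x - u x)) \<longlonglongrightarrow> 0"
    using complete[of s] s(1) by blast
  have "(\<lambda>k. nrm (s k)) \<longlonglongrightarrow> nrm u"
  proof (rule metric_tendsto_imp_tendsto[OF lim])
    show "\<forall>\<^sub>F k in sequentially. dist (nrm (s k)) (nrm u) \<le> dist (nrm (\<lambda>x. s k x - u x)) 0"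
    proof (intro always_eventually allI)
      fix k
      show "dist (nrm (s k)) (nrm u) \<le> dist (nrm (\<lambda>x. s k x - u x)) 0"
        using nrm_triangle_sub[OF s(1)[of k] u] nrm_triangle_sub[OF u s(1)[of k]] nrm_minus_commute[OF u s(1)[of k]]
          nrm_ge[OF diff_mem[OF s(1)[of k] u]] by (simp add: dist_real_def abs_le_iff)
    qed
  qed
  moreover have "(\<lambda>k. F (s k)) \<longlonglongrightarrow> F u"
  proof (rule metric_tendsto_imp_tendsto)
    show "(\<lambda>k. C * nrm (\<lambda>x. s k x - u x)) \<longlonglongrightarrow> 0" using tendsto_mult_left[OF lim, of C] by simp
    show "\<forall>\<^sub>F k in sequentially. dist (F (s k)) (F u) \<le> dist (C * nrm (\<lambda>x. s k x - u x)) 0"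
    proof (intro always_eventually allI)
      fix k
      have "F (s k) - F u = F (\<lambda>x. s k x - u x)"
        using antilinear_onD[OF F s(1)[of k] u, of 1 "-1"] by simp
      then show "dist (F (s k)) (F u) \<le> dist (C * nrm (\<lambda>x. s k x - u x)) 0"
        using bound[OF diff_mem[OF s(1)[of k] u]] by (simp add: dist_norm)
    qed
  qed
  ultimately have "(\<lambda>k. J (s k)) \<longlonglongrightarrow> J u" unfolding J_def by (intro tendsto_intros)
  moreover have "(\<lambda>k. m + 1 / real (Suc k)) \<longlonglongrightarrow> m + 0"
    using LIMSEQ_inverse_real_of_nat by (intro tendsto_intros) (simp add: inverse_eq_divide)
  ultimately have Ju: "J u \<le> m"
    using s(2) by (intro LIMSEQ_le[of "\<lambda>k. J (s k)" "J u" "\<lambda>k. m + 1 / real (Suc k)"]) (auto intro: less_imp_le)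
  have "ip u v = F v" if v: "v \<in> V" for v
  proof -
    define z where "z = ip u v - F v"
    have "2 * (norm z)\<^sup>2 \<le> t * ((norm z)\<^sup>2 * (nrm v)\<^sup>2)" if t: "0 < t" for t
    proof -
      let ?c = "- of_real t * z"
      have J_lin: "J (\<lambda>x. u x + c * v x) = J u + 2 * Re (cnj c * z) + (norm c)\<^sup>2 * (nrm v)\<^sup>2" for c
      proof -
        have "F (\<lambda>x. u x + c * v x) = F u + cnj c * F v" using antilinear_onD[OF F u v, of 1 c] by simp
        then show ?thesis by (simp add: J_def nrm_sq_lin u v z_def right_diff_distrib)
      qed
      have "(\<lambda>x. u x + ?c * v x) \<in> V" using lin_mem[OF u v, of 1 ?c] by simp
      then have "J u \<le> J (\<lambda>x. u x + ?c * v x)" using m_le Ju by fastforce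
      then have "0 \<le> 2 * Re (cnj ?c * z) + (norm ?c)\<^sup>2 * (nrm v)\<^sup>2"
        unfolding J_lin by linarith
      also have "Re (cnj ?c * z) = - t * (norm z)\<^sup>2"
        unfolding cmod_power2 by (simp add: power2_eq_square algebra_simps)
      finally have "t * (2 * (norm z)\<^sup>2) \<le> t * (t * ((norm z)\<^sup>2 * (nrm v)\<^sup>2))"
        by (simp add: norm_mult power_mult_distrib power2_eq_square algebra_simps)
      then show ?thesis using t by (simp only: mult_le_cancel_left_pos)
    qed
    then have "2 * (norm z)\<^sup>2 \<le> 0" by (rule le_zero_if_le_small_multiples)
    then show ?thesis by (simp add: z_def)
  qed
  then show ?thesis using u by blast
qed

text \<open>The representer of \<open>a u\<close> depends linearly on \<open>u\<close> and has norm equivalent to \<open>nrm u\<close>.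
  Projecting the representer of \<open>F\<close> onto the range of this map is the Riesz representation for
  the pulled back inner product, and coercivity makes the projection exact.\<close>

theorem lax_milgram:
  assumes a: "sesquilinear_on V a"
    and bounded: "\<And>u v. u \<in> V \<Longrightarrow> v \<in> V \<Longrightarrow> norm (a u v) \<le> M * nrm u * nrm v"
    and c: "0 < c" and coercive: "\<And>v. v \<in> V \<Longrightarrow> c * (nrm v)\<^sup>2 \<le> norm (a v v)"
    and F: "antilinear_on V F" and bound: "\<And>v. v \<in> V \<Longrightarrow> norm (F v) \<le> C * nrm v"
  shows "\<exists>u\<in>V. \<forall>v\<in>V. a u v = F v"
proof -
  obtain f where f: "f \<in> V" "\<And>v. v \<in> V \<Longrightarrow> ip f v = F v"
    using riesz_representation[OF F bound] by blast
  have "\<exists>t\<in>V. \<forall>v\<in>V. ip t v = a u v" if "u \<in> V" for u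
    using riesz_representation[OF sesquilinear_on_antilinear[OF a that] bounded[OF that]] .
  then obtain T where T: "\<And>u. u \<in> V \<Longrightarrow> T u \<in> V" "\<And>u v. u \<in> V \<Longrightarrow> v \<in> V \<Longrightarrow> ip (T u) v = a u v"
    by metis
  have T_le: "nrm (T u) \<le> M * nrm u" if u: "u \<in> V" for u
  proof -
    have "(nrm (T u))\<^sup>2 = norm (a u (T u))"
      using T u by (simp add: ip_self[OF T(1)[OF u]] norm_power flip: T(2)[OF u T(1)[OF u]])
    also have "\<dots> \<le> (M * nrm u) * nrm (T u)" using bounded[OF u T(1)[OF u]] .
    finally have *: "nrm (T u) * nrm (T u) \<le> (M * nrm u) * nrm (T u)" by (simp add: power2_eq_square)
    show ?thesis
    proof (cases "nrm (T u) = 0")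
      case True
      have "0 \<le> M * nrm u"
      proof (cases "nrm u = 0")
        case False
        then have "0 < nrm u" using nrm_ge[OF u] by simp
        moreover have "0 \<le> M * nrm u * nrm u" using bounded[OF u u] norm_ge_zero order_trans by blast
        ultimately show ?thesis by (simp add: zero_le_mult_iff)
      qed simp
      then show ?thesis using True by simp
    next
      case False
      then have "0 < nrm (T u)" using nrm_ge[OF T(1)[OF u]] by simp
      then show ?thesis using * by (simp only: mult_le_cancel_right_pos)
    qed
  qed
  have T_ge: "c * nrm u \<le> nrm (T u)" if u: "u \<in> V" for u
  proof (cases "nrm u = 0")
    case False
    then have pos: "0 < nrm u" using nrm_ge[OF u] by simp
    have "(c * nrm u) * nrm u \<le> norm (ip (T u) u)" using coercive[OF u] T u by (simp add: power2_eq_square)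
    also have "\<dots> \<le> nrm (T u) * nrm u" using T u by (intro ip_bound)
    finally show ?thesis using pos by (simp only: mult_le_cancel_right_pos)
  qed (use nrm_ge T u in simp)
  have T_lin: "ip (T (\<lambda>x. \<alpha> * u x + \<beta> * v x)) w = \<alpha> * ip (T u) w + \<beta> * ip (T v) w"
    if "u \<in> V" "v \<in> V" "w \<in> V" for u v w \<alpha> \<beta>
    using that by (simp add: T lin_mem sesquilinear_onD[OF a])
  interpret Q: semi_hilbert_space V "\<lambda>u v. ip (T u) (T v)"
    rewrites "\<And>v. semi_inner_space.nrm (\<lambda>u v. ip (T u) (T v)) v = nrm (T v)"
  proof -
    have *: "semi_inner_space V (\<lambda>u v. ip (T u) (T v))"
      by unfold_locales (blast intro: T_lin T(1) ip_cnj ip_ge)+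
    then interpret Q: semi_inner_space V "\<lambda>u v. ip (T u) (T v)" .
    have nrmQ: "Q.nrm v = nrm (T v)" for v by (simp add: Q.nrm_def nrm_def)
    then show "\<And>v. Q.nrm v = nrm (T v)" .
    show "semi_hilbert_space V (\<lambda>u v. ip (T u) (T v))"
    proof
      fix s :: "nat \<Rightarrow> 'a \<Rightarrow> complex"
      assume s: "\<And>k. s k \<in> V" and cauchy: "\<forall>\<epsilon>>0. \<exists>N. \<forall>m\<ge>N. \<forall>n\<ge>N. Q.nrm (\<lambda>x. s m x - s n x) < \<epsilon>"
      have "\<exists>N. \<forall>m\<ge>N. \<forall>n\<ge>N. nrm (\<lambda>x. s m x - s n x) < \<epsilon>" if "0 < \<epsilon>" for \<epsilon>
      proof -
        obtain N where N: "\<And>m n. N \<le> m \<Longrightarrow> N \<le> n \<Longrightarrow> nrm (T (\<lambda>x. s m x - s n x)) < c * \<epsilon>"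
          using cauchy c \<open>0 < \<epsilon>\<close> by (metis mult_pos_pos nrmQ)
        have "nrm (\<lambda>x. s m x - s n x) < \<epsilon>" if "N \<le> m" "N \<le> n" for m n
        proof -
          have "c * nrm (\<lambda>x. s m x - s n x) < c * \<epsilon>"
            using N[OF that] T_ge[OF diff_mem[OF s s], of m n] by linarith
          then show ?thesis using c by simp
        qed
        then show ?thesis by blast
      qed
      then obtain v where v: "v \<in> V" "(\<lambda>k. nrm (\<lambda>x. s k x - v x)) \<longlonglongrightarrow> 0"
        using complete[of s] s by blast
      have "(\<lambda>k. nrm (T (\<lambda>x. s k x - v x))) \<longlonglongrightarrow> 0"
      proof (rule tendsto_sandwich[OF _ _ tendsto_const])
        show "(\<lambda>k. M * nrm (\<lambda>x. s k x - v x)) \<longlonglongrightarrow> 0" using tendsto_mult_left[OF v(2), of M] by simp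
      qed (use T_le nrm_ge T s v(1) diff_mem in \<open>auto intro!: always_eventually\<close>)
      then show "\<exists>v\<in>V. (\<lambda>k. Q.nrm (\<lambda>x. s k x - v x)) \<longlonglongrightarrow> 0" using v(1) nrmQ by auto
    qed
  qed
  have "antilinear_on V (\<lambda>v. ip f (T v))"
    unfolding antilinear_on_def
  proof (intro ballI allI)
    fix u v \<alpha> \<beta> assume uv: "u \<in> V" "v \<in> V"
    have sw: "ip f w = cnj (ip w f)" if "w \<in> V" for w using that f by (intro ip_cnj)
    show "ip f (T (\<lambda>x. \<alpha> * u x + \<beta> * v x)) = cnj \<alpha> * ip f (T u) + cnj \<beta> * ip f (T v)"
      using uv by (simp add: sw T lin_mem sesquilinear_onD[OF a] f(1))
  qed
  moreover have "norm (ip f (T v)) \<le> nrm f * nrm (T v)" if "v \<in> V" for v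
    using that f T by (intro ip_bound) auto
  ultimately obtain u where u: "u \<in> V" "\<And>v. v \<in> V \<Longrightarrow> ip (T u) (T v) = ip f (T v)"
    using Q.riesz_representation by blast
  define w where "w = (\<lambda>x. T u x - f x)"
  have w: "w \<in> V" unfolding w_def using T u f by (intro diff_mem)
  have "ip w (T w) = 0"
    unfolding w_def using sesquilinear_on_diff(1)[OF ip_sesquilinear T(1)[OF u(1)] f(1) T(1)[OF w]] u(2)[OF w]
    by (simp add: w_def)
  then have "a w w = 0" using T[OF w] ip_cnj[OF w T(1)[OF w]] w by simp
  then have nw: "nrm w = 0" using coercive[OF w] c by (simp add: mult_le_0_iff not_le)
  have "a u v = F v" if v: "v \<in> V" for v
  proof -
    have "ip w v = 0" using ip_null[OF v w nw] ip_cnj[OF v w] by simp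
    then show ?thesis
      using sesquilinear_on_diff(1)[OF ip_sesquilinear T(1)[OF u(1)] f(1) v] T(2)[OF u(1) v] f(2)[OF v]
      by (simp add: w_def)
  qed
  then show ?thesis using u by blast
qed

end

definition fun_span :: "('y \<Rightarrow> complex) set \<Rightarrow> ('y \<Rightarrow> complex) set" where
  "fun_span F = {\<lambda>y. \<Sum>f\<in>F. a f * f y | a. True}"

lemma fun_spanI: "u = (\<lambda>y. \<Sum>f\<in>F. a f * f y) \<Longrightarrow> u \<in> fun_span F"
  unfolding fun_span_def by (rule CollectI, rule exI[of _ a]) simp

lemma fun_span_space: "function_space (fun_span F)"
proof
  show "(\<lambda>x. 0) \<in> fun_span F" unfolding fun_span_def by (auto intro!: exI[of _ "\<lambda>_. 0"])
  fix u v \<alpha> \<beta> assume "u \<in> fun_span F" "v \<in> fun_span F"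
  then obtain a b where "u = (\<lambda>y. \<Sum>f\<in>F. a f * f y)" "v = (\<lambda>y. \<Sum>f\<in>F. b f * f y)"
    unfolding fun_span_def by blast
  moreover have "\<alpha> * (\<Sum>f\<in>F. a f * f y) + \<beta> * (\<Sum>f\<in>F. b f * f y) = (\<Sum>f\<in>F. (\<alpha> * a f + \<beta> * b f) * f y)" for y
    by (simp only: sum_distrib_left sum.distrib distrib_right mult.assoc)
  ultimately have "(\<lambda>x. \<alpha> * u x + \<beta> * v x) = (\<lambda>y. \<Sum>f\<in>F. (\<alpha> * a f + \<beta> * b f) * f y)"
    by simp
  then show "(\<lambda>x. \<alpha> * u x + \<beta> * v x) \<in> fun_span F" by (rule fun_spanI)
qed

lemma fun_span_insert:
  assumes "finite F" "f \<notin> F"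
  shows "u \<in> fun_span (insert f F) \<longleftrightarrow> (\<exists>v\<in>fun_span F. \<exists>c. u = (\<lambda>y. v y + c * f y))"
proof
  assume "u \<in> fun_span (insert f F)"
  then obtain a where "u = (\<lambda>y. \<Sum>h\<in>insert f F. a h * h y)" by (auto simp: fun_span_def)
  then have "u = (\<lambda>y. (\<Sum>h\<in>F. a h * h y) + a f * f y)" using assms by (simp add: add.commute)
  then show "\<exists>v\<in>fun_span F. \<exists>c. u = (\<lambda>y. v y + c * f y)"
    by (intro bexI[OF _ fun_spanI[where F = F and a = a, OF refl]] exI[of _ "a f"]) simp
next
  assume "\<exists>v\<in>fun_span F. \<exists>c. u = (\<lambda>y. v y + c * f y)"
  then obtain a c where u: "u = (\<lambda>y. (\<Sum>h\<in>F. a h * h y) + c * f y)" by (auto simp: fun_span_def)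
  have "(\<Sum>h\<in>insert f F. (a(f := c)) h * h y) = (\<Sum>h\<in>F. a h * h y) + c * f y" for y
    using assms by (simp add: add.commute) (intro sum.cong, auto)
  then have "u = (\<lambda>y. \<Sum>h\<in>insert f F. (a(f := c)) h * h y)" using u by simp
  then show "u \<in> fun_span (insert f F)" by (rule fun_spanI)
qed

lemma (in function_space) fun_span_subset:
  assumes "finite F" "F \<subseteq> V"
  shows "fun_span F \<subseteq> V"
  using assms
proof (induction F)
  case empty
  then show ?case using zero_mem by (auto simp: fun_span_def)
next
  case (insert f F)
  show ?case
  proof
    fix u assume "u \<in> fun_span (insert f F)"
    then obtain v c where "v \<in> fun_span F" "u = (\<lambda>y. v y + c * f y)"
      using fun_span_insert[OF insert.hyps] by blast
    then show "u \<in> V" using lin_mem[of v f 1 c] insert by auto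
  qed
qed

lemma (in function_space) finite_dim_solve:
  assumes F: "finite F" "F \<subseteq> V" and a: "sesquilinear_on V a"
    and \<phi>: "antilinear_on V \<phi>"
    and null: "\<And>v. v \<in> V \<Longrightarrow> a v v = 0 \<Longrightarrow> \<phi> v = 0 \<and> (\<forall>u\<in>V. a u v = 0)"
  shows "\<exists>u\<in>fun_span F. \<forall>v\<in>fun_span F. a u v = \<phi> v"
  using F \<phi> null
proof (induction F arbitrary: \<phi>)
  case empty
  have "\<phi> (\<lambda>x. 0) = 0" "a (\<lambda>x. 0) (\<lambda>x. 0) = 0"
    using antilinear_onD[OF empty.prems(2) zero_mem zero_mem, of 0 0] sesquilinear_onD(1)[OF a zero_mem zero_mem zero_mem, of 0 0]
    by simp_all
  then show ?case by (simp add: fun_span_def)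
next
  case (insert f F)
  have f: "f \<in> V" and sub: "fun_span F \<subseteq> V" using insert.prems(1) fun_span_subset[OF insert.hyps(1)] by auto
  interpret S: function_space "fun_span F" by (rule fun_span_space)
  obtain q where q: "q \<in> fun_span F" "\<And>v. v \<in> fun_span F \<Longrightarrow> a q v = a f v"
    using insert.IH[OF _ sesquilinear_on_antilinear[OF a f]] insert.prems f by blast
  obtain u0 where u0: "u0 \<in> fun_span F" "\<And>v. v \<in> fun_span F \<Longrightarrow> a u0 v = \<phi> v"
    using insert.IH[OF _ insert.prems(2)] insert.prems by blast
  have qV: "q \<in> V" and u0V: "u0 \<in> V" using q u0 sub by auto
  define p where "p = (\<lambda>y. f y - q y)"
  have p: "p \<in> V" unfolding p_def using f qV by (rule diff_mem)
  have ap: "a p v = 0" if "v \<in> fun_span F" for v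
    unfolding p_def using sesquilinear_on_diff(1)[OF a f qV, of v] q(2)[OF that] that sub by auto
  have app: "a p p = a p f"
    using sesquilinear_on_diff(2)[OF a f qV p] ap[OF q(1)] by (simp add: p_def)
  have pq: "(\<lambda>y. q y + p y) = f" by (simp add: p_def)
  define c where "c = (\<phi> f - a u0 f) / a p f"
  have solve: "a u0 f + c * a p f = \<phi> f"
  proof (cases "a p f = 0")
    case True
    then have n: "\<phi> p = 0" "a u0 p = 0" using insert.prems(3)[OF p] app u0V by auto
    have "\<phi> f = \<phi> q" using antilinear_onD[OF insert.prems(2) qV p, of 1 1] n by (simp add: pq)
    moreover have "a u0 f = a u0 q" using sesquilinear_onD(2)[OF a qV p u0V, of 1 1] n by (simp add: pq)
    ultimately show ?thesis using True u0(2)[OF q(1)] by simp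
  qed (simp add: c_def)
  define u where "u = (\<lambda>y. (u0 y - c * q y) + c * f y)"
  have u_eq: "u = (\<lambda>y. 1 * u0 y + c * p y)" by (auto simp: u_def p_def algebra_simps)
  have "(\<lambda>y. u0 y - c * q y) \<in> fun_span F" using S.lin_mem[OF u0(1) q(1), of 1 "- c"] by simp
  then have "u \<in> fun_span (insert f F)"
    unfolding u_def fun_span_insert[OF insert.hyps(1,2)] by (rule bexI[rotated]) auto
  moreover have "a u v = \<phi> v" if v: "v \<in> fun_span (insert f F)" for v
  proof -
    obtain w d where w: "w \<in> fun_span F" and v: "v = (\<lambda>y. 1 * w y + d * f y)"
      using fun_span_insert[OF insert.hyps(1,2)] v by auto
    have wV: "w \<in> V" using w sub by auto
    have uV: "u \<in> V" unfolding u_eq using u0V p by (rule lin_mem)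
    have uw: "a u g = a u0 g + c * a p g" if "g \<in> V" for g
      unfolding u_eq using sesquilinear_onD(1)[OF a u0V p that, of 1 c] by simp
    have "a u v = a u w + cnj d * a u f" unfolding v using sesquilinear_onD(2)[OF a wV f uV, of 1 d] by simp
    also have "\<dots> = \<phi> w + cnj d * \<phi> f" using uw[OF wV] uw[OF f] solve ap[OF w] u0(2)[OF w] by simp
    also have "\<dots> = \<phi> v" unfolding v using antilinear_onD[OF insert.prems(2) wV f, of 1 d] by simp
    finally show ?thesis .
  qed
  ultimately show ?case by blast
qed

section \<open>Square integrable functions\<close>

lemma convergent_if_sum_sq_finite:
  fixes g :: "nat \<Rightarrow> 'b::banach"
  assumes fin: "(\<Sum>k. ennreal (2 ^ k * (norm (g (Suc k + m) - g (k + m)))\<^sup>2)) < \<infinity>"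
  shows "convergent g"
proof -
  define d where "d k = norm (g (Suc k + m) - g (k + m))" for k
  have "summable (\<lambda>k. 2 ^ k * (d k)\<^sup>2)"
    using fin by (intro summable_suminf_not_top) (auto simp: d_def less_top[symmetric])
  then have "Bseq (\<lambda>k. 2 ^ k * (d k)\<^sup>2)"
    by (intro convergent_imp_Bseq convergentI[of _ 0] summable_LIMSEQ_zero)
  then obtain B where B: "0 < B" "\<And>k. norm (2 ^ k * (d k)\<^sup>2) \<le> B" by (auto elim: BseqE)
  have d_le: "d k \<le> sqrt B * (1 / sqrt 2) ^ k" for k
  proof (rule power2_le_imp_le)
    have "(d k)\<^sup>2 \<le> B / 2 ^ k" using B(2)[of k] by (simp add: field_simps)
    also have "\<dots> = (sqrt B * (1 / sqrt 2) ^ k)\<^sup>2"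
    proof -
      have "(sqrt 2 ^ k)\<^sup>2 = ((sqrt 2)\<^sup>2) ^ k" by (simp only: power_mult[symmetric] mult.commute)
      then show ?thesis using B(1) by (simp add: power_mult_distrib power_divide)
    qed
    finally show "(d k)\<^sup>2 \<le> (sqrt B * (1 / sqrt 2) ^ k)\<^sup>2" .
  qed (use B in auto)
  have "summable (\<lambda>k. sqrt B * (1 / sqrt 2) ^ k)"
    by (intro summable_mult summable_geometric) auto
  then have "summable (\<lambda>k. g (Suc k + m) - g (k + m))"
    by (rule summable_comparison_test') (use d_le in \<open>simp add: d_def\<close>)
  then have "summable (\<lambda>k. g (Suc k) - g k)"
    using summable_iff_shift[of "\<lambda>k. g (Suc k) - g k" m] by simp
  then have "convergent (\<lambda>n. \<Sum>k<n. g (Suc k) - g k)" by (simp add: summable_iff_convergent)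
  then have "convergent (\<lambda>n. g n - g 0)" by (simp add: sum_lessThan_telescope)
  then have "convergent (\<lambda>n. (g n - g 0) + g 0)" by (intro convergent_add convergent_const)
  then show ?thesis by simp
qed

theorem riesz_fischer_local:
  fixes f :: "nat \<Rightarrow> 'a \<Rightarrow> 'b::{banach, second_countable_topology}"
  assumes f [measurable]: "\<And>k. f k \<in> borel_measurable M"
    and A [measurable]: "\<And>R. A R \<in> sets M" and incA: "incseq A"
    and cauchy: "\<And>R \<epsilon>. 0 < \<epsilon> \<Longrightarrow> \<exists>N. \<forall>m\<ge>N. \<forall>n\<ge>N. (\<integral>\<^sup>+x\<in>A R. ennreal ((norm (f m x - f n x))\<^sup>2) \<partial>M) \<le> ennreal \<epsilon>"
  shows "\<exists>t\<in>borel_measurable M. \<forall>R. (\<lambda>k. \<integral>\<^sup>+x\<in>A R. ennreal ((norm (f k x - t x))\<^sup>2) \<partial>M) \<longlonglongrightarrow> 0"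
proof -
  have "\<exists>N. \<forall>k. \<forall>m\<ge>N k. \<forall>n\<ge>N k. (\<integral>\<^sup>+x\<in>A k. ennreal ((norm (f m x - f n x))\<^sup>2) \<partial>M) \<le> ennreal ((1 / 4) ^ k)"
    by (rule choice) (auto intro!: cauchy)
  then obtain N where N: "\<And>k m n. N k \<le> m \<Longrightarrow> N k \<le> n \<Longrightarrow>
      (\<integral>\<^sup>+x\<in>A k. ennreal ((norm (f m x - f n x))\<^sup>2) \<partial>M) \<le> ennreal ((1 / 4) ^ k)" by auto
  define r where "r k = (\<Sum>i\<le>k. N i) + k" for k
  have r_ge: "N k \<le> r k" "N k \<le> r (Suc k)" "k \<le> r k" for k
    using member_le_sum[of k "{..k}" N] by (auto simp: r_def)
  define g where "g k = f (r k)" for k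
  have [measurable]: "g k \<in> borel_measurable M" for k by (simp add: g_def)
  define t where "t x = lim (\<lambda>k. g k x)" for x
  have t [measurable]: "t \<in> borel_measurable M" unfolding t_def[abs_def] by measurable
  have conv: "AE x in M. x \<in> A R \<longrightarrow> (\<lambda>k. g k x) \<longlonglongrightarrow> t x" for R
  proof -
    let ?s = "\<lambda>k x. ennreal (2 ^ k * (norm (g (Suc k + R) x - g (k + R) x))\<^sup>2) * indicator (A R) x"
    have "(\<integral>\<^sup>+x. (\<Sum>k. ?s k x) \<partial>M) = (\<Sum>k. \<integral>\<^sup>+x. ?s k x \<partial>M)"
      by (intro nn_integral_suminf) measurable
    also have "\<dots> \<le> (\<Sum>k. ennreal ((1 / 2) ^ k))"
    proof (intro suminf_le)
      fix k
      have "(\<integral>\<^sup>+x. ?s k x \<partial>M) = (\<integral>\<^sup>+x. ennreal (2 ^ k) * (ennreal ((norm (g (Suc k + R) x - g (k + R) x))\<^sup>2) * indicator (A R) x) \<partial>M)"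
        by (intro nn_integral_cong) (auto simp: ennreal_mult' mult.assoc)
      also have "\<dots> = ennreal (2 ^ k) * (\<integral>\<^sup>+x\<in>A R. ennreal ((norm (g (Suc k + R) x - g (k + R) x))\<^sup>2) \<partial>M)"
        by (intro nn_integral_cmult) measurable
      also have "\<dots> \<le> ennreal (2 ^ k) * (\<integral>\<^sup>+x\<in>A (k + R). ennreal ((norm (g (Suc k + R) x - g (k + R) x))\<^sup>2) \<partial>M)"
        using monoD[OF incA, of R "k + R"]
        by (intro mult_left_mono nn_integral_mono) (auto simp: indicator_def)
      also have "\<dots> \<le> ennreal (2 ^ k) * ennreal ((1 / 4) ^ (k + R))"
        unfolding g_def add_Suc by (intro mult_left_mono N r_ge) simp
      also have "\<dots> = ennreal (2 ^ k * (1 / 4) ^ (k + R))" by (simp add: ennreal_mult')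
      also have "\<dots> \<le> ennreal ((1 / 2) ^ k)"
      proof (rule ennreal_leI)
        have "2 ^ k * (1 / 4 :: real) ^ (k + R) = (2 * (1 / 4)) ^ k * (1 / 4) ^ R"
          by (simp only: power_add power_mult_distrib mult.assoc)
        also have "\<dots> \<le> (1 / 2) ^ k * 1" by (intro mult_mono power_le_one) auto
        finally show "2 ^ k * (1 / 4 :: real) ^ (k + R) \<le> (1 / 2) ^ k" by simp
      qed
      finally show "(\<integral>\<^sup>+x. ?s k x \<partial>M) \<le> ennreal ((1 / 2) ^ k)" .
    qed auto
    also have "\<dots> = ennreal (\<Sum>k. (1 / 2) ^ k)"
      by (rule suminf_ennreal2) (auto intro: summable_geometric)
    also have "\<dots> < \<infinity>" by simp
    finally have "(\<integral>\<^sup>+x. (\<Sum>k. ?s k x) \<partial>M) \<noteq> \<infinity>" by simp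
    then have "AE x in M. (\<Sum>k. ?s k x) \<noteq> \<infinity>"
      by (intro nn_integral_noteq_infinite) auto
    then show ?thesis
    proof (rule eventually_mono, intro impI)
      fix x assume *: "(\<Sum>k. ?s k x) \<noteq> \<infinity>" "x \<in> A R"
      then have "convergent (\<lambda>k. g k x)"
        by (intro convergent_if_sum_sq_finite[of "\<lambda>k. g k x" R]) (simp add: less_top)
      then show "(\<lambda>k. g k x) \<longlonglongrightarrow> t x" by (simp add: t_def convergent_LIMSEQ_iff)
    qed
  qed
  show ?thesis
  proof (intro bexI[OF _ t] allI)
    fix R
    show "(\<lambda>k. \<integral>\<^sup>+x\<in>A R. ennreal ((norm (f k x - t x))\<^sup>2) \<partial>M) \<longlonglongrightarrow> 0"
    proof (rule tendsto_zero_ennreal)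
      fix \<epsilon> :: real assume \<epsilon>: "0 < \<epsilon>"
      obtain K where K: "\<And>m n. K \<le> m \<Longrightarrow> K \<le> n \<Longrightarrow> (\<integral>\<^sup>+x\<in>A R. ennreal ((norm (f m x - f n x))\<^sup>2) \<partial>M) \<le> ennreal (\<epsilon> / 2)"
        using cauchy[of "\<epsilon> / 2" R] \<epsilon> by auto
      have "(\<integral>\<^sup>+x\<in>A R. ennreal ((norm (f k x - t x))\<^sup>2) \<partial>M) \<le> ennreal (\<epsilon> / 2)" if k: "K \<le> k" for k
      proof -
        have "(\<integral>\<^sup>+x\<in>A R. ennreal ((norm (f k x - t x))\<^sup>2) \<partial>M)
            \<le> (\<integral>\<^sup>+x. liminf (\<lambda>j. ennreal ((norm (f k x - g j x))\<^sup>2) * indicator (A R) x) \<partial>M)"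
        proof (rule nn_integral_mono_AE, rule eventually_mono[OF conv[of R]])
          fix x assume x: "x \<in> A R \<longrightarrow> (\<lambda>k. g k x) \<longlonglongrightarrow> t x"
          show "ennreal ((norm (f k x - t x))\<^sup>2) * indicator (A R) x
              \<le> liminf (\<lambda>j. ennreal ((norm (f k x - g j x))\<^sup>2) * indicator (A R) x)"
          proof (cases "x \<in> A R")
            case True
            then have "(\<lambda>j. ennreal ((norm (f k x - g j x))\<^sup>2)) \<longlonglongrightarrow> ennreal ((norm (f k x - t x))\<^sup>2)"
              using x by (intro tendsto_ennrealI tendsto_intros) auto
            then have "liminf (\<lambda>j. ennreal ((norm (f k x - g j x))\<^sup>2)) = ennreal ((norm (f k x - t x))\<^sup>2)"
              by (intro lim_imp_Liminf) auto
            then show ?thesis using True by simp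
          qed simp
        qed
        also have "\<dots> \<le> liminf (\<lambda>j. \<integral>\<^sup>+x\<in>A R. ennreal ((norm (f k x - g j x))\<^sup>2) \<partial>M)"
          by (intro nn_integral_liminf) measurable
        also have "\<dots> \<le> ennreal (\<epsilon> / 2)"
        proof (rule Liminf_le)
          show "\<forall>\<^sub>F j in sequentially. (\<integral>\<^sup>+x\<in>A R. ennreal ((norm (f k x - g j x))\<^sup>2) \<partial>M) \<le> ennreal (\<epsilon> / 2)"
            using eventually_ge_at_top[of K]
            by eventually_elim (use K[OF k] r_ge(3) in \<open>auto simp: g_def intro: order_trans\<close>)
        qed simp
        finally show ?thesis .
      qed
      moreover have "ennreal (\<epsilon> / 2) < ennreal \<epsilon>" using \<epsilon> by (simp add: ennreal_less_iff)
      ultimately show "\<forall>\<^sub>F k in sequentially. (\<integral>\<^sup>+x\<in>A R. ennreal ((norm (f k x - t x))\<^sup>2) \<partial>M) < ennreal \<epsilon>"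
        by (intro eventually_sequentiallyI[of K]) (rule le_less_trans)
    qed
  qed
qed

lemma norm_vector_smult: "norm (a *s (x :: complex ^ 'n)) = norm a * norm x"
proof -
  have "norm (a *s x) = L2_set (\<lambda>i. norm a * norm (x $ i)) UNIV"
    by (simp add: norm_vec_def norm_mult)
  also have "\<dots> = norm a * norm x" by (simp add: norm_vec_def L2_set_right_distrib)
  finally show ?thesis .
qed

lemma sum_sq_le_double: "(p + q)\<^sup>2 \<le> 2 * (p\<^sup>2 + q\<^sup>2)" for p q :: real
  using sum_squares_bound[of p q] by (simp add: power2_sum)

lemma borel_measurable_vec_component:
  fixes f :: "'a \<Rightarrow> complex ^ 'n"
  assumes "f \<in> borel_measurable M"
  shows "(\<lambda>x. f x $ i) \<in> borel_measurable M"
  using assms by (rule borel_measurable_continuous_on[rotated]) (intro continuous_intros)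

lemma borel_measurable_vec_lin:
  fixes f g :: "'a \<Rightarrow> complex ^ 'n"
  assumes "f \<in> borel_measurable M" "g \<in> borel_measurable M"
  shows "(\<lambda>x. a *s f x + b *s g x) \<in> borel_measurable M"
proof -
  have c: "continuous_on UNIV (\<lambda>x :: complex ^ 'n. c *s x)" for c
    unfolding vector_scalar_mult_def by (intro continuous_intros)
  show ?thesis
    using borel_measurable_continuous_on[OF c assms(1)] borel_measurable_continuous_on[OF c assms(2)]
    by (rule borel_measurable_add)
qed

lemma borel_measurable_vec_cnj:
  fixes f :: "'a \<Rightarrow> complex ^ 'n"
  assumes "f \<in> borel_measurable M"
  shows "(\<lambda>x. \<chi> i. cnj (f x $ i)) \<in> borel_measurable M"
  using assms by (rule borel_measurable_continuous_on[rotated]) (intro continuous_intros)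

lemma L2D:
  assumes "f \<in> L2 \<Omega>"
  shows "f \<in> borel_measurable (lebesgue_on \<Omega>)" "integrable (lebesgue_on \<Omega>) (\<lambda>x. (norm (f x))\<^sup>2)"
  using assms by (auto simp: L2_def)

lemma L2_bound:
  assumes f: "f \<in> borel_measurable (lebesgue_on \<Omega>)" and g: "g \<in> L2 \<Omega>" and h: "h \<in> L2 \<Omega>"
    and le: "\<And>x. (norm (f x))\<^sup>2 \<le> C * ((norm (g x))\<^sup>2 + (norm (h x))\<^sup>2)"
  shows "f \<in> L2 \<Omega>"
proof -
  have [measurable]: "f \<in> borel_measurable (lebesgue_on \<Omega>)" by (rule f)
  have "integrable (lebesgue_on \<Omega>) (\<lambda>x. (norm (f x))\<^sup>2)"
  proof (rule Bochner_Integration.integrable_bound)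
    show "integrable (lebesgue_on \<Omega>) (\<lambda>x. C * ((norm (g x))\<^sup>2 + (norm (h x))\<^sup>2))"
      using g h by (intro integrable_mult_right Bochner_Integration.integrable_add L2D)
    show "AE x in lebesgue_on \<Omega>. norm ((norm (f x))\<^sup>2) \<le> norm (C * ((norm (g x))\<^sup>2 + (norm (h x))\<^sup>2))"
      by (intro AE_I2) (use le in \<open>smt (verit) real_norm_def zero_le_power2\<close>)
  qed measurable
  then show ?thesis by (simp add: L2_def f)
qed

lemma L2_lin:
  fixes u v :: "real ^ 'n \<Rightarrow> complex"
  assumes "u \<in> L2 \<Omega>" "v \<in> L2 \<Omega>"
  shows "(\<lambda>x. a * u x + b * v x) \<in> L2 \<Omega>"
proof (rule L2_bound[OF _ assms, of _ "2 * ((norm a)\<^sup>2 + (norm b)\<^sup>2)"])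
  show "(\<lambda>x. a * u x + b * v x) \<in> borel_measurable (lebesgue_on \<Omega>)"
    using assms by (auto intro!: borel_measurable_add borel_measurable_times dest: L2D)
  fix x
  have "norm (a * u x + b * v x) \<le> norm a * norm (u x) + norm b * norm (v x)"
    by (metis norm_mult norm_triangle_ineq)
  then have "(norm (a * u x + b * v x))\<^sup>2 \<le> (norm a * norm (u x) + norm b * norm (v x))\<^sup>2"
    by (intro power_mono) auto
  also have "\<dots> \<le> 2 * ((norm a * norm (u x))\<^sup>2 + (norm b * norm (v x))\<^sup>2)" by (rule sum_sq_le_double)
  also have "\<dots> \<le> 2 * ((norm a)\<^sup>2 + (norm b)\<^sup>2) * ((norm (u x))\<^sup>2 + (norm (v x))\<^sup>2)"
    by (simp add: power_mult_distrib algebra_simps)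
  finally show "(norm (a * u x + b * v x))\<^sup>2 \<le> 2 * ((norm a)\<^sup>2 + (norm b)\<^sup>2) * ((norm (u x))\<^sup>2 + (norm (v x))\<^sup>2)" .
qed

lemma L2_vec_lin:
  fixes u v :: "real ^ 'n \<Rightarrow> complex ^ 'm"
  assumes "u \<in> L2 \<Omega>" "v \<in> L2 \<Omega>"
  shows "(\<lambda>x. a *s u x + b *s v x) \<in> L2 \<Omega>"
proof (rule L2_bound[OF _ assms, of _ "2 * ((norm a)\<^sup>2 + (norm b)\<^sup>2)"])
  show "(\<lambda>x. a *s u x + b *s v x) \<in> borel_measurable (lebesgue_on \<Omega>)"
    using assms by (intro borel_measurable_vec_lin L2D)
  fix x
  have "norm (a *s u x + b *s v x) \<le> norm a * norm (u x) + norm b * norm (v x)"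
    by (metis norm_vector_smult norm_triangle_ineq)
  then have "(norm (a *s u x + b *s v x))\<^sup>2 \<le> (norm a * norm (u x) + norm b * norm (v x))\<^sup>2"
    by (intro power_mono) auto
  also have "\<dots> \<le> 2 * ((norm a * norm (u x))\<^sup>2 + (norm b * norm (v x))\<^sup>2)" by (rule sum_sq_le_double)
  also have "\<dots> \<le> 2 * ((norm a)\<^sup>2 + (norm b)\<^sup>2) * ((norm (u x))\<^sup>2 + (norm (v x))\<^sup>2)"
    by (simp add: power_mult_distrib algebra_simps)
  finally show "(norm (a *s u x + b *s v x))\<^sup>2 \<le> 2 * ((norm a)\<^sup>2 + (norm b)\<^sup>2) * ((norm (u x))\<^sup>2 + (norm (v x))\<^sup>2)" .
qed

lemma L2_cnj: "u \<in> L2 \<Omega> \<Longrightarrow> cnj_fun u \<in> L2 \<Omega>"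
proof (rule L2_bound[of _ _ u u 1])
  assume "u \<in> L2 \<Omega>"
  then show "cnj_fun u \<in> borel_measurable (lebesgue_on \<Omega>)"
    unfolding cnj_fun_def by (intro borel_measurable_continuous_on[of cnj] continuous_intros L2D)
qed (auto simp: cnj_fun_def)

lemma norm_vec_cnj: "norm (\<chi> i. cnj (x $ i)) = norm (x :: complex ^ 'n)"
  by (simp add: norm_vec_def)

lemma L2_vec_cnj: "(u :: real ^ 'n \<Rightarrow> complex ^ 'm) \<in> L2 \<Omega> \<Longrightarrow> (\<lambda>x. \<chi> i. cnj (u x $ i)) \<in> L2 \<Omega>"
  by (rule L2_bound[of _ _ u u 1]) (auto simp: norm_vec_cnj dest: L2D intro: borel_measurable_vec_cnj)

lemma L2_component: "(u :: real ^ 'n \<Rightarrow> complex ^ 'm) \<in> L2 \<Omega> \<Longrightarrow> (\<lambda>x. u x $ i) \<in> L2 \<Omega>"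
proof (rule L2_bound[of _ _ u u 1])
  show "(norm (u x $ i))\<^sup>2 \<le> 1 * ((norm (u x))\<^sup>2 + (norm (u x))\<^sup>2)" for x
  proof -
    have "(norm (u x $ i))\<^sup>2 \<le> (norm (u x))\<^sup>2"
      by (rule power_mono[OF Finite_Cartesian_Product.norm_nth_le norm_ge_zero])
    also have "\<dots> \<le> 1 * ((norm (u x))\<^sup>2 + (norm (u x))\<^sup>2)" by simp
    finally show ?thesis .
  qed
qed (auto dest: L2D intro: borel_measurable_vec_component)

lemma L2_mult_integrable:
  fixes u v :: "real ^ 'n \<Rightarrow> complex"
  assumes u: "u \<in> L2 \<Omega>" and v: "v \<in> L2 \<Omega>"
  shows "integrable (lebesgue_on \<Omega>) (\<lambda>x. u x * v x)"
proof (rule Bochner_Integration.integrable_bound)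
  show "integrable (lebesgue_on \<Omega>) (\<lambda>x. (norm (u x))\<^sup>2 + (norm (v x))\<^sup>2)"
    using u v by (intro Bochner_Integration.integrable_add L2D)
  show "(\<lambda>x. u x * v x) \<in> borel_measurable (lebesgue_on \<Omega>)"
    using u v by (intro borel_measurable_times L2D)
  show "AE x in lebesgue_on \<Omega>. norm (u x * v x) \<le> norm ((norm (u x))\<^sup>2 + (norm (v x))\<^sup>2)"
  proof (intro AE_I2)
    fix x
    have "2 * (norm (u x) * norm (v x)) \<le> (norm (u x))\<^sup>2 + (norm (v x))\<^sup>2"
      using sum_squares_bound[of "norm (u x)" "norm (v x)"] by simp
    moreover have "0 \<le> norm (u x) * norm (v x)" by simp
    ultimately show "norm (u x * v x) \<le> norm ((norm (u x))\<^sup>2 + (norm (v x))\<^sup>2)"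
      unfolding norm_mult real_norm_def by linarith
  qed
qed

lemma L2_pairing_tendsto:
  fixes f :: "nat \<Rightarrow> real ^ 'n \<Rightarrow> complex"
  assumes f: "\<And>k. f k \<in> L2 \<Omega>" and t: "t \<in> L2 \<Omega>" and p: "p \<in> L2 \<Omega>"
    and lim: "(\<lambda>k. \<integral>\<^sup>+x. ennreal ((norm (f k x - t x))\<^sup>2) \<partial>lebesgue_on \<Omega>) \<longlonglongrightarrow> 0"
  shows "(\<lambda>k. LINT x|lebesgue_on \<Omega>. f k x * p x) \<longlonglongrightarrow> (LINT x|lebesgue_on \<Omega>. t x * p x)"
proof -
  let ?M = "lebesgue_on \<Omega>"
  have [measurable]: "f k \<in> borel_measurable ?M" "t \<in> borel_measurable ?M" "p \<in> borel_measurable ?M" for k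
    using f t p by (auto dest: L2D)
  define P where "P = (\<integral>\<^sup>+x. (ennreal (norm (p x)))\<^sup>2 \<partial>?M)"
  have P: "P < \<infinity>"
    using L2D(2)[OF p] unfolding integrable_iff_bounded by (simp add: P_def ennreal_power)
  define E where "E k = (\<integral>\<^sup>+x. ennreal ((norm (f k x - t x))\<^sup>2) \<partial>?M)" for k
  have le: "(ennreal (norm ((LINT x|?M. f k x * p x) - (LINT x|?M. t x * p x))))\<^sup>2 \<le> E k * P" for k
  proof -
    have "(LINT x|?M. f k x * p x) - (LINT x|?M. t x * p x) = (LINT x|?M. (f k x - t x) * p x)"
      unfolding left_diff_distrib
      by (rule Bochner_Integration.integral_diff[symmetric, OF L2_mult_integrable[OF f p] L2_mult_integrable[OF t p]])
    moreover have "integrable ?M (\<lambda>x. (f k x - t x) * p x)"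
      using L2_mult_integrable[OF L2_lin[OF f t, of 1 k "-1"] p] by simp
    ultimately have "ennreal (norm ((LINT x|?M. f k x * p x) - (LINT x|?M. t x * p x)))
        \<le> (\<integral>\<^sup>+x. ennreal (norm ((f k x - t x) * p x)) \<partial>?M)"
      by (simp only: integral_norm_bound_ennreal)
    also have "\<dots> = (\<integral>\<^sup>+x. ennreal (norm (f k x - t x)) * ennreal (norm (p x)) \<partial>?M)"
      by (simp add: norm_mult ennreal_mult)
    finally have "(ennreal (norm ((LINT x|?M. f k x * p x) - (LINT x|?M. t x * p x))))\<^sup>2
        \<le> (\<integral>\<^sup>+x. ennreal (norm (f k x - t x)) * ennreal (norm (p x)) \<partial>?M)\<^sup>2"
      by (rule power_mono_ennreal)
    also have "\<dots> \<le> (\<integral>\<^sup>+x. (ennreal (norm (f k x - t x)))\<^sup>2 \<partial>?M) * P"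
      unfolding P_def by (rule Cauchy_Schwarz_nn_integral) measurable
    finally show ?thesis by (simp add: E_def ennreal_power)
  qed
  have "(\<lambda>k. E k * P) \<longlonglongrightarrow> 0 * P"
    using lim P unfolding E_def by (intro tendsto_mult_ennreal) auto
  then have E0: "(\<lambda>k. E k * P) \<longlonglongrightarrow> 0" by simp
  have "(\<lambda>k. (ennreal (norm ((LINT x|?M. f k x * p x) - (LINT x|?M. t x * p x))))\<^sup>2) \<longlonglongrightarrow> 0"
    by (rule tendsto_sandwich[OF always_eventually always_eventually tendsto_const E0]) (simp_all add: le)
  then have "(\<lambda>k. ennreal ((norm ((LINT x|?M. f k x * p x) - (LINT x|?M. t x * p x)))\<^sup>2)) \<longlonglongrightarrow> ennreal 0"
    by (simp add: ennreal_power)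
  then have "(\<lambda>k. (norm ((LINT x|?M. f k x * p x) - (LINT x|?M. t x * p x)))\<^sup>2) \<longlonglongrightarrow> 0"
    by (rule tendsto_ennrealD) auto
  from tendsto_real_sqrt[OF this]
  have "(\<lambda>k. norm ((LINT x|?M. f k x * p x) - (LINT x|?M. t x * p x))) \<longlonglongrightarrow> 0" by simp
  then show ?thesis by (rule LIM_zero_cancel[OF tendsto_norm_zero_cancel])
qed

lemma has_weak_gradientD:
  assumes "has_weak_gradient \<Omega> v g" "\<phi> \<in> test_functions \<Omega>"
  shows "(LINT x|lebesgue_on \<Omega>. v x * partial_deriv i \<phi> x) = - (LINT x|lebesgue_on \<Omega>. g x $ i * \<phi> x)"
  using assms by (auto simp: has_weak_gradient_def)

locale sobolev_domain =
  fixes \<Omega> :: "(real ^ 'n) set"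
  assumes open_domain: "open \<Omega>"
begin

abbreviation "M \<equiv> lebesgue_on \<Omega>"

lemma domain_lebesgue [simp]: "\<Omega> \<in> sets lebesgue"
  using open_domain by (simp add: borel_open)

lemma borel_imp_M:
  assumes "f \<in> borel_measurable borel"
  shows "f \<in> borel_measurable M"
  using assms by (intro measurable_restrict_space1 measurable_completion) simp

lemma continuous_compact_support_L2:
  fixes f :: "real ^ 'n \<Rightarrow> 'b::euclidean_space"
  assumes f: "continuous_on UNIV f" and K: "compact K" "\<And>x. x \<notin> K \<Longrightarrow> f x = 0"
  shows "f \<in> L2 \<Omega>"
proof -
  have "integrable lborel (\<lambda>x. (norm (f x))\<^sup>2)"
    using f K by (intro continuous_compact_support_integrable[OF _ K(1)] continuous_intros) auto
  then have "integrable lebesgue (\<lambda>x. (norm (f x))\<^sup>2)"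
    using f by (subst integrable_completion) (auto intro!: borel_measurable_continuous_onI continuous_intros)
  from integrable_mult_indicator[OF domain_lebesgue this]
  have "integrable M (\<lambda>x. (norm (f x))\<^sup>2)" by (simp add: integrable_restrict_space)
  moreover have "f \<in> borel_measurable M"
    using f by (intro borel_imp_M borel_measurable_continuous_onI)
  ultimately show ?thesis by (simp add: L2_def)
qed

lemma test_function_L2: "\<phi> \<in> test_functions U \<Longrightarrow> \<phi> \<in> L2 \<Omega>"
  using continuous_compact_support_L2[OF test_functionsD(2,5)] test_functionsD(4) by blast

lemma test_function_gradient_L2:
  assumes "\<phi> \<in> test_functions U"
  shows "classical_gradient \<phi> \<in> L2 \<Omega>"
proof (rule continuous_compact_support_L2[OF _ test_functionsD(5)[OF assms]])
  show "continuous_on UNIV (classical_gradient \<phi>)"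
    unfolding classical_gradient_def
    using test_functionsD(2)[OF test_functions_partial_deriv[OF assms]] by (intro continuous_intros)
  show "classical_gradient \<phi> x = 0" if "x \<notin> closure {x. \<phi> x \<noteq> 0}" for x
    using partial_deriv_zero_outside[OF that] by (simp add: classical_gradient_def vec_eq_iff)
qed

lemma weak_gradient_unique:
  assumes g: "g \<in> L2 \<Omega>" "has_weak_gradient \<Omega> v g" and h: "h \<in> L2 \<Omega>" "has_weak_gradient \<Omega> v h"
  shows "AE x in M. g x = h x"
proof -
  have "AE x in M. g x $ i - h x $ i = 0" for i
  proof (rule fundamental_lemma[OF open_domain])
    have d: "(\<lambda>x. g x $ i - h x $ i) \<in> L2 \<Omega>"
      using L2_lin[OF L2_component[OF g(1)] L2_component[OF h(1)], of 1 i "-1"] by simp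
    then show "(\<lambda>x. g x $ i - h x $ i) \<in> borel_measurable M" by (rule L2D)
    fix a b assume "cbox a b \<subseteq> \<Omega>"
    have "(indicator (cbox a b) :: _ \<Rightarrow> complex) \<in> L2 \<Omega>"
    proof -
      have "integrable lebesgue (indicator (cbox a b) :: real ^ 'n \<Rightarrow> real)"
        by (intro integrable_real_indicator) (auto simp: emeasure_lborel_cbox_eq)
      from integrable_mult_indicator[OF domain_lebesgue this]
      have "integrable M (indicator (cbox a b) :: real ^ 'n \<Rightarrow> real)" by (simp add: integrable_restrict_space)
      moreover have "(\<lambda>x. (norm (indicator (cbox a b) x :: complex))\<^sup>2) = (indicator (cbox a b) :: real ^ 'n \<Rightarrow> real)"
        by (auto simp: indicator_def)
      moreover have "(indicator (cbox a b) :: real ^ 'n \<Rightarrow> complex) \<in> borel_measurable M"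
        by (intro borel_imp_M borel_measurable_indicator) auto
      ultimately show ?thesis by (simp add: L2_def)
    qed
    from L2_mult_integrable[OF this d]
    show "integrable M (\<lambda>x. indicator (cbox a b) x *\<^sub>R (g x $ i - h x $ i))"
      by (simp add: scaleR_conv_of_real of_real_indicator)
  next
    fix \<phi> assume \<phi>: "\<phi> \<in> test_functions \<Omega>"
    have "(LINT x|M. (g x $ i - h x $ i) * \<phi> x) = (LINT x|M. g x $ i * \<phi> x) - (LINT x|M. h x $ i * \<phi> x)"
      unfolding left_diff_distrib
      using L2_mult_integrable[OF L2_component[OF g(1)] test_function_L2[OF \<phi>]]
        L2_mult_integrable[OF L2_component[OF h(1)] test_function_L2[OF \<phi>]]
      by (rule Bochner_Integration.integral_diff)
    then show "(LINT x|M. (g x $ i - h x $ i) * \<phi> x) = 0"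
      using has_weak_gradientD[OF g(2) \<phi>, of i] has_weak_gradientD[OF h(2) \<phi>, of i] by simp
  qed
  then have "AE x in M. \<forall>i\<in>UNIV. g x $ i - h x $ i = 0" by (intro AE_finite_allI) auto
  then show ?thesis by (rule eventually_mono) (simp add: vec_eq_iff)
qed

lemma H1_weak_gradient:
  assumes "v \<in> H1 \<Omega>"
  shows "weak_gradient \<Omega> v \<in> L2 \<Omega>" "has_weak_gradient \<Omega> v (weak_gradient \<Omega> v)"
proof -
  have "\<exists>g. g \<in> L2 \<Omega> \<and> has_weak_gradient \<Omega> v g" using assms by (auto simp: H1_def)
  then have "weak_gradient \<Omega> v \<in> L2 \<Omega> \<and> has_weak_gradient \<Omega> v (weak_gradient \<Omega> v)"
    unfolding weak_gradient_def by (rule someI_ex)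
  then show "weak_gradient \<Omega> v \<in> L2 \<Omega>" "has_weak_gradient \<Omega> v (weak_gradient \<Omega> v)" by auto
qed

lemma H1_L2: "v \<in> H1 \<Omega> \<Longrightarrow> v \<in> L2 \<Omega>"
  by (simp add: H1_def)

lemma H1I:
  assumes "v \<in> L2 \<Omega>" "g \<in> L2 \<Omega>" "has_weak_gradient \<Omega> v g"
  shows "v \<in> H1 \<Omega>" "AE x in M. weak_gradient \<Omega> v x = g x"
proof -
  show v: "v \<in> H1 \<Omega>" using assms by (auto simp: H1_def)
  show "AE x in M. weak_gradient \<Omega> v x = g x"
    using H1_weak_gradient[OF v] assms by (intro weak_gradient_unique)
qed

lemma H1_lin:
  assumes u: "u \<in> H1 \<Omega>" and v: "v \<in> H1 \<Omega>"
  shows "(\<lambda>x. a * u x + b * v x) \<in> H1 \<Omega>"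
    "AE x in M. weak_gradient \<Omega> (\<lambda>x. a * u x + b * v x) x = a *s weak_gradient \<Omega> u x + b *s weak_gradient \<Omega> v x"
proof -
  note gu = H1_weak_gradient[OF u] and gv = H1_weak_gradient[OF v]
  have "has_weak_gradient \<Omega> (\<lambda>x. a * u x + b * v x) (\<lambda>x. a *s weak_gradient \<Omega> u x + b *s weak_gradient \<Omega> v x)"
    unfolding has_weak_gradient_def
  proof (intro ballI allI)
    fix \<phi> i assume \<phi>: "\<phi> \<in> test_functions \<Omega>"
    have p: "\<phi> \<in> L2 \<Omega>" "partial_deriv i \<phi> \<in> L2 \<Omega>"
      using \<phi> test_functions_partial_deriv test_function_L2 by blast+
    have "(LINT x|M. (a * u x + b * v x) * partial_deriv i \<phi> x)
        = (LINT x|M. a * (u x * partial_deriv i \<phi> x) + b * (v x * partial_deriv i \<phi> x))"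
      by (simp add: algebra_simps)
    also have "\<dots> = a * (LINT x|M. u x * partial_deriv i \<phi> x) + b * (LINT x|M. v x * partial_deriv i \<phi> x)"
      using u v p by (subst Bochner_Integration.integral_add) (auto intro!: integrable_mult_right L2_mult_integrable H1_L2)
    also have "\<dots> = - (a * (LINT x|M. weak_gradient \<Omega> u x $ i * \<phi> x) + b * (LINT x|M. weak_gradient \<Omega> v x $ i * \<phi> x))"
      by (simp add: has_weak_gradientD[OF gu(2) \<phi>] has_weak_gradientD[OF gv(2) \<phi>])
    also have "a * (LINT x|M. weak_gradient \<Omega> u x $ i * \<phi> x) + b * (LINT x|M. weak_gradient \<Omega> v x $ i * \<phi> x)
        = (LINT x|M. a * (weak_gradient \<Omega> u x $ i * \<phi> x) + b * (weak_gradient \<Omega> v x $ i * \<phi> x))"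
      using gu gv p by (subst Bochner_Integration.integral_add) (auto intro!: integrable_mult_right L2_mult_integrable L2_component)
    also have "\<dots> = (LINT x|M. (a *s weak_gradient \<Omega> u x + b *s weak_gradient \<Omega> v x) $ i * \<phi> x)"
      by (simp add: algebra_simps)
    finally show "(LINT x|M. (a * u x + b * v x) * partial_deriv i \<phi> x)
       = - (LINT x|M. (a *s weak_gradient \<Omega> u x + b *s weak_gradient \<Omega> v x) $ i * \<phi> x)" .
  qed
  from H1I[OF L2_lin[OF H1_L2[OF u] H1_L2[OF v]] L2_vec_lin[OF gu(1) gv(1)] this]
  show "(\<lambda>x. a * u x + b * v x) \<in> H1 \<Omega>"
    "AE x in M. weak_gradient \<Omega> (\<lambda>x. a * u x + b * v x) x = a *s weak_gradient \<Omega> u x + b *s weak_gradient \<Omega> v x"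
    by auto
qed

lemma H1_cnj:
  assumes v: "v \<in> H1 \<Omega>"
  shows "cnj_fun v \<in> H1 \<Omega>"
    "AE x in M. weak_gradient \<Omega> (cnj_fun v) x = (\<chi> i. cnj (weak_gradient \<Omega> v x $ i))"
proof -
  note gv = H1_weak_gradient[OF v]
  have "has_weak_gradient \<Omega> (cnj_fun v) (\<lambda>x. \<chi> i. cnj (weak_gradient \<Omega> v x $ i))"
    unfolding has_weak_gradient_def
  proof (intro ballI allI)
    fix \<phi> i assume \<phi>: "\<phi> \<in> test_functions \<Omega>"
    have "partial_deriv i (cnj_fun \<phi>) x = cnj (partial_deriv i \<phi> x)" for x
      using test_functionsD(3)[OF \<phi>] by (rule partial_deriv_cnj)
    then have "(LINT x|M. cnj_fun v x * partial_deriv i \<phi> x) = cnj (LINT x|M. v x * partial_deriv i (cnj_fun \<phi>) x)"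
      by (simp add: cnj_fun_def[of v] add: Bochner_Integration.integral_cnj[symmetric] del: Bochner_Integration.integral_cnj)
    also have "\<dots> = - cnj (LINT x|M. weak_gradient \<Omega> v x $ i * cnj_fun \<phi> x)"
      by (simp add: has_weak_gradientD[OF gv(2) test_functions_cnj[OF \<phi>]])
    also have "\<dots> = - (LINT x|M. (\<chi> i. cnj (weak_gradient \<Omega> v x $ i)) $ i * \<phi> x)"
      by (simp add: cnj_fun_def add: Bochner_Integration.integral_cnj[symmetric] del: Bochner_Integration.integral_cnj)
    finally show "(LINT x|M. cnj_fun v x * partial_deriv i \<phi> x) = - (LINT x|M. (\<chi> i. cnj (weak_gradient \<Omega> v x $ i)) $ i * \<phi> x)" .
  qed
  from H1I[OF L2_cnj[OF H1_L2[OF v]] L2_vec_cnj[OF gv(1)] this]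
  show "cnj_fun v \<in> H1 \<Omega>" "AE x in M. weak_gradient \<Omega> (cnj_fun v) x = (\<chi> i. cnj (weak_gradient \<Omega> v x $ i))"
    by auto
qed

lemma test_function_H1:
  assumes "\<phi> \<in> test_functions UNIV"
  shows "\<phi> \<in> H1 \<Omega>" "AE x in M. weak_gradient \<Omega> \<phi> x = classical_gradient \<phi> x"
  using H1I[OF test_function_L2[OF assms] test_function_gradient_L2[OF assms]
      test_function_weak_gradient[OF open_domain assms]] by auto

lemma H1_norm_sq: "(H1_norm \<Omega> v)\<^sup>2 = (LINT x|M. (norm (v x))\<^sup>2) + (LINT x|M. (norm (weak_gradient \<Omega> v x))\<^sup>2)"
  by (simp add: H1_norm_def)

lemma H1_norm_sq_nn:
  assumes v: "v \<in> H1 \<Omega>" and g: "AE x in M. weak_gradient \<Omega> v x = g x"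
  shows "ennreal ((H1_norm \<Omega> v)\<^sup>2) = (\<integral>\<^sup>+x. ennreal ((norm (v x))\<^sup>2) \<partial>M) + (\<integral>\<^sup>+x. ennreal ((norm (g x))\<^sup>2) \<partial>M)"
proof -
  have "(\<integral>\<^sup>+x. ennreal ((norm (g x))\<^sup>2) \<partial>M) = (\<integral>\<^sup>+x. ennreal ((norm (weak_gradient \<Omega> v x))\<^sup>2) \<partial>M)"
    using g by (intro nn_integral_cong_AE) (auto elim: eventually_mono)
  moreover have "(\<integral>\<^sup>+x. ennreal ((norm (weak_gradient \<Omega> v x))\<^sup>2) \<partial>M) = ennreal (LINT x|M. (norm (weak_gradient \<Omega> v x))\<^sup>2)"
    using L2D(2)[OF H1_weak_gradient(1)[OF v]] by (intro nn_integral_eq_integral) auto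
  moreover have "(\<integral>\<^sup>+x. ennreal ((norm (v x))\<^sup>2) \<partial>M) = ennreal (LINT x|M. (norm (v x))\<^sup>2)"
    using L2D(2)[OF H1_L2[OF v]] by (intro nn_integral_eq_integral) auto
  ultimately show ?thesis by (simp add: H1_norm_sq)
qed

end

section \<open>The Sobolev space \<open>H\<^sup>1\<close>\<close>

lemma riesz_fischer:
  fixes f :: "nat \<Rightarrow> 'a \<Rightarrow> 'b::{banach, second_countable_topology}"
  assumes f: "\<And>k. f k \<in> borel_measurable M"
    and cauchy: "\<And>\<epsilon>. 0 < \<epsilon> \<Longrightarrow> \<exists>N. \<forall>m\<ge>N. \<forall>n\<ge>N. (\<integral>\<^sup>+x. ennreal ((norm (f m x - f n x))\<^sup>2) \<partial>M) \<le> ennreal \<epsilon>"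
  shows "\<exists>t\<in>borel_measurable M. (\<lambda>k. \<integral>\<^sup>+x. ennreal ((norm (f k x - t x))\<^sup>2) \<partial>M) \<longlonglongrightarrow> 0"
proof -
  have *: "(\<integral>\<^sup>+x\<in>space M. u x \<partial>M) = (\<integral>\<^sup>+x. u x \<partial>M)" for u
    by (intro nn_integral_cong) simp
  have "\<exists>t\<in>borel_measurable M. \<forall>R :: nat. (\<lambda>k. \<integral>\<^sup>+x\<in>space M. ennreal ((norm (f k x - t x))\<^sup>2) \<partial>M) \<longlonglongrightarrow> 0"
  proof (rule riesz_fischer_local)
    show "incseq (\<lambda>R :: nat. space M)" by (simp add: incseq_def)
  qed (use f cauchy in \<open>auto simp: *\<close>)
  then show ?thesis by (simp add: *)
qed

lemma ennreal_add_leD: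
  fixes a b c :: ennreal
  assumes "a + b \<le> c"
  shows "a \<le> c" "b \<le> c"
  by (rule order_trans[OF _ assms], simp add: add_increasing add_increasing2)+

lemma norm_sq_diff_le:
  fixes a b :: "'a::real_normed_vector"
  shows "(norm a)\<^sup>2 \<le> 2 * ((norm b)\<^sup>2 + (norm (a - b))\<^sup>2)"
proof -
  have "(norm a)\<^sup>2 \<le> (norm b + norm (a - b))\<^sup>2"
    using norm_triangle_sub[of a b] by (intro power_mono) auto
  also have "\<dots> \<le> 2 * ((norm b)\<^sup>2 + (norm (a - b))\<^sup>2)" by (rule sum_sq_le_double)
  finally show ?thesis .
qed

lemma L2_limit:
  fixes f :: "nat \<Rightarrow> real ^ 'n \<Rightarrow> 'b::euclidean_space"
  assumes f: "\<And>k. f k \<in> L2 \<Omega>" and t: "t \<in> borel_measurable (lebesgue_on \<Omega>)"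
    and lim: "(\<lambda>k. \<integral>\<^sup>+x. ennreal ((norm (f k x - t x))\<^sup>2) \<partial>lebesgue_on \<Omega>) \<longlonglongrightarrow> 0"
  shows "t \<in> L2 \<Omega>"
proof -
  let ?M = "lebesgue_on \<Omega>"
  obtain k where k: "(\<integral>\<^sup>+x. ennreal ((norm (f k x - t x))\<^sup>2) \<partial>?M) < 1"
    using order_tendstoD(2)[OF lim, of 1] by (auto simp: eventually_sequentially)
  have [measurable]: "f k \<in> borel_measurable ?M" "t \<in> borel_measurable ?M" using f t by (auto dest: L2D)
  have d: "(\<lambda>x. t x - f k x) \<in> L2 \<Omega>"
  proof -
    have "(\<integral>\<^sup>+x. ennreal (norm ((norm (t x - f k x))\<^sup>2)) \<partial>?M) < \<infinity>"
      using order.strict_trans[OF k ennreal_one_less_top] by (simp add: norm_minus_commute)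
    then show ?thesis by (simp add: L2_def integrable_iff_bounded)
  qed
  show ?thesis
    by (rule L2_bound[OF t f[of k] d, of 2]) (rule norm_sq_diff_le)
qed

lemma nn_integral_lin_sq_le:
  fixes \<phi> \<psi> s t :: "'a \<Rightarrow> complex"
  assumes [measurable]: "\<phi> \<in> borel_measurable M" "\<psi> \<in> borel_measurable M" "s \<in> borel_measurable M" "t \<in> borel_measurable M"
    and A [measurable]: "A \<in> sets M"
  shows "(\<integral>\<^sup>+x\<in>A. ennreal ((norm (a * \<phi> x + b * \<psi> x - (a * s x + b * t x)))\<^sup>2) \<partial>M)
    \<le> ennreal (2 * (norm a)\<^sup>2) * (\<integral>\<^sup>+x\<in>A. ennreal ((norm (\<phi> x - s x))\<^sup>2) \<partial>M)
      + ennreal (2 * (norm b)\<^sup>2) * (\<integral>\<^sup>+x\<in>A. ennreal ((norm (\<psi> x - t x))\<^sup>2) \<partial>M)"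
proof -
  have "(\<integral>\<^sup>+x\<in>A. ennreal ((norm (a * \<phi> x + b * \<psi> x - (a * s x + b * t x)))\<^sup>2) \<partial>M)
    \<le> (\<integral>\<^sup>+x. ennreal (2 * (norm a)\<^sup>2) * (ennreal ((norm (\<phi> x - s x))\<^sup>2) * indicator A x)
        + ennreal (2 * (norm b)\<^sup>2) * (ennreal ((norm (\<psi> x - t x))\<^sup>2) * indicator A x) \<partial>M)"
  proof (rule nn_integral_mono)
    fix x
    have eq: "a * \<phi> x + b * \<psi> x - (a * s x + b * t x) = a * (\<phi> x - s x) + b * (\<psi> x - t x)"
      by (simp add: algebra_simps)
    have "norm (a * (\<phi> x - s x) + b * (\<psi> x - t x)) \<le> norm a * norm (\<phi> x - s x) + norm b * norm (\<psi> x - t x)"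
      by (metis norm_mult norm_triangle_ineq)
    then have "(norm (a * (\<phi> x - s x) + b * (\<psi> x - t x)))\<^sup>2 \<le> (norm a * norm (\<phi> x - s x) + norm b * norm (\<psi> x - t x))\<^sup>2"
      by (rule power_mono) simp
    also have "\<dots> \<le> 2 * ((norm a * norm (\<phi> x - s x))\<^sup>2 + (norm b * norm (\<psi> x - t x))\<^sup>2)" by (rule sum_sq_le_double)
    also have "\<dots> = 2 * (norm a)\<^sup>2 * (norm (\<phi> x - s x))\<^sup>2 + 2 * (norm b)\<^sup>2 * (norm (\<psi> x - t x))\<^sup>2"
      by (simp add: power_mult_distrib)
    finally have "ennreal ((norm (a * (\<phi> x - s x) + b * (\<psi> x - t x)))\<^sup>2)
        \<le> ennreal (2 * (norm a)\<^sup>2 * (norm (\<phi> x - s x))\<^sup>2 + 2 * (norm b)\<^sup>2 * (norm (\<psi> x - t x))\<^sup>2)"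
      by (rule ennreal_leI)
    also have "\<dots> = ennreal (2 * (norm a)\<^sup>2) * ennreal ((norm (\<phi> x - s x))\<^sup>2) + ennreal (2 * (norm b)\<^sup>2) * ennreal ((norm (\<psi> x - t x))\<^sup>2)"
      by (subst ennreal_plus) (simp_all add: ennreal_mult)
    finally show "ennreal ((norm (a * \<phi> x + b * \<psi> x - (a * s x + b * t x)))\<^sup>2) * indicator A x
       \<le> ennreal (2 * (norm a)\<^sup>2) * (ennreal ((norm (\<phi> x - s x))\<^sup>2) * indicator A x)
        + ennreal (2 * (norm b)\<^sup>2) * (ennreal ((norm (\<psi> x - t x))\<^sup>2) * indicator A x)"
      unfolding eq by (simp add: indicator_def)
  qed
  also have "\<dots> = ennreal (2 * (norm a)\<^sup>2) * (\<integral>\<^sup>+x\<in>A. ennreal ((norm (\<phi> x - s x))\<^sup>2) \<partial>M)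
      + ennreal (2 * (norm b)\<^sup>2) * (\<integral>\<^sup>+x\<in>A. ennreal ((norm (\<psi> x - t x))\<^sup>2) \<partial>M)"
    by (subst nn_integral_add) (auto simp: nn_integral_cmult)
  finally show ?thesis .
qed

context sobolev_domain begin

definition H1_ip :: "(real ^ 'n \<Rightarrow> complex) \<Rightarrow> (real ^ 'n \<Rightarrow> complex) \<Rightarrow> complex" where
  "H1_ip u v = (LINT x|M. u x * cnj (v x) + (\<Sum>i\<in>UNIV. weak_gradient \<Omega> u x $ i * cnj (weak_gradient \<Omega> v x $ i)))"

lemma ip_integrable:
  assumes "u \<in> H1 \<Omega>" "v \<in> H1 \<Omega>"
  shows "integrable M (\<lambda>x. u x * cnj (v x) + (\<Sum>i\<in>UNIV. weak_gradient \<Omega> u x $ i * cnj (weak_gradient \<Omega> v x $ i)))"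
proof (intro Bochner_Integration.integrable_add Bochner_Integration.integrable_sum)
  show "integrable M (\<lambda>x. u x * cnj (v x))"
    using L2_mult_integrable[OF H1_L2[OF assms(1)] L2_cnj[OF H1_L2[OF assms(2)]]] by (simp add: cnj_fun_def)
  show "integrable M (\<lambda>x. weak_gradient \<Omega> u x $ i * cnj (weak_gradient \<Omega> v x $ i))" for i
    using L2_mult_integrable[OF L2_component[OF H1_weak_gradient(1)[OF assms(1)]] L2_cnj[OF L2_component[OF H1_weak_gradient(1)[OF assms(2)]]]]
    by (simp add: cnj_fun_def)
qed

lemma zero_H1: "(\<lambda>x. 0) \<in> H1 \<Omega>"
  using test_function_H1(1)[OF test_functions_zero] .

lemma Re_H1_ip: "v \<in> H1 \<Omega> \<Longrightarrow> Re (H1_ip v v) = (H1_norm \<Omega> v)\<^sup>2"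
proof -
  assume v: "v \<in> H1 \<Omega>"
  have "v x * cnj (v x) + (\<Sum>i\<in>UNIV. weak_gradient \<Omega> v x $ i * cnj (weak_gradient \<Omega> v x $ i))
      = of_real ((norm (v x))\<^sup>2 + (norm (weak_gradient \<Omega> v x))\<^sup>2)" for x
    by (simp add: norm_vec_def L2_set_def sum_nonneg complex_norm_square[symmetric] of_real_sum)
  then have "H1_ip v v = of_real (LINT x|M. (norm (v x))\<^sup>2 + (norm (weak_gradient \<Omega> v x))\<^sup>2)"
    unfolding H1_ip_def by (simp only: integral_complex_of_real)
  also have "(LINT x|M. (norm (v x))\<^sup>2 + (norm (weak_gradient \<Omega> v x))\<^sup>2) = (H1_norm \<Omega> v)\<^sup>2"
    unfolding H1_norm_sq using v
    by (intro Bochner_Integration.integral_add L2D(2) H1_L2 H1_weak_gradient(1))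
  finally show ?thesis by simp
qed

sublocale H1: semi_inner_space "H1 \<Omega>" H1_ip
proof
  show "(\<lambda>x. 0) \<in> H1 \<Omega>" by (rule zero_H1)
  show "u \<in> H1 \<Omega> \<Longrightarrow> v \<in> H1 \<Omega> \<Longrightarrow> (\<lambda>x. a * u x + b * v x) \<in> H1 \<Omega>" for u v a b by (rule H1_lin)
  show "H1_ip v u = cnj (H1_ip u v)" for u v
    by (simp add: H1_ip_def mult.commute flip: Bochner_Integration.integral_cnj)
  show "v \<in> H1 \<Omega> \<Longrightarrow> 0 \<le> Re (H1_ip v v)" for v by (simp add: Re_H1_ip)
  fix u v w a b assume u: "u \<in> H1 \<Omega>" and v: "v \<in> H1 \<Omega>" and w: "w \<in> H1 \<Omega>"
  let ?G = "weak_gradient \<Omega>"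
  let ?u = "\<lambda>x. a * u x + b * v x"
  have uv: "?u \<in> H1 \<Omega>" using u v by (rule H1_lin)
  have "H1_ip ?u w = (LINT x|M. a * (u x * cnj (w x) + (\<Sum>i\<in>UNIV. ?G u x $ i * cnj (?G w x $ i)))
      + b * (v x * cnj (w x) + (\<Sum>i\<in>UNIV. ?G v x $ i * cnj (?G w x $ i))))"
    unfolding H1_ip_def
  proof (rule integral_cong_AE)
    show "(\<lambda>x. ?u x * cnj (w x) + (\<Sum>i\<in>UNIV. ?G ?u x $ i * cnj (?G w x $ i))) \<in> borel_measurable M"
      using ip_integrable[OF uv w] by (rule borel_measurable_integrable)
    show "(\<lambda>x. a * (u x * cnj (w x) + (\<Sum>i\<in>UNIV. ?G u x $ i * cnj (?G w x $ i)))
      + b * (v x * cnj (w x) + (\<Sum>i\<in>UNIV. ?G v x $ i * cnj (?G w x $ i)))) \<in> borel_measurable M"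
      using ip_integrable[OF u w] ip_integrable[OF v w]
      by (intro borel_measurable_integrable[OF Bochner_Integration.integrable_add] integrable_mult_right)
    show "AE x in M. ?u x * cnj (w x) + (\<Sum>i\<in>UNIV. ?G ?u x $ i * cnj (?G w x $ i))
       = a * (u x * cnj (w x) + (\<Sum>i\<in>UNIV. ?G u x $ i * cnj (?G w x $ i)))
      + b * (v x * cnj (w x) + (\<Sum>i\<in>UNIV. ?G v x $ i * cnj (?G w x $ i)))"
      using H1_lin(2)[OF u v, of a b]
      by eventually_elim (simp add: distrib_left distrib_right sum.distrib sum_distrib_left mult.assoc)
  qed
  also have "\<dots> = a * H1_ip u w + b * H1_ip v w"
    unfolding H1_ip_def
    using ip_integrable[OF u w] ip_integrable[OF v w]
    by (subst Bochner_Integration.integral_add) (auto intro!: integrable_mult_right simp del: distrib_left)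
  finally show "H1_ip ?u w = a * H1_ip u w + b * H1_ip v w" .
qed

lemma nrm_eq: "v \<in> H1 \<Omega> \<Longrightarrow> H1.nrm v = H1_norm \<Omega> v"
  by (simp add: H1.nrm_def Re_H1_ip) (simp add: H1_norm_def)

lemma H1_norm_ge: "0 \<le> H1_norm \<Omega> v"
  by (simp add: H1_norm_def)

lemma H1_norm_lin:
  assumes "u \<in> H1 \<Omega>" "v \<in> H1 \<Omega>"
  shows "H1_norm \<Omega> (\<lambda>x. a * u x + b * v x) \<le> norm a * H1_norm \<Omega> u + norm b * H1_norm \<Omega> v"
  using H1.nrm_triangle[OF H1.scale_mem[OF assms(1), of a] H1.scale_mem[OF assms(2), of b]] assms
  by (simp add: H1.nrm_scale nrm_eq H1.lin_mem)

lemma H1_norm_triangle: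
  assumes "u \<in> H1 \<Omega>" "v \<in> H1 \<Omega>" "w \<in> H1 \<Omega>"
  shows "H1_norm \<Omega> (\<lambda>x. u x - w x) \<le> H1_norm \<Omega> (\<lambda>x. u x - v x) + H1_norm \<Omega> (\<lambda>x. v x - w x)"
  using H1.nrm_triangle_diff[OF assms] assms by (simp add: nrm_eq H1.diff_mem)

lemma H1_norm_minus_commute:
  assumes "u \<in> H1 \<Omega>" "v \<in> H1 \<Omega>"
  shows "H1_norm \<Omega> (\<lambda>x. u x - v x) = H1_norm \<Omega> (\<lambda>x. v x - u x)"
  using H1.nrm_minus_commute[OF assms] assms by (simp add: nrm_eq H1.diff_mem)

lemma H1_norm_cnj:
  assumes "v \<in> H1 \<Omega>"
  shows "H1_norm \<Omega> (cnj_fun v) = H1_norm \<Omega> v"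
proof -
  have "ennreal ((H1_norm \<Omega> (cnj_fun v))\<^sup>2) = ennreal ((H1_norm \<Omega> v)\<^sup>2)"
    using H1_norm_sq_nn[OF H1_cnj[OF assms]] H1_norm_sq_nn[OF assms AE_I2[OF refl]]
    by (simp add: norm_vec_cnj cnj_fun_def)
  then show ?thesis using H1_norm_ge by (simp add: power2_eq_iff_nonneg)
qed

theorem H1_complete:
  assumes s: "\<And>k. s k \<in> H1 \<Omega>"
    and cauchy: "\<And>\<epsilon>. 0 < \<epsilon> \<Longrightarrow> \<exists>N. \<forall>m\<ge>N. \<forall>n\<ge>N. H1_norm \<Omega> (\<lambda>x. s m x - s n x) < \<epsilon>"
  shows "\<exists>v\<in>H1 \<Omega>. (\<lambda>k. H1_norm \<Omega> (\<lambda>x. s k x - v x)) \<longlonglongrightarrow> 0"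
proof -
  let ?G = "weak_gradient \<Omega>"
  have nn: "ennreal ((H1_norm \<Omega> (\<lambda>x. s m x - s n x))\<^sup>2) = (\<integral>\<^sup>+x. ennreal ((norm (s m x - s n x))\<^sup>2) \<partial>M)
      + (\<integral>\<^sup>+x. ennreal ((norm (?G (s m) x - ?G (s n) x))\<^sup>2) \<partial>M)" for m n
  proof -
    have "AE x in M. ?G (\<lambda>x. s m x - s n x) x = ?G (s m) x - ?G (s n) x"
      using H1_lin(2)[OF s[of m] s[of n], of 1 "-1"] by (rule eventually_mono) (simp add: vec_eq_iff)
    from H1_norm_sq_nn[OF H1.diff_mem[OF s s] this] show ?thesis .
  qed
  have small: "\<exists>N. \<forall>m\<ge>N. \<forall>n\<ge>N. ennreal ((H1_norm \<Omega> (\<lambda>x. s m x - s n x))\<^sup>2) \<le> ennreal \<epsilon>" if "0 < \<epsilon>" for \<epsilon>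
  proof -
    obtain N where N: "\<And>m n. N \<le> m \<Longrightarrow> N \<le> n \<Longrightarrow> H1_norm \<Omega> (\<lambda>x. s m x - s n x) < sqrt \<epsilon>"
      using cauchy[of "sqrt \<epsilon>"] \<open>0 < \<epsilon>\<close> by auto
    have "(H1_norm \<Omega> (\<lambda>x. s m x - s n x))\<^sup>2 \<le> \<epsilon>" if "N \<le> m" "N \<le> n" for m n
      using power_mono[OF less_imp_le[OF N[OF that]] H1_norm_ge, of 2] \<open>0 < \<epsilon>\<close> by simp
    then show ?thesis by (auto intro: ennreal_leI)
  qed
  have "\<exists>t\<in>borel_measurable M. (\<lambda>k. \<integral>\<^sup>+x. ennreal ((norm (s k x - t x))\<^sup>2) \<partial>M) \<longlonglongrightarrow> 0"
  proof (rule riesz_fischer)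
    show "s k \<in> borel_measurable M" for k using H1_L2[OF s] by (rule L2D)
    show "\<exists>N. \<forall>m\<ge>N. \<forall>n\<ge>N. (\<integral>\<^sup>+x. ennreal ((norm (s m x - s n x))\<^sup>2) \<partial>M) \<le> ennreal \<epsilon>" if "0 < \<epsilon>" for \<epsilon>
      using small[OF that] unfolding nn by (blast dest: ennreal_add_leD(1))
  qed
  then obtain v where v: "v \<in> borel_measurable M" and v_lim: "(\<lambda>k. \<integral>\<^sup>+x. ennreal ((norm (s k x - v x))\<^sup>2) \<partial>M) \<longlonglongrightarrow> 0"
    by blast
  have "\<exists>t\<in>borel_measurable M. (\<lambda>k. \<integral>\<^sup>+x. ennreal ((norm (?G (s k) x - t x))\<^sup>2) \<partial>M) \<longlonglongrightarrow> 0"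
  proof (rule riesz_fischer)
    show "?G (s k) \<in> borel_measurable M" for k using H1_weak_gradient(1)[OF s] by (rule L2D)
    show "\<exists>N. \<forall>m\<ge>N. \<forall>n\<ge>N. (\<integral>\<^sup>+x. ennreal ((norm (?G (s m) x - ?G (s n) x))\<^sup>2) \<partial>M) \<le> ennreal \<epsilon>" if "0 < \<epsilon>" for \<epsilon>
      using small[OF that] unfolding nn by (blast dest: ennreal_add_leD(2))
  qed
  then obtain g where g: "g \<in> borel_measurable M" and g_lim: "(\<lambda>k. \<integral>\<^sup>+x. ennreal ((norm (?G (s k) x - g x))\<^sup>2) \<partial>M) \<longlonglongrightarrow> 0"
    by blast
  have vL: "v \<in> L2 \<Omega>" using H1_L2[OF s] v v_lim by (rule L2_limit)
  have gL: "g \<in> L2 \<Omega>" using H1_weak_gradient(1)[OF s] g g_lim by (rule L2_limit)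
  have wg: "has_weak_gradient \<Omega> v g"
    unfolding has_weak_gradient_def
  proof (intro ballI allI)
    fix \<phi> i assume \<phi>: "\<phi> \<in> test_functions \<Omega>"
    have g_lim_i: "(\<lambda>k. \<integral>\<^sup>+x. ennreal ((norm (?G (s k) x $ i - g x $ i))\<^sup>2) \<partial>M) \<longlonglongrightarrow> 0"
    proof (rule tendsto_sandwich[OF always_eventually always_eventually tendsto_const g_lim])
      show "\<forall>k. (\<integral>\<^sup>+x. ennreal ((norm (?G (s k) x $ i - g x $ i))\<^sup>2) \<partial>M) \<le> (\<integral>\<^sup>+x. ennreal ((norm (?G (s k) x - g x))\<^sup>2) \<partial>M)"
        by (intro allI nn_integral_mono ennreal_leI power_mono)
          (simp_all add: Finite_Cartesian_Product.norm_nth_le flip: vector_minus_component)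
    qed simp
    have "(\<lambda>k. LINT x|M. s k x * partial_deriv i \<phi> x) \<longlonglongrightarrow> (LINT x|M. v x * partial_deriv i \<phi> x)"
      using H1_L2[OF s] vL test_function_L2[OF test_functions_partial_deriv[OF \<phi>]] v_lim by (rule L2_pairing_tendsto)
    moreover have "(\<lambda>k. LINT x|M. ?G (s k) x $ i * \<phi> x) \<longlonglongrightarrow> (LINT x|M. g x $ i * \<phi> x)"
      using L2_component[OF H1_weak_gradient(1)[OF s]] L2_component[OF gL] test_function_L2[OF \<phi>] g_lim_i
      by (rule L2_pairing_tendsto)
    then have "(\<lambda>k. LINT x|M. s k x * partial_deriv i \<phi> x) \<longlonglongrightarrow> - (LINT x|M. g x $ i * \<phi> x)"
      unfolding has_weak_gradientD[OF H1_weak_gradient(2)[OF s] \<phi>] by (rule tendsto_minus)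
    ultimately show "(LINT x|M. v x * partial_deriv i \<phi> x) = - (LINT x|M. g x $ i * \<phi> x)"
      by (rule LIMSEQ_unique)
  qed
  note vH = H1I[OF vL gL wg]
  have eq: "ennreal ((H1_norm \<Omega> (\<lambda>x. s k x - v x))\<^sup>2) = (\<integral>\<^sup>+x. ennreal ((norm (s k x - v x))\<^sup>2) \<partial>M)
      + (\<integral>\<^sup>+x. ennreal ((norm (?G (s k) x - g x))\<^sup>2) \<partial>M)" for k
  proof -
    have "AE x in M. ?G (\<lambda>x. s k x - v x) x = ?G (s k) x - g x"
      using H1_lin(2)[OF s[of k] vH(1), of 1 "-1"] vH(2) by eventually_elim (simp add: vec_eq_iff)
    from H1_norm_sq_nn[OF H1.diff_mem[OF s vH(1)] this] show ?thesis .
  qed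
  have "(\<lambda>k. ennreal ((H1_norm \<Omega> (\<lambda>x. s k x - v x))\<^sup>2)) \<longlonglongrightarrow> ennreal 0"
    unfolding eq using tendsto_add[OF v_lim g_lim] by simp
  then have "(\<lambda>k. (H1_norm \<Omega> (\<lambda>x. s k x - v x))\<^sup>2) \<longlonglongrightarrow> 0" by (rule tendsto_ennrealD) auto
  from tendsto_real_sqrt[OF this]
  have "(\<lambda>k. H1_norm \<Omega> (\<lambda>x. s k x - v x)) \<longlonglongrightarrow> 0" using H1_norm_ge by simp
  then show ?thesis using vH(1) by blast
qed

end

section \<open>Existence of traces\<close>

context sobolev_domain begin

lemma has_traceD:
  assumes "has_trace \<Omega> S v t"
  shows "v \<in> H1 \<Omega>" "t \<in> borel_measurable borel"
  using assms by (simp_all add: has_trace_def)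

lemma has_traceE:
  assumes "has_trace \<Omega> S v t"
  obtains \<phi> where "\<forall>k :: nat. \<phi> k \<in> test_functions UNIV" "(\<lambda>k. H1_norm \<Omega> (\<lambda>x. \<phi> k x - v x)) \<longlonglongrightarrow> 0"
    "\<forall>R. (\<lambda>k. \<integral>\<^sup>+x\<in>S \<inter> cball 0 R. ennreal ((norm (\<phi> k x - t x))\<^sup>2) \<partial>surface_measure) \<longlonglongrightarrow> 0"
  using assms unfolding has_trace_def by blast

lemma has_traceI:
  assumes "v \<in> H1 \<Omega>" "t \<in> borel_measurable borel" "\<And>k :: nat. \<phi> k \<in> test_functions UNIV"
    "(\<lambda>k. H1_norm \<Omega> (\<lambda>x. \<phi> k x - v x)) \<longlonglongrightarrow> 0"
    "\<And>R. (\<lambda>k. \<integral>\<^sup>+x\<in>S \<inter> cball 0 R. ennreal ((norm (\<phi> k x - t x))\<^sup>2) \<partial>surface_measure) \<longlonglongrightarrow> 0"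
  shows "has_trace \<Omega> S v t"
  using assms unfolding has_trace_def by blast

lemma test_function_borel:
  assumes "\<phi> \<in> test_functions U"
  shows "\<phi> \<in> borel_measurable borel"
  using test_functionsD(2)[OF assms] by (rule borel_measurable_continuous_onI)

lemma H1_norm_zero: "H1_norm \<Omega> (\<lambda>x. 0) = 0"
  using H1_norm_lin[OF zero_H1 zero_H1, of 0 0] H1_norm_ge[of "\<lambda>x. 0"] by simp

lemma has_trace_zero: "has_trace \<Omega> S (\<lambda>x. 0) (\<lambda>x. 0)"
  by (rule has_traceI[where \<phi> = "\<lambda>k x. 0"]) (auto simp: zero_H1 test_functions_zero H1_norm_zero)

lemma has_trace_lin:
  assumes S [measurable]: "S \<in> sets borel" and us: "has_trace \<Omega> S u s" and vt: "has_trace \<Omega> S v t"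
  shows "has_trace \<Omega> S (\<lambda>x. a * u x + b * v x) (\<lambda>x. a * s x + b * t x)"
proof -
  obtain \<phi> where \<phi>': "\<forall>k :: nat. \<phi> k \<in> test_functions UNIV" "(\<lambda>k. H1_norm \<Omega> (\<lambda>x. \<phi> k x - u x)) \<longlonglongrightarrow> 0"
    "\<forall>R. (\<lambda>k. \<integral>\<^sup>+x\<in>S \<inter> cball 0 R. ennreal ((norm (\<phi> k x - s x))\<^sup>2) \<partial>surface_measure) \<longlonglongrightarrow> 0"
    using us by (rule has_traceE)
  note \<phi> = \<phi>'[rule_format]
  obtain \<psi> where \<psi>': "\<forall>k :: nat. \<psi> k \<in> test_functions UNIV" "(\<lambda>k. H1_norm \<Omega> (\<lambda>x. \<psi> k x - v x)) \<longlonglongrightarrow> 0"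
    "\<forall>R. (\<lambda>k. \<integral>\<^sup>+x\<in>S \<inter> cball 0 R. ennreal ((norm (\<psi> k x - t x))\<^sup>2) \<partial>surface_measure) \<longlonglongrightarrow> 0"
    using vt by (rule has_traceE)
  note \<psi> = \<psi>'[rule_format]
  note u = has_traceD[OF us] and v = has_traceD[OF vt]
  note [measurable] = u(2) v(2) test_function_borel[OF \<phi>(1)] test_function_borel[OF \<psi>(1)]
  show ?thesis
  proof (rule has_traceI[where \<phi> = "\<lambda>k x. a * \<phi> k x + b * \<psi> k x"])
    show "(\<lambda>x. a * u x + b * v x) \<in> H1 \<Omega>" using u v by (intro H1_lin)
    show "(\<lambda>x. a * s x + b * t x) \<in> borel_measurable borel" by measurable
    show "(\<lambda>x. a * \<phi> k x + b * \<psi> k x) \<in> test_functions UNIV" for k using \<phi> \<psi> by (intro test_functions_lin)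
    have lim: "(\<lambda>k. norm a * H1_norm \<Omega> (\<lambda>x. \<phi> k x - u x) + norm b * H1_norm \<Omega> (\<lambda>x. \<psi> k x - v x)) \<longlonglongrightarrow> 0"
      using tendsto_add[OF tendsto_mult_left[OF \<phi>(2), of "norm a"] tendsto_mult_left[OF \<psi>(2), of "norm b"]] by simp
    show "(\<lambda>k. H1_norm \<Omega> (\<lambda>x. a * \<phi> k x + b * \<psi> k x - (a * u x + b * v x))) \<longlonglongrightarrow> 0"
    proof (rule tendsto_sandwich[OF always_eventually always_eventually tendsto_const lim]; intro allI)
      fix k
      have "(\<lambda>x. a * \<phi> k x + b * \<psi> k x - (a * u x + b * v x)) = (\<lambda>x. a * (\<phi> k x - u x) + b * (\<psi> k x - v x))"
        by (simp add: algebra_simps)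
      then show "H1_norm \<Omega> (\<lambda>x. a * \<phi> k x + b * \<psi> k x - (a * u x + b * v x))
          \<le> norm a * H1_norm \<Omega> (\<lambda>x. \<phi> k x - u x) + norm b * H1_norm \<Omega> (\<lambda>x. \<psi> k x - v x)"
        using H1_norm_lin[OF H1.diff_mem[OF test_function_H1(1)[OF \<phi>(1)] u(1)] H1.diff_mem[OF test_function_H1(1)[OF \<psi>(1)] v(1)]]
        by simp
    qed (rule H1_norm_ge)
    fix R
    have lim: "(\<lambda>k. ennreal (2 * (norm a)\<^sup>2) * (\<integral>\<^sup>+x\<in>S \<inter> cball 0 R. ennreal ((norm (\<phi> k x - s x))\<^sup>2) \<partial>surface_measure)
      + ennreal (2 * (norm b)\<^sup>2) * (\<integral>\<^sup>+x\<in>S \<inter> cball 0 R. ennreal ((norm (\<psi> k x - t x))\<^sup>2) \<partial>surface_measure)) \<longlonglongrightarrow> 0"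
      using tendsto_add[OF ennreal_tendsto_cmult[OF _ \<phi>(3)] ennreal_tendsto_cmult[OF _ \<psi>(3)],
          of "ennreal (2 * (norm a)\<^sup>2)" "ennreal (2 * (norm b)\<^sup>2)" R R] by simp
    show "(\<lambda>k. \<integral>\<^sup>+x\<in>S \<inter> cball 0 R. ennreal ((norm (a * \<phi> k x + b * \<psi> k x - (a * s x + b * t x)))\<^sup>2) \<partial>surface_measure) \<longlonglongrightarrow> 0"
      by (rule tendsto_sandwich[OF always_eventually always_eventually tendsto_const lim])
        (auto intro!: nn_integral_lin_sq_le)
  qed
qed

lemma has_trace_cnj:
  assumes vt: "has_trace \<Omega> S v t"
  shows "has_trace \<Omega> S (cnj_fun v) (cnj_fun t)"
proof -
  obtain \<phi> where \<phi>': "\<forall>k :: nat. \<phi> k \<in> test_functions UNIV" "(\<lambda>k. H1_norm \<Omega> (\<lambda>x. \<phi> k x - v x)) \<longlonglongrightarrow> 0"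
    "\<forall>R. (\<lambda>k. \<integral>\<^sup>+x\<in>S \<inter> cball 0 R. ennreal ((norm (\<phi> k x - t x))\<^sup>2) \<partial>surface_measure) \<longlonglongrightarrow> 0"
    using vt by (rule has_traceE)
  note \<phi> = \<phi>'[rule_format]
  note v = has_traceD[OF vt]
  show ?thesis
  proof (rule has_traceI[where \<phi> = "\<lambda>k. cnj_fun (\<phi> k)"])
    show "cnj_fun v \<in> H1 \<Omega>" using v(1) by (rule H1_cnj)
    show "cnj_fun t \<in> borel_measurable borel"
      unfolding cnj_fun_def using v(2) by (intro borel_measurable_continuous_on[of cnj] continuous_intros)
    show "cnj_fun (\<phi> k) \<in> test_functions UNIV" for k using \<phi>(1) by (rule test_functions_cnj)
    have "H1_norm \<Omega> (\<lambda>x. cnj_fun (\<phi> k) x - cnj_fun v x) = H1_norm \<Omega> (\<lambda>x. \<phi> k x - v x)" for k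
      using H1_norm_cnj[OF H1.diff_mem[OF test_function_H1(1)[OF \<phi>(1)] v(1)], of k] by (simp add: cnj_fun_def)
    then show "(\<lambda>k. H1_norm \<Omega> (\<lambda>x. cnj_fun (\<phi> k) x - cnj_fun v x)) \<longlonglongrightarrow> 0" using \<phi>(2) by simp
    have "norm (cnj_fun (\<phi> k) x - cnj_fun t x) = norm (\<phi> k x - t x)" for k x
      unfolding cnj_fun_def complex_cnj_diff[symmetric] complex_mod_cnj ..
    then show "(\<lambda>k. \<integral>\<^sup>+x\<in>S \<inter> cball 0 R. ennreal ((norm (cnj_fun (\<phi> k) x - cnj_fun t x))\<^sup>2) \<partial>surface_measure) \<longlonglongrightarrow> 0" for R
      using \<phi>(3) by simp
  qed
qed

lemma has_trace_cong_AE: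
  assumes vt: "has_trace \<Omega> S v t" and f: "f \<in> borel_measurable borel"
    and eq: "AE x in surface_measure. x \<in> S \<longrightarrow> t x = f x"
  shows "has_trace \<Omega> S v f"
proof -
  obtain \<phi> where \<phi>': "\<forall>k :: nat. \<phi> k \<in> test_functions UNIV" "(\<lambda>k. H1_norm \<Omega> (\<lambda>x. \<phi> k x - v x)) \<longlonglongrightarrow> 0"
    "\<forall>R. (\<lambda>k. \<integral>\<^sup>+x\<in>S \<inter> cball 0 R. ennreal ((norm (\<phi> k x - t x))\<^sup>2) \<partial>surface_measure) \<longlonglongrightarrow> 0"
    using vt by (rule has_traceE)
  note \<phi> = \<phi>'[rule_format]
  have "(\<integral>\<^sup>+x\<in>S \<inter> cball 0 R. ennreal ((norm (\<phi> k x - f x))\<^sup>2) \<partial>surface_measure)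
      = (\<integral>\<^sup>+x\<in>S \<inter> cball 0 R. ennreal ((norm (\<phi> k x - t x))\<^sup>2) \<partial>surface_measure)" for k R
    by (rule nn_integral_cong_AE, rule eventually_mono[OF eq]) (auto simp: indicator_def)
  with \<phi> show ?thesis using has_traceD[OF vt] f by (intro has_traceI[where \<phi> = \<phi>]) auto
qed

lemma test_function_trace_bound:
  assumes dim: "2 \<le> CARD('n)" and S0: "lipschitz_set S0" "S0 \<subseteq> \<Omega>" and S: "S \<subseteq> frontier S0"
  shows "\<exists>C\<ge>0. \<forall>\<phi>\<in>test_functions UNIV.
    (\<integral>\<^sup>+x\<in>S \<inter> cball 0 R. ennreal ((norm (\<phi> x))\<^sup>2) \<partial>surface_measure) \<le> ennreal (C * (H1_norm \<Omega> \<phi>)\<^sup>2)"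
proof -
  from trace_inequality[OF dim S0(1), of R] obtain C where C: "0 \<le> C" and
    le: "\<forall>\<phi>. Ck 1 \<phi> \<longrightarrow> (\<integral>\<^sup>+z\<in>frontier S0 \<inter> cball 0 R. ennreal ((norm (\<phi> z))\<^sup>2) \<partial>surface_measure)
      \<le> ennreal C * (\<integral>\<^sup>+y\<in>S0. ennreal ((norm (\<phi> y))\<^sup>2 + (norm (classical_gradient \<phi> y))\<^sup>2) \<partial>lborel)"
    by (elim exE conjE)
  show ?thesis
  proof (rule exI[of _ C], rule conjI[OF C], rule ballI)
    fix \<phi> :: "real ^ 'n \<Rightarrow> complex" assume \<phi>: "\<phi> \<in> test_functions UNIV"
    let ?u = "\<lambda>y. ennreal ((norm (\<phi> y))\<^sup>2 + (norm (classical_gradient \<phi> y))\<^sup>2)"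
    note L = L2D[OF test_function_L2[OF \<phi>]] L2D[OF test_function_gradient_L2[OF \<phi>]]
    have "(\<integral>\<^sup>+x\<in>S \<inter> cball 0 R. ennreal ((norm (\<phi> x))\<^sup>2) \<partial>surface_measure)
        \<le> (\<integral>\<^sup>+x\<in>frontier S0 \<inter> cball 0 R. ennreal ((norm (\<phi> x))\<^sup>2) \<partial>surface_measure)"
      using S by (intro nn_integral_mono) (auto simp: indicator_def)
    also have "\<dots> \<le> ennreal C * (\<integral>\<^sup>+y\<in>S0. ?u y \<partial>lborel)"
      by (rule le[rule_format, OF test_functionsD(1)[OF \<phi>]])
    also have "(\<integral>\<^sup>+y\<in>S0. ?u y \<partial>lborel) \<le> (\<integral>\<^sup>+y\<in>\<Omega>. ?u y \<partial>lborel)"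
      using S0(2) by (intro nn_integral_mono) (auto simp: indicator_def)
    also have "(\<integral>\<^sup>+y\<in>\<Omega>. ?u y \<partial>lborel) = (\<integral>\<^sup>+y. ?u y \<partial>M)"
      by (simp add: nn_integral_restrict_space nn_integral_completion)
    also have "\<dots> = (\<integral>\<^sup>+y. ennreal ((norm (\<phi> y))\<^sup>2) + ennreal ((norm (classical_gradient \<phi> y))\<^sup>2) \<partial>M)" by simp
    also have "\<dots> = (\<integral>\<^sup>+y. ennreal ((norm (\<phi> y))\<^sup>2) \<partial>M) + (\<integral>\<^sup>+y. ennreal ((norm (classical_gradient \<phi> y))\<^sup>2) \<partial>M)"
      using L(2,4)[THEN borel_measurable_integrable] by (intro nn_integral_add) auto
    also have "\<dots> = ennreal ((H1_norm \<Omega> \<phi>)\<^sup>2)"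
      using H1_norm_sq_nn[OF test_function_H1[OF \<phi>]] by simp
    finally show "(\<integral>\<^sup>+x\<in>S \<inter> cball 0 R. ennreal ((norm (\<phi> x))\<^sup>2) \<partial>surface_measure) \<le> ennreal (C * (H1_norm \<Omega> \<phi>)\<^sup>2)"
      using C by (simp add: ennreal_mult' mult_left_mono)
  qed
qed

theorem trace_exists:
  assumes dim: "2 \<le> CARD('n)" and S0: "lipschitz_set S0" "S0 \<subseteq> \<Omega>" and S: "S \<subseteq> frontier S0"
    and Sb [measurable]: "S \<in> sets borel" and v: "v \<in> H1 \<Omega>"
    and \<phi>: "\<And>k :: nat. \<phi> k \<in> test_functions UNIV" and lim: "(\<lambda>k. H1_norm \<Omega> (\<lambda>x. \<phi> k x - v x)) \<longlonglongrightarrow> 0"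
  shows "\<exists>t. has_trace \<Omega> S v t"
proof -
  have \<phi>H: "\<phi> k \<in> H1 \<Omega>" for k using \<phi> by (rule test_function_H1)
  have "\<exists>t\<in>borel_measurable surface_measure. \<forall>R :: nat. (\<lambda>k. \<integral>\<^sup>+x\<in>S \<inter> cball 0 (real R). ennreal ((norm (\<phi> k x - t x))\<^sup>2) \<partial>surface_measure) \<longlonglongrightarrow> 0"
  proof (rule riesz_fischer_local)
    show "\<phi> k \<in> borel_measurable surface_measure" for k using test_function_borel[OF \<phi>] by simp
    show "S \<inter> cball 0 (real R) \<in> sets surface_measure" for R by simp
    show "incseq (\<lambda>R. S \<inter> cball 0 (real R))" by (auto simp: incseq_def)
    fix R :: nat and \<epsilon> :: real assume \<epsilon>: "0 < \<epsilon>"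
    from test_function_trace_bound[OF dim S0 S, of "real R"] obtain C where C: "0 \<le> C" and
      le: "\<forall>\<phi>\<in>test_functions UNIV. (\<integral>\<^sup>+x\<in>S \<inter> cball 0 (real R). ennreal ((norm (\<phi> x))\<^sup>2) \<partial>surface_measure) \<le> ennreal (C * (H1_norm \<Omega> \<phi>)\<^sup>2)"
      by (elim exE conjE)
    define \<delta> where "\<delta> = sqrt (\<epsilon> / (C + 1))"
    have \<delta>: "0 < \<delta>" "C * \<delta>\<^sup>2 \<le> \<epsilon>"
    proof -
      show "0 < \<delta>" using \<epsilon> C by (simp add: \<delta>_def)
      have "C * \<delta>\<^sup>2 = \<epsilon> * (C / (C + 1))" using \<epsilon> C by (simp add: \<delta>_def)
      also have "\<dots> \<le> \<epsilon> * 1" using \<epsilon> C by (intro mult_left_mono) auto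
      finally show "C * \<delta>\<^sup>2 \<le> \<epsilon>" by simp
    qed
    obtain N where N: "\<And>k. N \<le> k \<Longrightarrow> H1_norm \<Omega> (\<lambda>x. \<phi> k x - v x) < \<delta> / 2"
      using order_tendstoD(2)[OF lim, of "\<delta> / 2"] \<delta>(1) by (auto simp: eventually_sequentially)
    have "(\<integral>\<^sup>+x\<in>S \<inter> cball 0 (real R). ennreal ((norm (\<phi> m x - \<phi> n x))\<^sup>2) \<partial>surface_measure) \<le> ennreal \<epsilon>"
      if "N \<le> m" "N \<le> n" for m n
    proof -
      have d: "(\<lambda>x. \<phi> m x - \<phi> n x) \<in> test_functions UNIV"
        using test_functions_lin[OF \<phi>[of m] \<phi>[of n], of 1 "-1"] by simp
      have "H1_norm \<Omega> (\<lambda>x. \<phi> m x - \<phi> n x) \<le> H1_norm \<Omega> (\<lambda>x. \<phi> m x - v x) + H1_norm \<Omega> (\<lambda>x. v x - \<phi> n x)"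
        using \<phi>H v by (intro H1_norm_triangle)
      also have "H1_norm \<Omega> (\<lambda>x. v x - \<phi> n x) = H1_norm \<Omega> (\<lambda>x. \<phi> n x - v x)"
        using \<phi>H v by (intro H1_norm_minus_commute)
      finally have "H1_norm \<Omega> (\<lambda>x. \<phi> m x - \<phi> n x) \<le> \<delta>" using N[OF that(1)] N[OF that(2)] by linarith
      then have "C * (H1_norm \<Omega> (\<lambda>x. \<phi> m x - \<phi> n x))\<^sup>2 \<le> C * \<delta>\<^sup>2"
        using C H1_norm_ge by (intro mult_left_mono power_mono) auto
      then show ?thesis using le[rule_format, OF d] \<delta>(2) by (meson ennreal_leI order_trans)
    qed
    then show "\<exists>N. \<forall>m\<ge>N. \<forall>n\<ge>N. (\<integral>\<^sup>+x\<in>S \<inter> cball 0 (real R). ennreal ((norm (\<phi> m x - \<phi> n x))\<^sup>2) \<partial>surface_measure) \<le> ennreal \<epsilon>"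
      by blast
  qed
  then obtain t where t: "t \<in> borel_measurable surface_measure"
    and t_lim: "\<And>R :: nat. (\<lambda>k. \<integral>\<^sup>+x\<in>S \<inter> cball 0 (real R). ennreal ((norm (\<phi> k x - t x))\<^sup>2) \<partial>surface_measure) \<longlonglongrightarrow> 0"
    by blast
  have "has_trace \<Omega> S v t"
  proof (rule has_traceI[where \<phi> = \<phi>])
    show "t \<in> borel_measurable borel" using t by simp
    fix R
    obtain N :: nat where N: "R \<le> real N" using real_arch_simple by blast
    show "(\<lambda>k. \<integral>\<^sup>+x\<in>S \<inter> cball 0 R. ennreal ((norm (\<phi> k x - t x))\<^sup>2) \<partial>surface_measure) \<longlonglongrightarrow> 0"
      by (rule tendsto_sandwich[OF always_eventually always_eventually tendsto_const t_lim[of N]])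
        (use N in \<open>auto intro!: nn_integral_mono simp: indicator_def\<close>)
  qed (rule v \<phi> lim)+
  then show ?thesis by blast
qed

end

locale sobolev_dirichlet = sobolev_domain \<Omega> for \<Omega> :: "(real ^ 'n) set" +
  fixes \<Gamma>D :: "(real ^ 'n) set"
  assumes borel_\<Gamma>D [measurable]: "\<Gamma>D \<in> sets borel"
begin

lemma H1D_H1: "v \<in> H1D \<Omega> \<Gamma>D \<Longrightarrow> v \<in> H1 \<Omega>"
  by (simp add: H1D_def)

lemma H1D_lin:
  assumes "u \<in> H1D \<Omega> \<Gamma>D" "v \<in> H1D \<Omega> \<Gamma>D"
  shows "(\<lambda>x. a * u x + b * v x) \<in> H1D \<Omega> \<Gamma>D"
  using has_trace_lin[OF borel_\<Gamma>D, of u "\<lambda>x. 0" v "\<lambda>x. 0" a b] assms H1_lin(1)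
  by (simp add: H1D_def)

lemma H1D_cnj: "v \<in> H1D \<Omega> \<Gamma>D \<Longrightarrow> cnj_fun v \<in> H1D \<Omega> \<Gamma>D"
  using has_trace_cnj[of \<Gamma>D v "\<lambda>x. 0"] H1_cnj(1) by (simp add: H1D_def cnj_fun_def)

lemma H1D_closed:
  assumes s: "\<And>k :: nat. s k \<in> H1D \<Omega> \<Gamma>D" and v: "v \<in> H1 \<Omega>" and lim: "(\<lambda>k. H1_norm \<Omega> (\<lambda>x. s k x - v x)) \<longlonglongrightarrow> 0"
  shows "v \<in> H1D \<Omega> \<Gamma>D"
proof -
  have "\<forall>k. \<exists>\<phi>. \<phi> \<in> test_functions UNIV \<and> H1_norm \<Omega> (\<lambda>x. \<phi> x - s k x) < 1 / real (Suc k) \<and>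
      (\<integral>\<^sup>+x\<in>\<Gamma>D \<inter> cball 0 (real k). ennreal ((norm (\<phi> x))\<^sup>2) \<partial>surface_measure) < ennreal (1 / real (Suc k))"
  proof
    fix k
    have "has_trace \<Omega> \<Gamma>D (s k) (\<lambda>x. 0)" using s by (simp add: H1D_def)
    then obtain \<phi> where \<phi>': "\<forall>j :: nat. \<phi> j \<in> test_functions UNIV" "(\<lambda>j. H1_norm \<Omega> (\<lambda>x. \<phi> j x - s k x)) \<longlonglongrightarrow> 0"
      "\<forall>R. (\<lambda>j. \<integral>\<^sup>+x\<in>\<Gamma>D \<inter> cball 0 R. ennreal ((norm (\<phi> j x - 0))\<^sup>2) \<partial>surface_measure) \<longlonglongrightarrow> 0"
      by (rule has_traceE)
    note \<phi> = \<phi>'[rule_format]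
    have "\<forall>\<^sub>F j in sequentially. H1_norm \<Omega> (\<lambda>x. \<phi> j x - s k x) < 1 / real (Suc k) \<and>
        (\<integral>\<^sup>+x\<in>\<Gamma>D \<inter> cball 0 (real k). ennreal ((norm (\<phi> j x - 0))\<^sup>2) \<partial>surface_measure) < ennreal (1 / real (Suc k))"
      by (intro eventually_conj order_tendstoD(2)[OF \<phi>(2)] order_tendstoD(2)[OF \<phi>(3)]) auto
    then obtain j where "H1_norm \<Omega> (\<lambda>x. \<phi> j x - s k x) < 1 / real (Suc k)"
        "(\<integral>\<^sup>+x\<in>\<Gamma>D \<inter> cball 0 (real k). ennreal ((norm (\<phi> j x - 0))\<^sup>2) \<partial>surface_measure) < ennreal (1 / real (Suc k))"
      by (auto simp: eventually_sequentially)
    then show "\<exists>\<phi>. \<phi> \<in> test_functions UNIV \<and> H1_norm \<Omega> (\<lambda>x. \<phi> x - s k x) < 1 / real (Suc k) \<and>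
      (\<integral>\<^sup>+x\<in>\<Gamma>D \<inter> cball 0 (real k). ennreal ((norm (\<phi> x))\<^sup>2) \<partial>surface_measure) < ennreal (1 / real (Suc k))"
      using \<phi>(1)[of j] by auto
  qed
  from choice[OF this] obtain \<phi> where
    "\<forall>k. \<phi> k \<in> test_functions UNIV \<and> H1_norm \<Omega> (\<lambda>x. \<phi> k x - s k x) < 1 / real (Suc k) \<and>
      (\<integral>\<^sup>+x\<in>\<Gamma>D \<inter> cball 0 (real k). ennreal ((norm (\<phi> k x))\<^sup>2) \<partial>surface_measure) < ennreal (1 / real (Suc k))"
    by (elim exE)
  then have \<phi>: "\<phi> k \<in> test_functions UNIV" "H1_norm \<Omega> (\<lambda>x. \<phi> k x - s k x) < 1 / real (Suc k)"
      "(\<integral>\<^sup>+x\<in>\<Gamma>D \<inter> cball 0 (real k). ennreal ((norm (\<phi> k x))\<^sup>2) \<partial>surface_measure) < ennreal (1 / real (Suc k))" for k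
    by simp_all
  have inv: "(\<lambda>k. 1 / real (Suc k)) \<longlonglongrightarrow> 0"
    using LIMSEQ_inverse_real_of_nat by (simp add: inverse_eq_divide)
  have "has_trace \<Omega> \<Gamma>D v (\<lambda>x. 0)"
  proof (rule has_traceI[where \<phi> = \<phi>])
    have lim': "(\<lambda>k. 1 / real (Suc k) + H1_norm \<Omega> (\<lambda>x. s k x - v x)) \<longlonglongrightarrow> 0"
      using tendsto_add[OF inv lim] by simp
    show "(\<lambda>k. H1_norm \<Omega> (\<lambda>x. \<phi> k x - v x)) \<longlonglongrightarrow> 0"
    proof (rule tendsto_sandwich[OF always_eventually always_eventually tendsto_const lim']; intro allI)
      fix k
      show "H1_norm \<Omega> (\<lambda>x. \<phi> k x - v x) \<le> 1 / real (Suc k) + H1_norm \<Omega> (\<lambda>x. s k x - v x)"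
        using H1_norm_triangle[OF test_function_H1(1)[OF \<phi>(1)] H1D_H1[OF s] v, of k k] \<phi>(2)[of k] by linarith
    qed (rule H1_norm_ge)
    fix R
    obtain N :: nat where N: "R \<le> real N" using real_arch_simple by blast
    have inv': "(\<lambda>k. ennreal (1 / real (Suc k))) \<longlonglongrightarrow> 0" using tendsto_ennrealI[OF inv] by simp
    show "(\<lambda>k. \<integral>\<^sup>+x\<in>\<Gamma>D \<inter> cball 0 R. ennreal ((norm (\<phi> k x - 0))\<^sup>2) \<partial>surface_measure) \<longlonglongrightarrow> 0"
    proof (rule tendsto_sandwich[OF always_eventually _ tendsto_const inv'])
      show "\<forall>\<^sub>F k in sequentially. (\<integral>\<^sup>+x\<in>\<Gamma>D \<inter> cball 0 R. ennreal ((norm (\<phi> k x - 0))\<^sup>2) \<partial>surface_measure) \<le> ennreal (1 / real (Suc k))"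
        using eventually_ge_at_top[of N]
      proof eventually_elim
        fix k assume "N \<le> k"
        then have "R \<le> real k" using N by linarith
        then have "(\<integral>\<^sup>+x\<in>\<Gamma>D \<inter> cball 0 R. ennreal ((norm (\<phi> k x - 0))\<^sup>2) \<partial>surface_measure)
            \<le> (\<integral>\<^sup>+x\<in>\<Gamma>D \<inter> cball 0 (real k). ennreal ((norm (\<phi> k x))\<^sup>2) \<partial>surface_measure)"
          by (intro nn_integral_mono) (auto simp: indicator_def)
        also have "\<dots> \<le> ennreal (1 / real (Suc k))" using \<phi>(3) by (rule less_imp_le)
        finally show "(\<integral>\<^sup>+x\<in>\<Gamma>D \<inter> cball 0 R. ennreal ((norm (\<phi> k x - 0))\<^sup>2) \<partial>surface_measure) \<le> ennreal (1 / real (Suc k))" .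
      qed
    qed simp
  qed (use v \<phi> in auto)
  then show ?thesis using v by (simp add: H1D_def)
qed

sublocale V: semi_hilbert_space "H1D \<Omega> \<Gamma>D" H1_ip
proof
  show "(\<lambda>x. 0) \<in> H1D \<Omega> \<Gamma>D" by (simp add: H1D_def zero_H1 has_trace_zero)
  show "u \<in> H1D \<Omega> \<Gamma>D \<Longrightarrow> v \<in> H1D \<Omega> \<Gamma>D \<Longrightarrow> (\<lambda>x. a * u x + b * v x) \<in> H1D \<Omega> \<Gamma>D" for u v a b by (rule H1D_lin)
  show "H1_ip (\<lambda>x. a * u x + b * v x) w = a * H1_ip u w + b * H1_ip v w"
    if "u \<in> H1D \<Omega> \<Gamma>D" "v \<in> H1D \<Omega> \<Gamma>D" "w \<in> H1D \<Omega> \<Gamma>D" for u v w a b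
    using that by (intro H1.ip_lin H1D_H1)
  show "H1_ip v u = cnj (H1_ip u v)" if "u \<in> H1D \<Omega> \<Gamma>D" "v \<in> H1D \<Omega> \<Gamma>D" for u v
    using that by (intro H1.ip_cnj H1D_H1)
  show "0 \<le> Re (H1_ip v v)" if "v \<in> H1D \<Omega> \<Gamma>D" for v using that by (intro H1.ip_ge H1D_H1)
  fix s :: "nat \<Rightarrow> real ^ 'n \<Rightarrow> complex"
  assume s: "\<And>k. s k \<in> H1D \<Omega> \<Gamma>D" and cauchy: "\<forall>\<epsilon>>0. \<exists>N. \<forall>m\<ge>N. \<forall>n\<ge>N. H1.nrm (\<lambda>x. s m x - s n x) < \<epsilon>"
  have "\<exists>v\<in>H1 \<Omega>. (\<lambda>k. H1_norm \<Omega> (\<lambda>x. s k x - v x)) \<longlonglongrightarrow> 0"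
  proof (rule H1_complete)
    show "s k \<in> H1 \<Omega>" for k using s by (rule H1D_H1)
    then show "\<exists>N. \<forall>m\<ge>N. \<forall>n\<ge>N. H1_norm \<Omega> (\<lambda>x. s m x - s n x) < \<epsilon>" if "0 < \<epsilon>" for \<epsilon>
      using cauchy that by (simp add: nrm_eq H1.diff_mem)
  qed
  then obtain v where v: "v \<in> H1 \<Omega>" "(\<lambda>k. H1_norm \<Omega> (\<lambda>x. s k x - v x)) \<longlonglongrightarrow> 0" by blast
  then have "v \<in> H1D \<Omega> \<Gamma>D" by (rule H1D_closed[OF s])
  then show "\<exists>v\<in>H1D \<Omega> \<Gamma>D. (\<lambda>k. H1.nrm (\<lambda>x. s k x - v x)) \<longlonglongrightarrow> 0"
    using v s by (intro bexI[of _ v]) (simp_all add: nrm_eq H1.diff_mem H1D_H1)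
qed

lemma H1D_trace_exists:
  assumes "2 \<le> CARD('n)" "lipschitz_set S0" "S0 \<subseteq> \<Omega>" "S \<subseteq> frontier S0" "S \<in> sets borel" "v \<in> H1D \<Omega> \<Gamma>D"
  shows "\<exists>t. has_trace \<Omega> S v t"
proof -
  have "has_trace \<Omega> \<Gamma>D v (\<lambda>x. 0)" using assms(6) by (simp add: H1D_def)
  then obtain \<phi> where \<phi>: "\<forall>k :: nat. \<phi> k \<in> test_functions UNIV" "(\<lambda>k. H1_norm \<Omega> (\<lambda>x. \<phi> k x - v x)) \<longlonglongrightarrow> 0"
    by (rule has_traceE)
  show ?thesis by (rule trace_exists[OF assms(1-5) H1D_H1[OF assms(6)] \<phi>(1)[rule_format] \<phi>(2)])
qed

end

section \<open>Trace spaces and their duals\<close>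

lemma cnj_fun_lin: "cnj_fun (\<lambda>x. a * u x + b * v x) = (\<lambda>x. cnj a * cnj_fun u x + cnj b * cnj_fun v x)"
  by (simp add: cnj_fun_def)

locale trace_interface = sobolev_dirichlet \<Omega> \<Gamma>D for \<Omega> \<Gamma>D :: "(real ^ 'n) set" +
  fixes S :: "(real ^ 'n) set"
  assumes borel_S: "S \<in> sets borel"
    and trace_ex: "v \<in> H1D \<Omega> \<Gamma>D \<Longrightarrow> \<exists>t. has_trace \<Omega> S v t"
begin

abbreviation "W \<equiv> trace_space \<Omega> \<Gamma>D S"
abbreviation "N \<equiv> trace_norm \<Omega> \<Gamma>D S"
abbreviation "\<gamma> \<equiv> dirichlet_trace \<Omega> S"
abbreviation "B \<equiv> Hm12 \<Omega> \<Gamma>D S"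
abbreviation "normB \<equiv> Hm12_norm \<Omega> \<Gamma>D S"

lemma has_trace_dirichlet_trace: "v \<in> H1D \<Omega> \<Gamma>D \<Longrightarrow> has_trace \<Omega> S v (\<gamma> v)"
  unfolding dirichlet_trace_def using trace_ex by (rule someI_ex)

lemma trace_mem: "v \<in> H1D \<Omega> \<Gamma>D \<Longrightarrow> has_trace \<Omega> S v t \<Longrightarrow> t \<in> W"
  by (auto simp: trace_space_def)

lemma trace_spaceE:
  assumes "t \<in> W"
  obtains v where "v \<in> H1D \<Omega> \<Gamma>D" "has_trace \<Omega> S v t"
  using assms by (auto simp: trace_space_def)

sublocale W: function_space W
proof
  show "(\<lambda>x. 0) \<in> W" using trace_mem[OF V.zero_mem has_trace_zero] .
  fix s t a b assume "s \<in> W" "t \<in> W"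
  then obtain u v where "u \<in> H1D \<Omega> \<Gamma>D" "has_trace \<Omega> S u s" "v \<in> H1D \<Omega> \<Gamma>D" "has_trace \<Omega> S v t"
    by (auto simp: trace_space_def)
  then show "(\<lambda>x. a * s x + b * t x) \<in> W"
    using has_trace_lin[OF borel_S] by (intro trace_mem[of "\<lambda>x. a * u x + b * v x"] V.lin_mem)
qed

lemma trace_norm_le: "v \<in> H1D \<Omega> \<Gamma>D \<Longrightarrow> has_trace \<Omega> S v t \<Longrightarrow> N t \<le> H1_norm \<Omega> v"
  unfolding trace_norm_def using H1_norm_ge by (intro cInf_lower bdd_belowI[of _ 0]) auto

lemma trace_norm_greatest:
  assumes "t \<in> W" "\<And>v. v \<in> H1D \<Omega> \<Gamma>D \<Longrightarrow> has_trace \<Omega> S v t \<Longrightarrow> c \<le> H1_norm \<Omega> v"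
  shows "c \<le> N t"
  unfolding trace_norm_def using assms by (intro cInf_greatest) (auto simp: trace_space_def)

lemma trace_norm_ge: "t \<in> W \<Longrightarrow> 0 \<le> N t"
  by (rule trace_norm_greatest) (auto simp: H1_norm_ge)

lemma trace_norm_scale:
  assumes t: "t \<in> W" and a: "a \<noteq> 0"
  shows "N (\<lambda>x. a * t x) \<le> norm a * N t"
proof -
  have "N (\<lambda>x. a * t x) / norm a \<le> N t"
  proof (rule trace_norm_greatest[OF t])
    fix v assume v: "v \<in> H1D \<Omega> \<Gamma>D" "has_trace \<Omega> S v t"
    have "N (\<lambda>x. a * t x) \<le> H1_norm \<Omega> (\<lambda>x. a * v x)"
      using has_trace_lin[OF borel_S v(2) v(2), of a 0] v(1) by (intro trace_norm_le V.scale_mem) simp_all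
    also have "\<dots> = norm a * H1_norm \<Omega> v"
      using V.nrm_scale[OF v(1)] H1D_H1[OF v(1)] H1.scale_mem by (simp add: nrm_eq)
    finally show "N (\<lambda>x. a * t x) / norm a \<le> H1_norm \<Omega> v" using a by (simp add: divide_le_eq mult.commute)
  qed
  then show ?thesis using a by (simp add: divide_le_eq mult.commute)
qed

lemma HmD:
  assumes "g \<in> B"
  shows "t \<notin> W \<Longrightarrow> g t = 0"
    and "s \<in> W \<Longrightarrow> t \<in> W \<Longrightarrow> g (\<lambda>x. \<alpha> * s x + \<beta> * t x) = \<alpha> * g s + \<beta> * g t"
    and "\<exists>C. \<forall>t\<in>W. norm (g t) \<le> C * N t"
  using assms unfolding Hm12_def dual_space_def by blast+

lemma dual_bdd_above:
  assumes g: "g \<in> B"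
  shows "bdd_above ((\<lambda>t. norm (g t)) ` {t \<in> W. N t \<le> 1})"
proof -
  obtain C where C: "\<And>t. t \<in> W \<Longrightarrow> norm (g t) \<le> C * N t" using HmD(3)[OF g] by blast
  show ?thesis
  proof (rule bdd_aboveI2)
    fix t assume t: "t \<in> {t \<in> W. N t \<le> 1}"
    then have "norm (g t) \<le> C * N t" using C by auto
    also have "\<dots> \<le> \<bar>C\<bar> * 1" using t trace_norm_ge[of t] by (intro mult_mono) auto
    finally show "norm (g t) \<le> \<bar>C\<bar>" by simp
  qed
qed

lemma dual_apply_le:
  assumes g: "g \<in> B" and t: "t \<in> W"
  shows "norm (g t) \<le> normB g * N t"
proof -
  obtain C where C: "\<And>t. t \<in> W \<Longrightarrow> norm (g t) \<le> C * N t" using HmD(3)[OF g] by blast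
  show ?thesis
  proof (cases "N t = 0")
    case True
    then show ?thesis using C[OF t] by simp
  next
    case False
    then have pos: "0 < N t" using trace_norm_ge[OF t] by simp
    let ?a = "complex_of_real (1 / N t)"
    have "N (\<lambda>x. ?a * t x) \<le> 1" using trace_norm_scale[OF t, of ?a] pos by (simp add: norm_divide)
    then have "norm (g (\<lambda>x. ?a * t x)) \<le> normB g"
      unfolding Hm12_norm_def dual_norm_def using W.scale_mem[OF t, of ?a] by (intro cSUP_upper[OF _ dual_bdd_above[OF g]]) auto
    moreover have "g (\<lambda>x. ?a * t x) = ?a * g t" using HmD(2)[OF g t t, of ?a 0] by simp
    ultimately show ?thesis using pos by (simp add: norm_mult norm_divide divide_le_eq)
  qed
qed

lemma trace_norm_zero: "N (\<lambda>x. 0) \<le> 0"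
  using trace_norm_le[OF V.zero_mem has_trace_zero] H1_norm_zero by simp

lemma dual_norm_le:
  assumes C: "0 \<le> C" and le: "\<And>t. t \<in> W \<Longrightarrow> norm (g t) \<le> C * N t"
  shows "normB g \<le> C"
  unfolding Hm12_norm_def dual_norm_def
proof (rule cSUP_least)
  show "{t \<in> W. N t \<le> 1} \<noteq> {}" using W.zero_mem trace_norm_zero by force
  fix t assume "t \<in> {t \<in> W. N t \<le> 1}"
  then have "norm (g t) \<le> C * N t" "N t \<le> 1" using le by auto
  then show "norm (g t) \<le> C" using mult_left_mono[OF \<open>N t \<le> 1\<close> C] by simp
qed

lemma dual_norm_ge:
  assumes g: "g \<in> B"
  shows "0 \<le> normB g"
proof -
  have "norm (g (\<lambda>x. 0)) \<le> normB g"
    unfolding Hm12_norm_def dual_norm_def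
    using W.zero_mem trace_norm_zero by (intro cSUP_upper[OF _ dual_bdd_above[OF g]]) auto
  then show ?thesis using norm_ge_zero order_trans by blast
qed

sublocale B: function_space B
proof
  show "(\<lambda>x. 0) \<in> B" unfolding Hm12_def dual_space_def by (auto intro!: exI[of _ 0])
  fix g h \<alpha> \<beta> assume g: "g \<in> B" and h: "h \<in> B"
  have "norm (\<alpha> * g t + \<beta> * h t) \<le> (norm \<alpha> * normB g + norm \<beta> * normB h) * N t" if "t \<in> W" for t
  proof -
    have "norm (\<alpha> * g t + \<beta> * h t) \<le> norm \<alpha> * norm (g t) + norm \<beta> * norm (h t)"
      by (metis norm_mult norm_triangle_ineq)
    also have "\<dots> \<le> norm \<alpha> * (normB g * N t) + norm \<beta> * (normB h * N t)"
      using that g h by (intro add_mono mult_left_mono dual_apply_le) auto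
    finally show ?thesis by (simp add: algebra_simps)
  qed
  note bound = this
  show "(\<lambda>x. \<alpha> * g x + \<beta> * h x) \<in> B"
    unfolding Hm12_def dual_space_def
  proof (intro CollectI conjI allI ballI impI)
    show "\<alpha> * g t + \<beta> * h t = 0" if "t \<notin> W" for t using HmD(1)[OF g that] HmD(1)[OF h that] by simp
    show "\<alpha> * g (\<lambda>x. p * s x + q * t x) + \<beta> * h (\<lambda>x. p * s x + q * t x)
        = p * (\<alpha> * g s + \<beta> * h s) + q * (\<alpha> * g t + \<beta> * h t)" if "s \<in> W" "t \<in> W" for s t p q
      using HmD(2)[OF g that] HmD(2)[OF h that] by (simp add: algebra_simps)
    show "\<exists>C. \<forall>t\<in>W. norm (\<alpha> * g t + \<beta> * h t) \<le> C * N t" using bound by blast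
  qed
qed

lemma dual_norm_triangle:
  assumes g: "g \<in> B" and h: "h \<in> B"
  shows "normB (\<lambda>t. g t + h t) \<le> normB g + normB h"
proof (rule dual_norm_le)
  fix t assume "t \<in> W"
  then have "norm (g t) + norm (h t) \<le> normB g * N t + normB h * N t"
    using g h by (intro add_mono dual_apply_le)
  then show "norm (g t + h t) \<le> (normB g + normB h) * N t"
    using norm_triangle_ineq[of "g t" "h t"] by (simp add: algebra_simps)
qed (use dual_norm_ge g h in auto)

lemma dual_norm_eq_0D:
  assumes g: "g \<in> B" and zero: "normB g = 0"
  shows "g = (\<lambda>t. 0)"
proof
  fix t
  show "g t = 0" using HmD(1)[OF g, of t] dual_apply_le[OF g, of t] zero by (cases "t \<in> W") auto
qed

lemma dual_apply_trace_le:
  assumes g: "g \<in> B" and v: "v \<in> H1D \<Omega> \<Gamma>D" "has_trace \<Omega> S v t"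
  shows "norm (g t) \<le> normB g * H1_norm \<Omega> v"
  using dual_apply_le[OF g trace_mem[OF v]] mult_left_mono[OF trace_norm_le[OF v] dual_norm_ge[OF g]]
  by (rule order_trans)

text \<open>Two traces of one function differ by a trace of zero, which bounded functionals annihilate.
  This replaces the uniqueness of traces.\<close>

lemma dual_apply_trace_unique:
  assumes g: "g \<in> B" and v: "v \<in> H1D \<Omega> \<Gamma>D" and s: "has_trace \<Omega> S v s" and t: "has_trace \<Omega> S v t"
  shows "g s = g t"
proof -
  have "has_trace \<Omega> S (\<lambda>x. 0) (\<lambda>x. s x - t x)"
    using has_trace_lin[OF borel_S s t, of 1 "-1"] by simp
  then have "norm (g (\<lambda>x. s x - t x)) \<le> 0"
    using dual_apply_trace_le[OF g V.zero_mem] H1_norm_zero by fastforce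
  then show ?thesis
    using HmD(2)[OF g trace_mem[OF v s] trace_mem[OF v t], of 1 "-1"] by simp
qed

lemma dual_apply_trace_lin:
  assumes g: "g \<in> B" and u: "u \<in> H1D \<Omega> \<Gamma>D" and v: "v \<in> H1D \<Omega> \<Gamma>D"
  shows "g (\<gamma> (\<lambda>x. a * u x + b * v x)) = a * g (\<gamma> u) + b * g (\<gamma> v)"
proof -
  note tu = has_trace_dirichlet_trace[OF u] and tv = has_trace_dirichlet_trace[OF v]
  have uv: "(\<lambda>x. a * u x + b * v x) \<in> H1D \<Omega> \<Gamma>D" using u v by (rule V.lin_mem)
  have "g (\<gamma> (\<lambda>x. a * u x + b * v x)) = g (\<lambda>x. a * \<gamma> u x + b * \<gamma> v x)"
    using g uv has_trace_dirichlet_trace[OF uv] has_trace_lin[OF borel_S tu tv] by (rule dual_apply_trace_unique)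
  also have "\<dots> = a * g (\<gamma> u) + b * g (\<gamma> v)"
    using HmD(2)[OF g trace_mem[OF u tu] trace_mem[OF v tv]] .
  finally show ?thesis .
qed

lemma dual_apply_cnj_trace:
  assumes g: "g \<in> B" and v: "v \<in> H1D \<Omega> \<Gamma>D"
  shows "g (cnj_fun (\<gamma> (cnj_fun v))) = g (\<gamma> v)" "g (cnj_fun (\<gamma> v)) = g (\<gamma> (cnj_fun v))"
proof -
  have cc: "cnj_fun (cnj_fun v) = v" by (simp add: cnj_fun_def)
  show "g (cnj_fun (\<gamma> (cnj_fun v))) = g (\<gamma> v)"
    using has_trace_cnj[OF has_trace_dirichlet_trace[OF H1D_cnj[OF v]]] has_trace_dirichlet_trace[OF v]
    by (intro dual_apply_trace_unique[OF g v]) (simp_all add: cc)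
  show "g (cnj_fun (\<gamma> v)) = g (\<gamma> (cnj_fun v))"
    using has_trace_cnj[OF has_trace_dirichlet_trace[OF v]] has_trace_dirichlet_trace[OF H1D_cnj[OF v]]
    by (rule dual_apply_trace_unique[OF g H1D_cnj[OF v]])
qed

end

lemma norm_cdot_le: "norm (cdot x y) \<le> norm x * norm y"
proof -
  have "norm (cdot x y) \<le> (\<Sum>i\<in>UNIV. \<bar>norm (x $ i)\<bar> * \<bar>norm (y $ i)\<bar>)"
    unfolding cdot_def by (rule order_trans[OF norm_sum]) (simp add: norm_mult)
  also have "\<dots> \<le> L2_set (\<lambda>i. norm (x $ i)) UNIV * L2_set (\<lambda>i. norm (y $ i)) UNIV"
    by (rule L2_set_mult_ineq)
  finally show ?thesis by (simp add: norm_vec_def)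
qed

lemma norm_matrix_vector_mult_le:
  fixes A :: "complex ^ 'n ^ 'm"
  shows "norm (A *v x) \<le> norm A * norm x"
proof -
  have "norm ((A *v x) $ i) \<le> norm (A $ i) * norm x" for i
    using norm_cdot_le[of "A $ i" x] by (simp add: cdot_def matrix_vector_mult_def)
  then have "norm (A *v x) \<le> L2_set (\<lambda>i. norm (A $ i) * norm x) UNIV"
    unfolding norm_vec_def[of "A *v x"] by (intro L2_set_mono) auto
  also have "\<dots> = norm A * norm x" by (simp add: norm_vec_def[of A] L2_set_left_distrib)
  finally show ?thesis .
qed

lemma cdot_lin:
  "cdot (a *s x + b *s y) z = a * cdot x z + b * cdot y z"
  "cdot z (a *s x + b *s y) = a * cdot z x + b * cdot z y"
  by (simp_all add: cdot_def algebra_simps sum.distrib sum_distrib_left)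

locale elliptic_form_data = trace_interface \<Omega> \<Gamma>D "frontier \<Omega> - \<Gamma>D" for \<Omega> \<Gamma>D :: "(real ^ 'n) set" +
  fixes A :: "real ^ 'n \<Rightarrow> complex ^ 'n ^ 'n"
    and bv :: "real ^ 'n \<Rightarrow> complex ^ 'n"
    and c :: "real ^ 'n \<Rightarrow> complex"
    and G :: "(real ^ 'n \<Rightarrow> complex) \<Rightarrow> (real ^ 'n \<Rightarrow> complex) \<Rightarrow> complex"
  assumes A: "A \<in> L_infinity \<Omega>" and bv: "bv \<in> L_infinity \<Omega>" and c: "c \<in> L_infinity \<Omega>"
    and G: "bounded_operator_Hm12 \<Omega> \<Gamma>D (frontier \<Omega> - \<Gamma>D) G"
begin

definition integrand :: "(real ^ 'n \<Rightarrow> complex) \<Rightarrow> (real ^ 'n \<Rightarrow> complex) \<Rightarrow> real ^ 'n \<Rightarrow> complex" where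
  "integrand v z x = cdot (A x *v weak_gradient \<Omega> v x) (weak_gradient \<Omega> z x) +
     (cdot (bv x) (weak_gradient \<Omega> v x) + c x * v x) * z x"

lemma elliptic_form_eq:
  "elliptic_form \<Omega> \<Gamma>D A bv c G v w = (LINT x|M. integrand v (cnj_fun w) x) - G v (\<gamma> (cnj_fun w))"
  by (simp add: elliptic_form_def integrand_def)

lemma integrand_measurable:
  assumes v: "v \<in> H1 \<Omega>" and z: "z \<in> H1 \<Omega>"
  shows "integrand v z \<in> borel_measurable M"
proof -
  have [measurable]: "v \<in> borel_measurable M" "z \<in> borel_measurable M" "c \<in> borel_measurable M"
    using L2D(1)[OF H1_L2[OF v]] L2D(1)[OF H1_L2[OF z]] c by (auto simp: L_infinity_def)
  have gv [measurable]: "(\<lambda>x. weak_gradient \<Omega> v x $ i) \<in> borel_measurable M" for i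
    using H1_weak_gradient(1)[OF v] by (intro L2D L2_component)
  have gz [measurable]: "(\<lambda>x. weak_gradient \<Omega> z x $ i) \<in> borel_measurable M" for i
    using H1_weak_gradient(1)[OF z] by (intro L2D L2_component)
  have [measurable]: "(\<lambda>x. bv x $ i) \<in> borel_measurable M" for i
    using bv by (intro borel_measurable_vec_component) (auto simp: L_infinity_def)
  have [measurable]: "(\<lambda>x. A x $ i $ j) \<in> borel_measurable M" for i j
  proof -
    have "A \<in> borel_measurable M" using A by (simp add: L_infinity_def)
    then show ?thesis
      by (rule borel_measurable_continuous_on[rotated]) (intro continuous_intros)
  qed
  show ?thesis
    unfolding integrand_def[abs_def] cdot_def matrix_vector_mult_def vec_lambda_beta by measurable
qed

lemma integrand_bound:
  "\<exists>K\<ge>0. \<forall>v\<in>H1 \<Omega>. \<forall>z\<in>H1 \<Omega>. integrable M (integrand v z) \<and>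
    norm (LINT x|M. integrand v z x) \<le> K * ((H1_norm \<Omega> v)\<^sup>2 + (H1_norm \<Omega> z)\<^sup>2)"
proof -
  obtain KA Kb Kc where "AE x in M. norm (A x) \<le> KA" "AE x in M. norm (bv x) \<le> Kb" "AE x in M. norm (c x) \<le> Kc"
    using A bv c by (auto simp: L_infinity_def)
  define K where "K = \<bar>KA\<bar> + \<bar>Kb\<bar> + \<bar>Kc\<bar>"
  have K: "0 \<le> K" by (simp add: K_def)
  have coeff: "AE x in M. norm (A x) \<le> K \<and> norm (bv x) \<le> K \<and> norm (c x) \<le> K"
    using \<open>AE x in M. norm (A x) \<le> KA\<close> \<open>AE x in M. norm (bv x) \<le> Kb\<close> \<open>AE x in M. norm (c x) \<le> Kc\<close>
    by eventually_elim (auto simp: K_def)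
  show ?thesis
  proof (intro exI[of _ K] conjI K ballI)
    fix v z assume v: "v \<in> H1 \<Omega>" and z: "z \<in> H1 \<Omega>"
    let ?gv = "weak_gradient \<Omega> v" and ?gz = "weak_gradient \<Omega> z"
    let ?m = "\<lambda>x. K * (((norm (v x))\<^sup>2 + (norm (?gv x))\<^sup>2) + ((norm (z x))\<^sup>2 + (norm (?gz x))\<^sup>2))"
    have le: "AE x in M. norm (integrand v z x) \<le> ?m x"
      using coeff
    proof eventually_elim
      fix x assume k: "norm (A x) \<le> K \<and> norm (bv x) \<le> K \<and> norm (c x) \<le> K"
      define p q r s where "p = norm (v x)" and "q = norm (?gv x)" and "r = norm (z x)" and "s = norm (?gz x)"
      have nn: "0 \<le> p" "0 \<le> q" "0 \<le> r" "0 \<le> s" by (auto simp: p_def q_def r_def s_def)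
      have 1: "norm (cdot (A x *v ?gv x) (?gz x)) \<le> K * q * s"
      proof -
        have "norm (cdot (A x *v ?gv x) (?gz x)) \<le> norm (A x *v ?gv x) * s" unfolding s_def by (rule norm_cdot_le)
        also have "norm (A x *v ?gv x) \<le> norm (A x) * q" unfolding q_def by (rule norm_matrix_vector_mult_le)
        also have "norm (A x) * q \<le> K * q" using k nn by (intro mult_right_mono) auto
        finally show ?thesis using nn by (simp add: mult_right_mono)
      qed
      have 2: "norm (cdot (bv x) (?gv x)) \<le> K * q"
      proof -
        have "norm (cdot (bv x) (?gv x)) \<le> norm (bv x) * q" unfolding q_def by (rule norm_cdot_le)
        also have "\<dots> \<le> K * q" using k nn by (intro mult_right_mono) auto
        finally show ?thesis .
      qed
      have 3: "norm (c x * v x) \<le> K * p"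
        using k nn by (simp add: norm_mult p_def mult_right_mono)
      have "norm (integrand v z x) \<le> norm (cdot (A x *v ?gv x) (?gz x)) + norm (cdot (bv x) (?gv x) + c x * v x) * r"
        unfolding integrand_def r_def norm_mult[symmetric] by (rule norm_triangle_ineq)
      also have "\<dots> \<le> K * q * s + (K * q + K * p) * r"
        using nn 1 norm_triangle_le[OF add_mono[OF 2 3]] by (intro add_mono mult_right_mono)
      also have "\<dots> = K * (q * s + q * r + p * r)" by (simp add: algebra_simps)
      also have "\<dots> \<le> K * ((p\<^sup>2 + q\<^sup>2) + (r\<^sup>2 + s\<^sup>2))"
      proof (rule mult_left_mono[OF _ K])
        show "q * s + q * r + p * r \<le> (p\<^sup>2 + q\<^sup>2) + (r\<^sup>2 + s\<^sup>2)"
          using sum_squares_bound[of q s] sum_squares_bound[of q r] sum_squares_bound[of p r]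
            zero_le_power2[of p] zero_le_power2[of s] by argo
      qed
      finally show "norm (integrand v z x) \<le> ?m x" by (simp add: p_def q_def r_def s_def)
    qed
    have int: "integrable M (\<lambda>x. (norm (u x))\<^sup>2 + (norm (weak_gradient \<Omega> u x))\<^sup>2)"
      "(LINT x|M. (norm (u x))\<^sup>2 + (norm (weak_gradient \<Omega> u x))\<^sup>2) = (H1_norm \<Omega> u)\<^sup>2" if u: "u \<in> H1 \<Omega>" for u
    proof -
      have i: "integrable M (\<lambda>x. (norm (u x))\<^sup>2)" "integrable M (\<lambda>x. (norm (weak_gradient \<Omega> u x))\<^sup>2)"
        using L2D(2)[OF H1_L2[OF u]] L2D(2)[OF H1_weak_gradient(1)[OF u]] by auto
      show "integrable M (\<lambda>x. (norm (u x))\<^sup>2 + (norm (weak_gradient \<Omega> u x))\<^sup>2)"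
        using i by (rule Bochner_Integration.integrable_add)
      show "(LINT x|M. (norm (u x))\<^sup>2 + (norm (weak_gradient \<Omega> u x))\<^sup>2) = (H1_norm \<Omega> u)\<^sup>2"
        unfolding H1_norm_sq using i by (rule Bochner_Integration.integral_add)
    qed
    have im: "integrable M ?m"
      using int(1)[OF v] int(1)[OF z] by (intro integrable_mult_right Bochner_Integration.integrable_add[of _ "\<lambda>x. (norm (v x))\<^sup>2 + (norm (?gv x))\<^sup>2"])
    show ii: "integrable M (integrand v z)"
      by (rule Bochner_Integration.integrable_bound[OF im integrand_measurable[OF v z]])
        (rule eventually_mono[OF le], use K in auto)
    have "norm (LINT x|M. integrand v z x) \<le> (LINT x|M. ?m x)"
      using Bochner_Integration.integral_norm_bound integral_mono_AE[OF integrable_norm[OF ii] im le] by (rule order_trans)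
    also have "\<dots> = K * ((H1_norm \<Omega> v)\<^sup>2 + (H1_norm \<Omega> z)\<^sup>2)"
      by (subst integral_mult_right_zero, subst Bochner_Integration.integral_add[OF int(1)[OF v] int(1)[OF z]])
        (simp add: int(2) v z)
    finally show "norm (LINT x|M. integrand v z x) \<le> K * ((H1_norm \<Omega> v)\<^sup>2 + (H1_norm \<Omega> z)\<^sup>2)" .
  qed
qed

lemma integrand_lin:
  assumes u: "u \<in> H1 \<Omega>" and v: "v \<in> H1 \<Omega>" and z: "z \<in> H1 \<Omega>"
  shows "(LINT x|M. integrand (\<lambda>x. a * u x + b * v x) z x) = a * (LINT x|M. integrand u z x) + b * (LINT x|M. integrand v z x)"
    and "(LINT x|M. integrand z (\<lambda>x. a * u x + b * v x) x) = a * (LINT x|M. integrand z u x) + b * (LINT x|M. integrand z v x)"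
proof -
  obtain K where "\<forall>v\<in>H1 \<Omega>. \<forall>z\<in>H1 \<Omega>. integrable M (integrand v z) \<and>
      norm (LINT x|M. integrand v z x) \<le> K * ((H1_norm \<Omega> v)\<^sup>2 + (H1_norm \<Omega> z)\<^sup>2)"
    using integrand_bound by (elim exE conjE)
  then have int: "integrable M (integrand v z)" if "v \<in> H1 \<Omega>" "z \<in> H1 \<Omega>" for v z
    using that by blast
  have uv: "(\<lambda>x. a * u x + b * v x) \<in> H1 \<Omega>" using u v by (rule H1_lin)
  have "(LINT x|M. integrand (\<lambda>x. a * u x + b * v x) z x) = (LINT x|M. a * integrand u z x + b * integrand v z x)"
  proof (rule integral_cong_AE)
    show "AE x in M. integrand (\<lambda>x. a * u x + b * v x) z x = a * integrand u z x + b * integrand v z x"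
      using H1_lin(2)[OF u v, of a b]
      by eventually_elim (simp add: integrand_def matrix_vector_right_distrib vec.scale cdot_lin algebra_simps)
  qed (use integrand_measurable uv u v z in \<open>auto intro!: borel_measurable_add borel_measurable_times\<close>)
  also have "\<dots> = (LINT x|M. a * integrand u z x) + (LINT x|M. b * integrand v z x)"
    using int[OF u z] int[OF v z] by (intro Bochner_Integration.integral_add integrable_mult_right)
  finally show "(LINT x|M. integrand (\<lambda>x. a * u x + b * v x) z x) = a * (LINT x|M. integrand u z x) + b * (LINT x|M. integrand v z x)"
    by simp
  have "(LINT x|M. integrand z (\<lambda>x. a * u x + b * v x) x) = (LINT x|M. a * integrand z u x + b * integrand z v x)"
  proof (rule integral_cong_AE)
    show "AE x in M. integrand z (\<lambda>x. a * u x + b * v x) x = a * integrand z u x + b * integrand z v x"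
      using H1_lin(2)[OF u v, of a b]
      by eventually_elim (simp add: integrand_def cdot_lin algebra_simps)
  qed (use integrand_measurable uv u v z in \<open>auto intro!: borel_measurable_add borel_measurable_times\<close>)
  also have "\<dots> = (LINT x|M. a * integrand z u x) + (LINT x|M. b * integrand z v x)"
    using int[OF z u] int[OF z v] by (intro Bochner_Integration.integral_add integrable_mult_right)
  finally show "(LINT x|M. integrand z (\<lambda>x. a * u x + b * v x) x) = a * (LINT x|M. integrand z u x) + b * (LINT x|M. integrand z v x)"
    by simp
qed

lemma G_D:
  assumes "v \<in> H1D \<Omega> \<Gamma>D"
  shows "G v \<in> B"
    and "w \<in> H1D \<Omega> \<Gamma>D \<Longrightarrow> G (\<lambda>x. a * v x + b * w x) = (\<lambda>t. a * G v t + b * G w t)"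
    and "\<exists>C. \<forall>v\<in>H1D \<Omega> \<Gamma>D. normB (G v) \<le> C * H1_norm \<Omega> v"
  using G assms unfolding bounded_operator_Hm12_def by blast+

lemma elliptic_form_sesquilinear: "sesquilinear_on (H1D \<Omega> \<Gamma>D) (elliptic_form \<Omega> \<Gamma>D A bv c G)"
  unfolding sesquilinear_on_def
proof (intro ballI allI conjI)
  fix u v w a b assume u: "u \<in> H1D \<Omega> \<Gamma>D" and v: "v \<in> H1D \<Omega> \<Gamma>D" and w: "w \<in> H1D \<Omega> \<Gamma>D"
  note [simp] = elliptic_form_eq
  show "elliptic_form \<Omega> \<Gamma>D A bv c G (\<lambda>x. a * u x + b * v x) w
      = a * elliptic_form \<Omega> \<Gamma>D A bv c G u w + b * elliptic_form \<Omega> \<Gamma>D A bv c G v w"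
    by (simp add: integrand_lin(1) H1D_H1 H1D_cnj u v w G_D(2) algebra_simps)
  show "elliptic_form \<Omega> \<Gamma>D A bv c G w (\<lambda>x. a * u x + b * v x)
      = cnj a * elliptic_form \<Omega> \<Gamma>D A bv c G w u + cnj b * elliptic_form \<Omega> \<Gamma>D A bv c G w v"
    by (simp add: cnj_fun_lin integrand_lin(2) H1D_H1 H1D_cnj u v w dual_apply_trace_lin[OF G_D(1)] algebra_simps)
qed

lemma elliptic_form_bounded:
  "\<exists>K. \<forall>v\<in>H1D \<Omega> \<Gamma>D. \<forall>w\<in>H1D \<Omega> \<Gamma>D. norm (elliptic_form \<Omega> \<Gamma>D A bv c G v w) \<le> K * V.nrm v * V.nrm w"
proof -
  from integrand_bound obtain K where K: "0 \<le> K" and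
    Kb: "\<forall>v\<in>H1 \<Omega>. \<forall>z\<in>H1 \<Omega>. integrable M (integrand v z) \<and>
      norm (LINT x|M. integrand v z x) \<le> K * ((H1_norm \<Omega> v)\<^sup>2 + (H1_norm \<Omega> z)\<^sup>2)"
    by (elim exE conjE)
  obtain C where C: "\<And>v. v \<in> H1D \<Omega> \<Gamma>D \<Longrightarrow> normB (G v) \<le> C * H1_norm \<Omega> v"
    using G_D(3)[OF V.zero_mem] by blast
  have "norm (elliptic_form \<Omega> \<Gamma>D A bv c G v w) \<le> (K + \<bar>C\<bar>) * ((V.nrm v)\<^sup>2 + (V.nrm w)\<^sup>2)"
    if v: "v \<in> H1D \<Omega> \<Gamma>D" and w: "w \<in> H1D \<Omega> \<Gamma>D" for v w
  proof -
    define p q where "p = H1_norm \<Omega> v" and "q = H1_norm \<Omega> w"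
    have pq: "0 \<le> p" "0 \<le> q" by (simp_all add: p_def q_def H1_norm_ge)
    have nw: "H1_norm \<Omega> (cnj_fun w) = q" using H1_norm_cnj[OF H1D_H1[OF w]] by (simp add: q_def)
    have "norm (LINT x|M. integrand v (cnj_fun w) x) \<le> K * (p\<^sup>2 + q\<^sup>2)"
      using Kb[rule_format, OF H1D_H1[OF v] H1D_H1[OF H1D_cnj[OF w]]] nw by (simp add: p_def)
    moreover have "norm (G v (\<gamma> (cnj_fun w))) \<le> \<bar>C\<bar> * (p\<^sup>2 + q\<^sup>2)"
    proof -
      have "norm (G v (\<gamma> (cnj_fun w))) \<le> normB (G v) * q"
        using dual_apply_trace_le[OF G_D(1)[OF v] H1D_cnj[OF w] has_trace_dirichlet_trace[OF H1D_cnj[OF w]]] nw by simp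
      also have "\<dots> \<le> (C * p) * q" using C[OF v] pq by (intro mult_right_mono) (simp_all add: p_def)
      also have "\<dots> \<le> \<bar>C\<bar> * (p * q)" using pq by (simp add: mult_right_mono mult.assoc)
      also have "\<dots> \<le> \<bar>C\<bar> * (p\<^sup>2 + q\<^sup>2)"
      proof (rule mult_left_mono)
        have "0 \<le> p * q" using pq by simp
        then show "p * q \<le> p\<^sup>2 + q\<^sup>2" using sum_squares_bound[of p q] by linarith
      qed simp
      finally show ?thesis .
    qed
    ultimately have "norm (elliptic_form \<Omega> \<Gamma>D A bv c G v w) \<le> K * (p\<^sup>2 + q\<^sup>2) + \<bar>C\<bar> * (p\<^sup>2 + q\<^sup>2)"
      unfolding elliptic_form_eq by (intro order_trans[OF norm_triangle_ineq4] add_mono)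
    then show ?thesis using v w by (simp add: p_def q_def nrm_eq H1D_H1 distrib_right)
  qed
  from V.sesquilinear_bound[OF elliptic_form_sesquilinear _ this]
  show ?thesis using K by (intro exI[of _ "2 * (K + \<bar>C\<bar>)"] ballI) simp
qed

end

section \<open>Layer potentials and their discretisation\<close>

lemma fun_span_superset:
  assumes "finite F" "f \<in> F"
  shows "f \<in> fun_span F"
proof (rule fun_spanI)
  show "f = (\<lambda>y. \<Sum>h\<in>F. (if h = f then 1 else 0) * h y)"
    using assms by (simp add: if_distrib[of "\<lambda>c. c * _"] cong: if_cong)
qed

lemma finite_dim_subspace_eq: "finite_dim_subspace U W \<longleftrightarrow> (\<exists>F. finite F \<and> F \<subseteq> W \<and> U = fun_span F)"
  by (simp add: finite_dim_subspace_def fun_span_def)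

lemma cancel_le:
  assumes "c * p\<^sup>2 \<le> q * p" "0 \<le> p" "0 \<le> q"
  shows "c * p \<le> (q :: real)"
proof (cases "p = 0")
  case False
  then have "0 < p" using assms(2) by simp
  then show ?thesis using assms(1) by (simp add: power2_eq_square flip: mult.assoc)
qed (use assms in simp)

locale layer_potentials = trace_interface \<Omega> \<Gamma>D S for \<Omega> \<Gamma>D S :: "(real ^ 'n) set" +
  fixes \<l> :: "'n form" and K cL :: real
  assumes sesq: "sesquilinear_on (H1D \<Omega> \<Gamma>D) \<l>"
    and bounded: "u \<in> H1D \<Omega> \<Gamma>D \<Longrightarrow> v \<in> H1D \<Omega> \<Gamma>D \<Longrightarrow> norm (\<l> u v) \<le> K * H1_norm \<Omega> u * H1_norm \<Omega> v"
    and coercive: "v \<in> H1D \<Omega> \<Gamma>D \<Longrightarrow> cL * (H1_norm \<Omega> v)\<^sup>2 \<le> norm (\<l> v v)"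
    and K: "0 < K" and cL: "0 < cL"
begin

lemma null_if_test_zero:
  assumes "u \<in> H1D \<Omega> \<Gamma>D" "\<l> u u = 0"
  shows "H1_norm \<Omega> u = 0"
  using coercive[OF assms(1)] assms(2) cL by (simp add: mult_le_0_iff not_le[symmetric])

lemma form_null:
  assumes "u \<in> H1D \<Omega> \<Gamma>D" "v \<in> H1D \<Omega> \<Gamma>D" "H1_norm \<Omega> v = 0"
  shows "\<l> u v = 0"
  using bounded[OF assms(1,2)] assms(3) by simp

abbreviation "SL \<equiv> single_layer_potential \<Omega> \<Gamma>D \<l> S"

lemma single_layer_potential:
  assumes g: "g \<in> B"
  shows single_layer_mem: "SL g \<in> H1D \<Omega> \<Gamma>D"
    and single_layer_eq: "w \<in> H1D \<Omega> \<Gamma>D \<Longrightarrow> \<l> (SL g) w = g (\<gamma> (cnj_fun w))"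
proof -
  let ?F = "\<lambda>w. g (\<gamma> (cnj_fun w))"
  have cc: "cnj_fun (cnj_fun w) = w" for w :: "real ^ 'n \<Rightarrow> complex" by (simp add: cnj_fun_def)
  have F: "antilinear_on (H1D \<Omega> \<Gamma>D) ?F"
    unfolding antilinear_on_def by (simp add: cnj_fun_lin dual_apply_trace_lin[OF g] H1D_cnj)
  have F_le: "norm (?F w) \<le> normB g * V.nrm w" if w: "w \<in> H1D \<Omega> \<Gamma>D" for w
    using dual_apply_trace_le[OF g H1D_cnj[OF w] has_trace_dirichlet_trace[OF H1D_cnj[OF w]]]
    by (simp add: H1_norm_cnj nrm_eq H1D_H1 w)
  have K_le: "norm (\<l> u v) \<le> K * V.nrm u * V.nrm v" if "u \<in> H1D \<Omega> \<Gamma>D" "v \<in> H1D \<Omega> \<Gamma>D" for u v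
    using bounded[OF that] that by (simp add: nrm_eq H1D_H1)
  have cL_le: "cL * (V.nrm v)\<^sup>2 \<le> norm (\<l> v v)" if "v \<in> H1D \<Omega> \<Gamma>D" for v
    using coercive[OF that] that by (simp add: nrm_eq H1D_H1)
  have "\<exists>u\<in>H1D \<Omega> \<Gamma>D. \<forall>w\<in>H1D \<Omega> \<Gamma>D. \<l> u w = ?F w"
    by (rule V.lax_milgram[OF sesq K_le cL cL_le F F_le])
  then obtain u where u_mem: "u \<in> H1D \<Omega> \<Gamma>D" and u_eq: "\<forall>w\<in>H1D \<Omega> \<Gamma>D. \<l> u w = ?F w" by (elim bexE)
  have "elliptic_operator \<Omega> \<Gamma>D \<l> u = trace_adjoint \<Omega> \<Gamma>D S g"
    unfolding elliptic_operator_def trace_adjoint_def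
    by (intro ext) (simp add: u_eq H1D_cnj cc dual_apply_cnj_trace(1)[OF g])
  then have im: "trace_adjoint \<Omega> \<Gamma>D S g \<in> elliptic_operator \<Omega> \<Gamma>D \<l> ` H1D \<Omega> \<Gamma>D" using u_mem by (metis imageI)
  show "SL g \<in> H1D \<Omega> \<Gamma>D"
    unfolding single_layer_potential_def solution_operator_def using im by (rule inv_into_into)
  have op: "elliptic_operator \<Omega> \<Gamma>D \<l> (SL g) = trace_adjoint \<Omega> \<Gamma>D S g"
    unfolding single_layer_potential_def solution_operator_def using im by (rule f_inv_into_f)
  show "\<l> (SL g) w = g (\<gamma> (cnj_fun w))" if w: "w \<in> H1D \<Omega> \<Gamma>D" for w
    using fun_cong[OF op, of "cnj_fun w"] dual_apply_cnj_trace(2)[OF g w]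
    by (simp add: elliptic_operator_def trace_adjoint_def cc H1D_cnj w)
qed

lemma pairing_eq:
  assumes h: "h \<in> B" and v: "v \<in> H1D \<Omega> \<Gamma>D" "has_trace \<Omega> S v t"
  shows "pairing_XB t (cnj_functional h) = cnj (\<l> (SL h) v)"
proof -
  have "h (cnj_fun t) = h (\<gamma> (cnj_fun v))"
    using has_trace_cnj[OF v(2)] has_trace_dirichlet_trace[OF H1D_cnj[OF v(1)]]
    by (rule dual_apply_trace_unique[OF h H1D_cnj[OF v(1)]])
  then show ?thesis by (simp add: pairing_XB_def cnj_functional_def single_layer_eq[OF h v(1)])
qed

lemma single_layer_form_le:
  assumes h: "h \<in> B" and v: "v \<in> H1D \<Omega> \<Gamma>D"
  shows "norm (\<l> (SL h) v) \<le> normB h * H1_norm \<Omega> v"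
  using dual_apply_trace_le[OF h H1D_cnj[OF v] has_trace_dirichlet_trace[OF H1D_cnj[OF v]]]
  by (simp add: single_layer_eq h v H1_norm_cnj H1D_H1)

lemma dual_norm_le_single_layer:
  assumes g: "g \<in> B"
  shows "normB g \<le> K * H1_norm \<Omega> (SL g)"
proof (rule dual_norm_le)
  show nn: "0 \<le> K * H1_norm \<Omega> (SL g)" using K H1_norm_ge by simp
  fix t assume t: "t \<in> W"
  have le: "norm (g t) \<le> K * H1_norm \<Omega> (SL g) * H1_norm \<Omega> v" if v: "v \<in> H1D \<Omega> \<Gamma>D" "has_trace \<Omega> S v t" for v
  proof -
    have "g t = g (\<gamma> v)"
      using v has_trace_dirichlet_trace[OF v(1)] by (intro dual_apply_trace_unique[OF g])
    also have "\<dots> = \<l> (SL g) (cnj_fun v)"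
      using single_layer_eq[OF g H1D_cnj[OF v(1)]] by (simp add: cnj_fun_def)
    finally show ?thesis
      using bounded[OF single_layer_mem[OF g] H1D_cnj[OF v(1)]] v(1) by (simp add: H1_norm_cnj H1D_H1)
  qed
  show "norm (g t) \<le> K * H1_norm \<Omega> (SL g) * N t"
  proof (cases "K * H1_norm \<Omega> (SL g) = 0")
    case True
    obtain v where "v \<in> H1D \<Omega> \<Gamma>D" "has_trace \<Omega> S v t" using t by (rule trace_spaceE)
    from le[OF this] show ?thesis unfolding True by simp
  next
    case False
    with nn have pos: "0 < K * H1_norm \<Omega> (SL g)" by linarith
    have "norm (g t) / (K * H1_norm \<Omega> (SL g)) \<le> N t"
      using t le pos by (intro trace_norm_greatest) (simp_all add: pos_divide_le_eq mult.commute mult.left_commute)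
    then show ?thesis using pos by (simp add: pos_divide_le_eq mult.commute mult.left_commute)
  qed
qed

lemma single_layer_diff_le:
  assumes g: "g \<in> B" and h: "h \<in> B"
  shows "cL * H1_norm \<Omega> (\<lambda>x. SL g x - SL h x) \<le> normB (\<lambda>t. g t - h t)"
proof (rule cancel_le)
  let ?d = "\<lambda>x. SL g x - SL h x"
  have d: "?d \<in> H1D \<Omega> \<Gamma>D" using g h by (intro V.diff_mem single_layer_mem)
  have gh: "(\<lambda>t. g t - h t) \<in> B" using g h by (rule B.diff_mem)
  have "\<l> ?d ?d = (g (\<gamma> (cnj_fun ?d)) - h (\<gamma> (cnj_fun ?d)))"
    using sesquilinear_on_diff(1)[OF sesq single_layer_mem[OF g] single_layer_mem[OF h] d]
    by (simp add: single_layer_eq g h d)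
  then have "norm (\<l> ?d ?d) \<le> normB (\<lambda>t. g t - h t) * H1_norm \<Omega> ?d"
    using dual_apply_trace_le[OF gh H1D_cnj[OF d] has_trace_dirichlet_trace[OF H1D_cnj[OF d]]]
    by (simp add: H1_norm_cnj H1D_H1 d)
  then show "cL * (H1_norm \<Omega> ?d)\<^sup>2 \<le> normB (\<lambda>t. g t - h t) * H1_norm \<Omega> ?d"
    using coercive[OF d] by linarith
  show "0 \<le> normB (\<lambda>t. g t - h t)" using gh by (rule dual_norm_ge)
qed (rule H1_norm_ge)

end

locale galerkin = layer_potentials \<Omega> \<Gamma>D S \<l> K cL for \<Omega> \<Gamma>D S :: "(real ^ 'n) set" and \<l> K cL +
  fixes Vd
  assumes Vd: "finite_dim_subspace Vd (H1D \<Omega> \<Gamma>D)"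
begin

abbreviation "P \<equiv> galerkin_projector \<l> Vd"

lemma Vd_space: "function_space Vd" and Vd_subset: "Vd \<subseteq> H1D \<Omega> \<Gamma>D"
  using Vd fun_span_space V.fun_span_subset by (auto simp: finite_dim_subspace_eq)

lemma galerkin:
  assumes v: "v \<in> H1D \<Omega> \<Gamma>D"
  shows galerkin_mem: "P v \<in> Vd" and galerkin_eq: "w \<in> Vd \<Longrightarrow> \<l> (P v) w = \<l> v w"
proof -
  obtain F where F: "finite F" "F \<subseteq> H1D \<Omega> \<Gamma>D" "Vd = fun_span F" using Vd by (auto simp: finite_dim_subspace_eq)
  have "\<exists>u\<in>fun_span F. \<forall>w\<in>fun_span F. \<l> u w = \<l> v w"
    using F(1,2) sesq sesquilinear_on_antilinear[OF sesq v]
  proof (rule V.finite_dim_solve)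
    fix w assume w: "w \<in> H1D \<Omega> \<Gamma>D" "\<l> w w = 0"
    then show "\<l> v w = 0 \<and> (\<forall>u\<in>H1D \<Omega> \<Gamma>D. \<l> u w = 0)"
      using form_null null_if_test_zero v by blast
  qed
  then have "\<exists>p. p \<in> Vd \<and> (\<forall>vd\<in>Vd. \<l> p vd = \<l> v vd)" using F(3) by blast
  then have "P v \<in> Vd \<and> (\<forall>vd\<in>Vd. \<l> (P v) vd = \<l> v vd)"
    unfolding galerkin_projector_def by (rule someI_ex)
  then show "P v \<in> Vd" "w \<in> Vd \<Longrightarrow> \<l> (P v) w = \<l> v w" by auto
qed

lemma galerkin_H1D: "v \<in> H1D \<Omega> \<Gamma>D \<Longrightarrow> P v \<in> H1D \<Omega> \<Gamma>D"
  using galerkin_mem Vd_subset by blast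

lemma cea:
  assumes v: "v \<in> H1D \<Omega> \<Gamma>D" and w: "w \<in> Vd"
  shows "cL * H1_norm \<Omega> (\<lambda>x. v x - P v x) \<le> K * H1_norm \<Omega> (\<lambda>x. v x - w x)"
proof (rule cancel_le)
  let ?d = "\<lambda>x. v x - P v x"
  have d: "?d \<in> H1D \<Omega> \<Gamma>D" using v galerkin_H1D by (intro V.diff_mem)
  have wV: "w \<in> H1D \<Omega> \<Gamma>D" using w Vd_subset by blast
  have vw: "(\<lambda>x. v x - w x) \<in> H1D \<Omega> \<Gamma>D" using v wV by (rule V.diff_mem)
  have orth: "\<l> ?d z = 0" if "z \<in> Vd" for z
    using sesquilinear_on_diff(1)[OF sesq v galerkin_H1D[OF v], of z] galerkin_eq[OF v that] that Vd_subset by auto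
  have "\<l> ?d ?d = \<l> ?d (\<lambda>x. v x - w x)"
    using sesquilinear_on_diff(2)[OF sesq v galerkin_H1D[OF v] d] sesquilinear_on_diff(2)[OF sesq v wV d]
      orth[OF w] orth[OF galerkin_mem[OF v]] by simp
  then show "cL * (H1_norm \<Omega> ?d)\<^sup>2 \<le> K * H1_norm \<Omega> (\<lambda>x. v x - w x) * H1_norm \<Omega> ?d"
    using coercive[OF d] bounded[OF d vw] by (simp add: mult.commute mult.left_commute)
  show "0 \<le> K * H1_norm \<Omega> (\<lambda>x. v x - w x)" using K H1_norm_ge by simp
qed (rule H1_norm_ge)

lemma galerkin_diff_le:
  assumes u: "u \<in> H1D \<Omega> \<Gamma>D" and v: "v \<in> H1D \<Omega> \<Gamma>D"
  shows "cL * H1_norm \<Omega> (\<lambda>x. P u x - P v x) \<le> K * H1_norm \<Omega> (\<lambda>x. u x - v x)"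
proof (rule cancel_le)
  interpret Vd: function_space Vd by (rule Vd_space)
  let ?d = "\<lambda>x. P u x - P v x"
  have d: "?d \<in> Vd" using u v by (intro Vd.diff_mem galerkin_mem)
  then have dV: "?d \<in> H1D \<Omega> \<Gamma>D" using Vd_subset by blast
  have uv: "(\<lambda>x. u x - v x) \<in> H1D \<Omega> \<Gamma>D" using u v by (rule V.diff_mem)
  have "\<l> ?d ?d = \<l> (\<lambda>x. u x - v x) ?d"
    using sesquilinear_on_diff(1)[OF sesq galerkin_H1D[OF u] galerkin_H1D[OF v] dV]
      sesquilinear_on_diff(1)[OF sesq u v dV] galerkin_eq[OF u d] galerkin_eq[OF v d] by simp
  then show "cL * (H1_norm \<Omega> ?d)\<^sup>2 \<le> K * H1_norm \<Omega> (\<lambda>x. u x - v x) * H1_norm \<Omega> ?d"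
    using coercive[OF dV] bounded[OF uv dV] by simp
  show "0 \<le> K * H1_norm \<Omega> (\<lambda>x. u x - v x)" using K H1_norm_ge by simp
qed (rule H1_norm_ge)

text \<open>The composition of the potential with the projector is linear only modulo functions of norm zero.\<close>

lemma galerkin_single_layer_lin:
  assumes g: "g \<in> B" and h: "h \<in> B"
  shows "H1_norm \<Omega> (\<lambda>x. P (SL (\<lambda>t. a * g t + b * h t)) x - (a * P (SL g) x + b * P (SL h) x)) = 0"
    (is "H1_norm \<Omega> ?d = 0")
proof -
  interpret Vd: function_space Vd by (rule Vd_space)
  let ?gh = "\<lambda>t. a * g t + b * h t"
  have gh: "?gh \<in> B" using g h by (rule B.lin_mem)
  note m = single_layer_mem[OF g] single_layer_mem[OF h] single_layer_mem[OF gh]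
  have c: "(\<lambda>x. a * P (SL g) x + b * P (SL h) x) \<in> Vd" using m by (intro Vd.lin_mem galerkin_mem)
  have d: "?d \<in> Vd" using galerkin_mem[OF m(3)] c by (rule Vd.diff_mem)
  have dV: "?d \<in> H1D \<Omega> \<Gamma>D" using d Vd_subset by blast
  have cV: "(\<lambda>x. a * P (SL g) x + b * P (SL h) x) \<in> H1D \<Omega> \<Gamma>D" using c Vd_subset by blast
  have "\<l> ?d ?d = \<l> (SL ?gh) ?d - (a * \<l> (SL g) ?d + b * \<l> (SL h) ?d)"
    using sesquilinear_on_diff(1)[OF sesq galerkin_H1D[OF m(3)] cV dV]
      sesquilinear_onD(1)[OF sesq galerkin_H1D[OF m(1)] galerkin_H1D[OF m(2)] dV, of a b]
      galerkin_eq[OF m(1) d] galerkin_eq[OF m(2) d] galerkin_eq[OF m(3) d] by simp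
  also have "\<dots> = 0" by (simp add: single_layer_eq g h gh dV)
  finally show ?thesis by (rule null_if_test_zero[OF dV])
qed

definition discrete_form where
  "discrete_form g h = cnj (h (\<gamma> (cnj_fun (P (SL g)))))"

lemma discrete_form_eq:
  assumes "g \<in> B" "h \<in> B"
  shows "pairing_XB (discrete_single_layer_operator \<Omega> \<Gamma>D \<l> S Vd g) (cnj_functional h) = discrete_form g h"
    and "discrete_form g h = cnj (\<l> (SL h) (P (SL g)))"
proof -
  have p: "P (SL g) \<in> H1D \<Omega> \<Gamma>D" using assms by (intro galerkin_H1D single_layer_mem)
  show "discrete_form g h = cnj (\<l> (SL h) (P (SL g)))"
    using assms p by (simp add: discrete_form_def single_layer_eq)
  then show "pairing_XB (discrete_single_layer_operator \<Omega> \<Gamma>D \<l> S Vd g) (cnj_functional h) = discrete_form g h"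
    unfolding discrete_single_layer_operator_def
    using pairing_eq[OF assms(2) p has_trace_dirichlet_trace[OF p]] by simp
qed

lemma discrete_form_sesquilinear: "sesquilinear_on B discrete_form"
  unfolding sesquilinear_on_def
proof (intro ballI allI conjI)
  fix u v w a b assume u: "u \<in> B" and v: "v \<in> B" and w: "w \<in> B"
  let ?uv = "\<lambda>t. a * u t + b * v t"
  have uv: "?uv \<in> B" using u v by (rule B.lin_mem)
  have p: "P (SL g) \<in> H1D \<Omega> \<Gamma>D" if "g \<in> B" for g using that by (intro galerkin_H1D single_layer_mem)
  have cV: "(\<lambda>x. a * P (SL u) x + b * P (SL v) x) \<in> H1D \<Omega> \<Gamma>D" using p u v by (intro V.lin_mem)
  have "\<l> (SL w) (P (SL ?uv)) = \<l> (SL w) (\<lambda>x. a * P (SL u) x + b * P (SL v) x)"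
    using form_null[OF single_layer_mem[OF w] V.diff_mem[OF p[OF uv] cV] galerkin_single_layer_lin[OF u v]]
      sesquilinear_on_diff(2)[OF sesq p[OF uv] cV single_layer_mem[OF w]] by simp
  also have "\<dots> = cnj a * \<l> (SL w) (P (SL u)) + cnj b * \<l> (SL w) (P (SL v))"
    using sesq p[OF u] p[OF v] single_layer_mem[OF w] by (rule sesquilinear_onD(2))
  finally show "discrete_form ?uv w = a * discrete_form u w + b * discrete_form v w"
    by (simp add: discrete_form_eq(2) u v w uv)
  show "discrete_form w ?uv = cnj a * discrete_form w u + cnj b * discrete_form w v"
    by (simp add: discrete_form_def)
qed

lemma consistency_errorD:
  assumes g: "g \<in> Bh" and h: "h \<in> Bh" and Bh: "Bh \<subseteq> B" and \<epsilon>: "0 \<le> \<epsilon>"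
    and err: "consistency_error \<Omega> \<Gamma>D \<l> S Vd Bh \<le> ennreal \<epsilon>"
  shows "norm (\<l> (SL h) (SL g) - \<l> (SL h) (P (SL g))) \<le> \<epsilon> * (normB g * normB h)"
proof (cases "g = (\<lambda>_. 0) \<or> h = (\<lambda>_. 0)")
  case True
  have gB: "g \<in> B" and hB: "h \<in> B" using g h Bh by auto
  have s: "SL g \<in> H1D \<Omega> \<Gamma>D" "P (SL g) \<in> H1D \<Omega> \<Gamma>D" "SL h \<in> H1D \<Omega> \<Gamma>D"
    using gB hB by (auto intro: galerkin_H1D single_layer_mem)
  have "\<l> (SL h) (SL g) - \<l> (SL h) (P (SL g)) = 0"
    using True
  proof
    assume "h = (\<lambda>_. 0)"
    then show ?thesis using hB s by (simp add: single_layer_eq)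
  next
    assume "g = (\<lambda>_. 0)"
    then have "\<l> (SL g) w = 0" if "w \<in> H1D \<Omega> \<Gamma>D" for w using single_layer_eq[OF gB that] by simp
    then have z: "\<l> (SL g) (SL g) = 0" "\<l> (P (SL g)) (P (SL g)) = 0"
      using s galerkin_eq[OF s(1) galerkin_mem[OF s(1)]] by auto
    then show ?thesis using form_null[OF s(3)] null_if_test_zero s by simp
  qed
  then show ?thesis using \<epsilon> dual_norm_ge gB hB by simp
next
  case False
  have gB: "g \<in> B" and hB: "h \<in> B" using g h Bh by auto
  have pos: "0 < normB g" "0 < normB h"
    using dual_norm_eq_0D[OF gB] dual_norm_eq_0D[OF hB] dual_norm_ge[OF gB] dual_norm_ge[OF hB] False by force+
  have s: "SL g \<in> H1D \<Omega> \<Gamma>D" "P (SL g) \<in> H1D \<Omega> \<Gamma>D" "SL h \<in> H1D \<Omega> \<Gamma>D"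
    using gB hB by (auto intro: galerkin_H1D single_layer_mem)
  let ?p = "pairing_XB (\<lambda>x. single_layer_operator \<Omega> \<Gamma>D \<l> S g x - discrete_single_layer_operator \<Omega> \<Gamma>D \<l> S Vd g x) (cnj_functional h)"
  have "has_trace \<Omega> S (\<lambda>x. SL g x - P (SL g) x)
      (\<lambda>x. single_layer_operator \<Omega> \<Gamma>D \<l> S g x - discrete_single_layer_operator \<Omega> \<Gamma>D \<l> S Vd g x)"
    using has_trace_lin[OF borel_S has_trace_dirichlet_trace[OF s(1)] has_trace_dirichlet_trace[OF s(2)], of 1 "-1"]
    by (simp add: single_layer_operator_def discrete_single_layer_operator_def)
  from pairing_eq[OF hB V.diff_mem[OF s(1,2)] this]
  have p: "norm ?p = norm (\<l> (SL h) (SL g) - \<l> (SL h) (P (SL g)))"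
    using sesquilinear_on_diff(2)[OF sesq s] by (simp only: complex_mod_cnj)
  have "ennreal (norm ?p / (normB g * normB h)) \<le> consistency_error \<Omega> \<Gamma>D \<l> S Vd Bh"
    unfolding consistency_error_def using g h False by (intro SUP_upper2[of "(g, h)"]) auto
  also note err
  finally have "norm ?p / (normB g * normB h) \<le> \<epsilon>" using \<epsilon> by (simp add: ennreal_le_iff)
  then show ?thesis using pos p by (simp add: pos_divide_le_eq mult.commute)
qed

end

locale discrete_problem = galerkin \<Omega> \<Gamma>D S \<l> K cL Vd
  for \<Omega> \<Gamma>D S :: "(real ^ 'n) set" and \<l> K cL Vd +
  fixes Bh f b
  assumes Bh: "finite_dim_subspace Bh (Hm12 \<Omega> \<Gamma>D S)"
    and b: "b \<in> Hm12 \<Omega> \<Gamma>D S"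
    and f: "has_trace \<Omega> S (single_layer_potential \<Omega> \<Gamma>D \<l> S b) f"
    and err: "consistency_error \<Omega> \<Gamma>D \<l> S Vd Bh \<le> ennreal (cL / (2 * K\<^sup>2))"
begin

lemma Bh_space: "function_space Bh" and Bh_subset: "Bh \<subseteq> B"
  using Bh fun_span_space B.fun_span_subset by (auto simp: finite_dim_subspace_eq)

lemma stability:
  assumes g: "g \<in> Bh"
  shows "cL / (2 * K\<^sup>2) * (normB g)\<^sup>2 \<le> norm (discrete_form g g)"
proof -
  have gB: "g \<in> B" using g Bh_subset by blast
  have "(normB g)\<^sup>2 \<le> (K * H1_norm \<Omega> (SL g))\<^sup>2"
    using dual_norm_le_single_layer[OF gB] dual_norm_ge[OF gB] by (intro power_mono)
  then have "cL / K\<^sup>2 * (normB g)\<^sup>2 \<le> cL / K\<^sup>2 * (K * H1_norm \<Omega> (SL g))\<^sup>2"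
    using cL by (intro mult_left_mono) auto
  also have "\<dots> = cL * (H1_norm \<Omega> (SL g))\<^sup>2" using K by (simp add: power_mult_distrib)
  also have "\<dots> \<le> norm (\<l> (SL g) (SL g))" using coercive[OF single_layer_mem[OF gB]] .
  also have "\<dots> \<le> norm (\<l> (SL g) (P (SL g))) + norm (\<l> (SL g) (SL g) - \<l> (SL g) (P (SL g)))"
    by (rule norm_triangle_sub)
  also have "\<dots> \<le> norm (discrete_form g g) + cL / (2 * K\<^sup>2) * (normB g)\<^sup>2"
    using consistency_errorD[OF g g Bh_subset _ err] cL by (simp add: discrete_form_eq(2) gB power2_eq_square[of "normB g"])
  finally have "cL / K\<^sup>2 * (normB g)\<^sup>2 \<le> norm (discrete_form g g) + cL / (2 * K\<^sup>2) * (normB g)\<^sup>2" .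
  moreover have "cL / K\<^sup>2 * (normB g)\<^sup>2 = 2 * (cL / (2 * K\<^sup>2) * (normB g)\<^sup>2)" by simp
  ultimately show ?thesis by linarith
qed

lemma discrete_solution_iff:
  "discrete_solution \<Omega> \<Gamma>D \<l> S Vd Bh f bh \<longleftrightarrow>
    bh \<in> Bh \<and> (\<forall>g\<in>Bh. discrete_form bh g = cnj (\<l> (SL g) (SL b)))"
proof -
  have "pairing_XB f (cnj_functional g) = cnj (\<l> (SL g) (SL b))" if "g \<in> Bh" for g
    using that Bh_subset pairing_eq[OF _ single_layer_mem[OF b] f] by blast
  moreover have "pairing_XB (discrete_single_layer_operator \<Omega> \<Gamma>D \<l> S Vd bh) (cnj_functional g) = discrete_form bh g"
    if "bh \<in> Bh" "g \<in> Bh" for g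
    using that Bh_subset by (intro discrete_form_eq(1)) auto
  ultimately show ?thesis unfolding discrete_solution_def by auto
qed

lemma discrete_form_definite:
  assumes "g \<in> Bh" "discrete_form g g = 0"
  shows "g = (\<lambda>t. 0)"
proof -
  have "(normB g)\<^sup>2 \<le> 0" using stability[OF assms(1)] assms(2) cL K by (simp add: mult_le_0_iff divide_le_0_iff)
  then show ?thesis using assms(1) Bh_subset by (intro dual_norm_eq_0D) auto
qed

theorem discrete_solution_ex1: "\<exists>!bh. discrete_solution \<Omega> \<Gamma>D \<l> S Vd Bh f bh"
proof -
  interpret Bh: function_space Bh by (rule Bh_space)
  have sq: "sesquilinear_on Bh discrete_form"
    using discrete_form_sesquilinear Bh_subset by (rule sesquilinear_on_subset)
  obtain F where F: "finite F" "F \<subseteq> B" "Bh = fun_span F" using Bh by (auto simp: finite_dim_subspace_eq)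
  have "\<exists>u\<in>fun_span F. \<forall>g\<in>fun_span F. discrete_form u g = cnj (\<l> (SL g) (SL b))"
  proof (rule Bh.finite_dim_solve[OF F(1) _ sq])
    show "F \<subseteq> Bh" using fun_span_superset F by blast
    have eq: "cnj (\<l> (SL g) (SL b)) = cnj (g (\<gamma> (cnj_fun (SL b))))" if "g \<in> B" for g
      using single_layer_eq[OF that single_layer_mem[OF b]] by simp
    show "antilinear_on Bh (\<lambda>g. cnj (\<l> (SL g) (SL b)))"
      unfolding antilinear_on_def
    proof (intro ballI allI)
      fix g h p q assume "g \<in> Bh" "h \<in> Bh"
      then have "g \<in> B" "h \<in> B" using Bh_subset by auto
      then show "cnj (\<l> (SL (\<lambda>t. p * g t + q * h t)) (SL b)) = cnj p * cnj (\<l> (SL g) (SL b)) + cnj q * cnj (\<l> (SL h) (SL b))"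
        by (simp add: eq B.lin_mem)
    qed
    fix g assume g: "g \<in> Bh" "discrete_form g g = 0"
    then have g0: "g = (\<lambda>t. 0)" by (rule discrete_form_definite)
    then show "cnj (\<l> (SL g) (SL b)) = 0 \<and> (\<forall>u\<in>Bh. discrete_form u g = 0)"
      using eq[of g] g(1) Bh_subset by (auto simp: discrete_form_def)
  qed
  then obtain u where u: "discrete_solution \<Omega> \<Gamma>D \<l> S Vd Bh f u"
    unfolding discrete_solution_iff using F(3) by blast
  moreover have "v = u" if v: "discrete_solution \<Omega> \<Gamma>D \<l> S Vd Bh f v" for v
  proof -
    have uB: "u \<in> Bh" and vB: "v \<in> Bh" using u v by (auto simp: discrete_solution_iff)
    let ?e = "\<lambda>t. v t - u t"
    have e: "?e \<in> Bh" using vB uB by (rule Bh.diff_mem)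
    have "discrete_form ?e ?e = discrete_form v ?e - discrete_form u ?e"
      using sesquilinear_on_diff(1)[OF sq vB uB e] .
    also have "\<dots> = 0" using u v e by (simp add: discrete_solution_iff)
    finally have "?e = (\<lambda>t. 0)" by (rule discrete_form_definite[OF e])
    then show ?thesis by (simp add: fun_eq_iff)
  qed
  ultimately show ?thesis by blast
qed

definition quasi_const :: real where
  "quasi_const = 2 * K\<^sup>2 / cL * (K / cL)"

lemma discrete_error:
  assumes bh: "discrete_solution \<Omega> \<Gamma>D \<l> S Vd Bh f bh" and g: "g \<in> Bh" and vd: "vd \<in> Vd"
  shows "normB (\<lambda>t. b t - bh t) \<le> (1 + quasi_const + quasi_const / cL) *
    (normB (\<lambda>t. b t - g t) + H1_norm \<Omega> (\<lambda>x. SL b x - vd x))"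
proof -
  interpret Bh: function_space Bh by (rule Bh_space)
  have bhB: "bh \<in> Bh" using bh by (simp add: discrete_solution_iff)
  let ?e = "\<lambda>t. g t - bh t"
  have e: "?e \<in> Bh" using g bhB by (rule Bh.diff_mem)
  have mB: "g \<in> B" "bh \<in> B" "?e \<in> B" using g bhB e Bh_subset by auto
  note m = single_layer_mem[OF b] single_layer_mem[OF mB(1)] single_layer_mem[OF mB(3)]
  note p = galerkin_H1D[OF m(1)] galerkin_H1D[OF m(2)]
  define X where "X = normB (\<lambda>t. b t - g t)"
  define Y where "Y = H1_norm \<Omega> (\<lambda>x. SL b x - vd x)"
  have X: "0 \<le> X" using dual_norm_ge[OF B.diff_mem[OF b mB(1)]] by (simp add: X_def)
  have Y: "0 \<le> Y" by (simp add: Y_def H1_norm_ge)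
  have D: "0 \<le> quasi_const" using K cL by (simp add: quasi_const_def)
  let ?d = "\<lambda>x. P (SL g) x - SL b x"
  have d: "?d \<in> H1D \<Omega> \<Gamma>D" using p m by (intro V.diff_mem)
  have "discrete_form ?e ?e = discrete_form g ?e - discrete_form bh ?e"
    using sesquilinear_on_diff(1)[OF discrete_form_sesquilinear mB] .
  also have "discrete_form bh ?e = cnj (\<l> (SL ?e) (SL b))" using bh e by (simp add: discrete_solution_iff)
  also have "discrete_form g ?e - cnj (\<l> (SL ?e) (SL b)) = cnj (\<l> (SL ?e) ?d)"
    using sesquilinear_on_diff(2)[OF sesq p(2) m(1) m(3)] discrete_form_eq(2)[OF mB(1) mB(3)] by simp
  finally have "norm (discrete_form ?e ?e) = norm (\<l> (SL ?e) ?d)" by simp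
  also have "\<dots> \<le> normB ?e * H1_norm \<Omega> ?d" using single_layer_form_le[OF mB(3) d] .
  finally have "cL / (2 * K\<^sup>2) * (normB ?e)\<^sup>2 \<le> H1_norm \<Omega> ?d * normB ?e"
    using stability[OF e] by (simp add: mult.commute)
  then have stab: "cL / (2 * K\<^sup>2) * normB ?e \<le> H1_norm \<Omega> ?d"
    using dual_norm_ge[OF mB(3)] H1_norm_ge by (rule cancel_le)
  have "H1_norm \<Omega> ?d \<le> H1_norm \<Omega> (\<lambda>x. P (SL g) x - P (SL b) x) + H1_norm \<Omega> (\<lambda>x. P (SL b) x - SL b x)"
    using p m by (intro H1_norm_triangle H1D_H1)
  also have "H1_norm \<Omega> (\<lambda>x. P (SL g) x - P (SL b) x) = H1_norm \<Omega> (\<lambda>x. P (SL b) x - P (SL g) x)"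
    using p by (intro H1_norm_minus_commute H1D_H1)
  also have "\<dots> \<le> K / cL * (X / cL)"
  proof -
    have "cL * H1_norm \<Omega> (\<lambda>x. P (SL b) x - P (SL g) x) \<le> K * H1_norm \<Omega> (\<lambda>x. SL b x - SL g x)"
      using m by (intro galerkin_diff_le)
    also have "\<dots> \<le> K * (X / cL)"
      using single_layer_diff_le[OF b mB(1)] K cL
      by (intro mult_left_mono) (auto simp: X_def pos_le_divide_eq mult.commute)
    finally show ?thesis using cL by (simp add: pos_le_divide_eq mult.commute)
  qed
  also have "H1_norm \<Omega> (\<lambda>x. P (SL b) x - SL b x) = H1_norm \<Omega> (\<lambda>x. SL b x - P (SL b) x)"
    using p m by (intro H1_norm_minus_commute H1D_H1)
  also have "\<dots> \<le> K / cL * Y"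
    using cea[OF m(1) vd] cL by (simp add: Y_def pos_le_divide_eq mult.commute)
  finally have "cL / (2 * K\<^sup>2) * normB ?e \<le> K / cL * (X / cL + Y)"
    using stab by (simp add: distrib_left)
  then have "2 * K\<^sup>2 / cL * (cL / (2 * K\<^sup>2) * normB ?e) \<le> 2 * K\<^sup>2 / cL * (K / cL * (X / cL + Y))"
    using cL by (intro mult_left_mono) auto
  then have e_le: "normB ?e \<le> quasi_const * (X / cL + Y)"
    using cL K by (simp add: quasi_const_def mult.assoc)
  have "normB (\<lambda>t. b t - bh t) \<le> X + normB ?e"
    using dual_norm_triangle[OF B.diff_mem[OF b mB(1)] mB(3)] by (simp add: X_def)
  also have "\<dots> \<le> X + quasi_const * (X / cL + Y)" using e_le by simp
  also have "\<dots> \<le> (1 + quasi_const + quasi_const / cL) * (X + Y)"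
  proof -
    have "(1 + quasi_const + quasi_const / cL) * (X + Y)
        = (X + quasi_const * (X / cL + Y)) + (Y + quasi_const * X + quasi_const / cL * Y)"
      by (simp add: algebra_simps add_divide_distrib)
    moreover have "0 \<le> Y + quasi_const * X + quasi_const / cL * Y" using X Y D cL by simp
    ultimately show ?thesis by linarith
  qed
  finally show ?thesis by (simp add: X_def Y_def)
qed

theorem quasi_optimality:
  assumes bh: "discrete_solution \<Omega> \<Gamma>D \<l> S Vd Bh f bh"
  shows "inverse (1 + quasi_const + quasi_const / cL) * normB (\<lambda>t. b t - bh t)
    \<le> (INF g\<in>Bh. normB (\<lambda>t. b t - g t)) + (INF vd\<in>Vd. H1_norm \<Omega> (\<lambda>x. SL b x - vd x))"
proof -
  define C where "C = 1 + quasi_const + quasi_const / cL"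
  have C: "0 < C" using K cL by (simp add: C_def quasi_const_def add_pos_nonneg)
  define E where "E = inverse C * normB (\<lambda>t. b t - bh t)"
  have le: "E \<le> normB (\<lambda>t. b t - g t) + H1_norm \<Omega> (\<lambda>x. SL b x - vd x)" if "g \<in> Bh" "vd \<in> Vd" for g vd
  proof -
    have "normB (\<lambda>t. b t - bh t) / C \<le> normB (\<lambda>t. b t - g t) + H1_norm \<Omega> (\<lambda>x. SL b x - vd x)"
      unfolding pos_divide_le_eq[OF C] using discrete_error[OF bh that] by (simp only: C_def mult.commute)
    then show ?thesis by (simp add: E_def divide_inverse mult.commute)
  qed
  have ne: "Bh \<noteq> {}" "Vd \<noteq> {}"
    using function_space.zero_mem[OF Bh_space] function_space.zero_mem[OF Vd_space] by auto
  have "E - normB (\<lambda>t. b t - g t) \<le> (INF vd\<in>Vd. H1_norm \<Omega> (\<lambda>x. SL b x - vd x))" if "g \<in> Bh" for g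
    using ne(2) le[OF that] by (intro cINF_greatest) (auto simp: algebra_simps)
  then have "E - (INF vd\<in>Vd. H1_norm \<Omega> (\<lambda>x. SL b x - vd x)) \<le> (INF g\<in>Bh. normB (\<lambda>t. b t - g t))"
    using ne(1) by (intro cINF_greatest) (auto simp: algebra_simps)
  then show ?thesis by (simp add: E_def C_def)
qed

end

lemma isolated_boundary_component_closed:
  assumes "isolated_boundary_component S \<Gamma>"
  shows "closed \<Gamma>"
proof -
  obtain \<delta> where \<Gamma>: "\<Gamma> \<subseteq> frontier S" "0 < \<delta>" "\<And>x y. x \<in> frontier S - \<Gamma> \<Longrightarrow> y \<in> \<Gamma> \<Longrightarrow> \<delta> \<le> dist x y"
    using assms by (auto simp: isolated_boundary_component_def)
  have "closure \<Gamma> \<subseteq> \<Gamma>"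
  proof
    fix x assume x: "x \<in> closure \<Gamma>"
    then have "x \<in> frontier S" using \<Gamma>(1) closure_minimal[OF _ frontier_closed] by blast
    moreover obtain y where "y \<in> \<Gamma>" "dist y x < \<delta>" using x \<Gamma>(2) by (auto simp: closure_approachable)
    ultimately show "x \<in> \<Gamma>" using \<Gamma>(3)[of x y] by (auto simp: dist_commute)
  qed
  then show ?thesis using closure_subset_eq by blast
qed

theorem theoremA:
  fixes \<Omega> \<Gamma>D :: "(real ^ 'n) set"
    and A :: "real ^ 'n \<Rightarrow> complex ^ 'n ^ 'n"
    and bv :: "real ^ 'n \<Rightarrow> complex ^ 'n"
    and c :: "real ^ 'n \<Rightarrow> complex"
    and G :: "(real ^ 'n \<Rightarrow> complex) \<Rightarrow> (real ^ 'n \<Rightarrow> complex) \<Rightarrow> complex"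
    and \<l> :: "'n form"
  assumes dim: "CARD('n) \<ge> 2"
    and domain: "lipschitz_domain \<Omega>"
    and \<Gamma>D: "\<Gamma>D \<subseteq> frontier \<Omega>" "closedin (top_of_set (frontier \<Omega>)) \<Gamma>D"
    and A: "A \<in> L_infinity \<Omega>" "AE x in lebesgue_on \<Omega>. hermitian (A x)"
    and bv: "bv \<in> L_infinity \<Omega>"
    and c: "c \<in> L_infinity \<Omega>"
    and G: "bounded_operator_Hm12 \<Omega> \<Gamma>D (frontier \<Omega> - \<Gamma>D) G"
    and elliptic: "\<exists>amin>0. AE x in lebesgue_on \<Omega>. \<forall>\<xi> :: complex ^ 'n.
        amin * (norm \<xi>)\<^sup>2 \<le> Re (cdot (\<chi> i. cnj (\<xi> $ i)) (A x *v \<xi>))"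
    and \<l>_def: "\<l> = elliptic_form \<Omega> \<Gamma>D A bv c G"
    and coercive: "\<exists>cL>0. \<forall>v\<in>H1D \<Omega> \<Gamma>D. norm (\<l> v v) \<ge> cL * (H1_norm \<Omega> v)\<^sup>2"
  shows "\<exists>\<epsilon>L>0. \<exists>Cqb>0. \<forall>\<Sigma> Vd Bh f b.
    admissible_interface \<Omega> \<Gamma>D \<Sigma> \<longrightarrow>
    finite_dim_subspace Vd (H1D \<Omega> \<Gamma>D) \<longrightarrow>
    finite_dim_subspace Bh (Hm12 \<Omega> \<Gamma>D \<Sigma>) \<longrightarrow>
    f \<in> Hp12 \<Omega> \<Gamma>D \<Sigma> \<longrightarrow>
    b \<in> Hm12 \<Omega> \<Gamma>D \<Sigma> \<longrightarrow>
    (AE x in surface_measure. x \<in> \<Sigma> \<longrightarrow> single_layer_operator \<Omega> \<Gamma>D \<l> \<Sigma> b x = f x) \<longrightarrow>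
    consistency_error \<Omega> \<Gamma>D \<l> \<Sigma> Vd Bh \<le> ennreal \<epsilon>L \<longrightarrow>
    (\<exists>!bh. discrete_solution \<Omega> \<Gamma>D \<l> \<Sigma> Vd Bh f bh) \<and>
    (\<forall>bh. discrete_solution \<Omega> \<Gamma>D \<l> \<Sigma> Vd Bh f bh \<longrightarrow>
       inverse Cqb * Hm12_norm \<Omega> \<Gamma>D \<Sigma> (\<lambda>t. b t - bh t)
         \<le> (INF g\<in>Bh. Hm12_norm \<Omega> \<Gamma>D \<Sigma> (\<lambda>t. b t - g t)) +
           (INF vd\<in>Vd. H1_norm \<Omega> (\<lambda>x. single_layer_potential \<Omega> \<Gamma>D \<l> \<Sigma> b x - vd x)))"
proof -
  have lip: "lipschitz_set \<Omega>" using domain by (simp add: lipschitz_domain_def)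
  have "closed \<Gamma>D" using \<Gamma>D(2) by (simp add: closedin_closed_eq)
  then interpret D: sobolev_dirichlet \<Omega> \<Gamma>D
    using lip by unfold_locales (auto simp: lipschitz_set_def)
  have \<Gamma>N: "frontier \<Omega> - \<Gamma>D \<in> sets borel" using \<open>closed \<Gamma>D\<close> by (auto intro: borel_closed)
  interpret E: elliptic_form_data \<Omega> \<Gamma>D A bv c G
    using A(1) bv c G \<Gamma>N D.H1D_trace_exists[OF dim lip subset_refl Diff_subset \<Gamma>N]
    by unfold_locales auto
  obtain cL where cL: "0 < cL" "\<And>v. v \<in> H1D \<Omega> \<Gamma>D \<Longrightarrow> cL * (H1_norm \<Omega> v)\<^sup>2 \<le> norm (\<l> v v)"
    using coercive by blast
  from E.elliptic_form_bounded obtain K0 where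
    K0: "\<forall>v\<in>H1D \<Omega> \<Gamma>D. \<forall>w\<in>H1D \<Omega> \<Gamma>D. norm (\<l> v w) \<le> K0 * D.V.nrm v * D.V.nrm w"
    unfolding \<l>_def by (elim exE)
  define K where "K = \<bar>K0\<bar> + 1"
  have K: "norm (\<l> v w) \<le> K * H1_norm \<Omega> v * H1_norm \<Omega> w" if "v \<in> H1D \<Omega> \<Gamma>D" "w \<in> H1D \<Omega> \<Gamma>D" for v w
  proof -
    have "norm (\<l> v w) \<le> K0 * (H1_norm \<Omega> v * H1_norm \<Omega> w)"
      using K0 that by (simp add: D.nrm_eq D.H1D_H1 mult.assoc)
    also have "\<dots> \<le> K * (H1_norm \<Omega> v * H1_norm \<Omega> w)"
      by (intro mult_right_mono mult_nonneg_nonneg D.H1_norm_ge) (simp add: K_def)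
    finally show ?thesis by (simp add: mult.assoc)
  qed
  have Kpos: "0 < K" by (simp add: K_def)
  define D where "D = 2 * K\<^sup>2 / cL * (K / cL)"
  have pos: "0 < cL / (2 * K\<^sup>2)" "0 < 1 + D + D / cL"
    using Kpos cL(1) by (auto simp: D_def intro!: add_pos_nonneg)
  show ?thesis
  proof (rule exI[of _ "cL / (2 * K\<^sup>2)"], rule conjI[OF pos(1)], rule exI[of _ "1 + D + D / cL"],
      rule conjI[OF pos(2)], intro allI impI conjI)
    fix \<Sigma> Vd Bh f b
    assume adm: "admissible_interface \<Omega> \<Gamma>D \<Sigma>" and Vd: "finite_dim_subspace Vd (H1D \<Omega> \<Gamma>D)"
      and Bh: "finite_dim_subspace Bh (Hm12 \<Omega> \<Gamma>D \<Sigma>)" and f: "f \<in> Hp12 \<Omega> \<Gamma>D \<Sigma>" and b: "b \<in> Hm12 \<Omega> \<Gamma>D \<Sigma>"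
      and Vb: "AE x in surface_measure. x \<in> \<Sigma> \<longrightarrow> single_layer_operator \<Omega> \<Gamma>D \<l> \<Sigma> b x = f x"
      and err: "consistency_error \<Omega> \<Gamma>D \<l> \<Sigma> Vd Bh \<le> ennreal (cL / (2 * K\<^sup>2))"
    obtain S0 where S0: "lipschitz_set S0" "S0 \<subseteq> \<Omega>" "isolated_boundary_component S0 \<Sigma>"
      using adm by (auto simp: admissible_interface_def lipschitz_interface_def)
    have \<Sigma>: "\<Sigma> \<in> sets borel" "\<Sigma> \<subseteq> frontier S0"
      using isolated_boundary_component_closed[OF S0(3)] S0(3)
      by (auto simp: isolated_boundary_component_def intro: borel_closed)
    interpret L: layer_potentials \<Omega> \<Gamma>D \<Sigma> \<l> K cL
      using \<Sigma>(1) D.H1D_trace_exists[OF dim S0(1,2) \<Sigma>(2,1)] E.elliptic_form_sesquilinear K cL Kpos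
      by unfold_locales (auto simp: \<l>_def)
    have "f \<in> borel_measurable borel"
      using f D.has_traceD(2) by (auto simp: trace_space_def)
    with L.has_trace_dirichlet_trace[OF L.single_layer_mem[OF b]]
    have "has_trace \<Omega> \<Sigma> (single_layer_potential \<Omega> \<Gamma>D \<l> \<Sigma> b) f"
      using Vb unfolding single_layer_operator_def by (rule D.has_trace_cong_AE)
    then interpret P: discrete_problem \<Omega> \<Gamma>D \<Sigma> \<l> K cL Vd Bh f b
      using Vd Bh b err by unfold_locales auto
    have D: "D = P.quasi_const" by (simp add: D_def P.quasi_const_def)
    show "\<exists>!bh. discrete_solution \<Omega> \<Gamma>D \<l> \<Sigma> Vd Bh f bh" by (rule P.discrete_solution_ex1)
    show "inverse (1 + D + D / cL) * Hm12_norm \<Omega> \<Gamma>D \<Sigma> (\<lambda>t. b t - bh t)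
         \<le> (INF g\<in>Bh. Hm12_norm \<Omega> \<Gamma>D \<Sigma> (\<lambda>t. b t - g t)) +
           (INF vd\<in>Vd. H1_norm \<Omega> (\<lambda>x. single_layer_potential \<Omega> \<Gamma>D \<l> \<Sigma> b x - vd x))"
      if "discrete_solution \<Omega> \<Gamma>D \<l> \<Sigma> Vd Bh f bh" for bh
      unfolding D using that by (rule P.quasi_optimality)
  qed
qed

end
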